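(* Let $m\ge 1$ be an integer, and for each $k\in\{1,\dots,m\}$ let $b_k,p_k,t_k$ be integers with $|b_k|\ge 2$, $p_k\ge 2$, $|t_k|\ge 1$, such that for every $k\in\{1,\dots,m\}$ the integers $p_k,t_1,t_2,\dots,t_m$ are pairwise coprime. Put $D_k=\{0,1,\dots,p_k-1\}t_k=\{0,t_k,2t_k,\dots,(p_k-1)t_k\}$. Let $\Sigma^{(m)}=\{1,2,\dots,m\}^{\mathbb N}$ and, for $\sigma=(\sigma_n)_{n=1}^\infty\in\Sigma^{(m)}$, let $$\mu_\sigma=\delta_{b_{\sigma_1}^{-1}D_{\sigma_1}}*\delta_{(b_{\sigma_1}b_{\sigma_2})^{-1}D_{\sigma_2}}*\delta_{(b_{\sigma_1}b_{\sigma_2}b_{\sigma_3})^{-1}D_{\sigma_3}}*\cdots .$$ For $l\ge 1$ let $$\Pi_l=\{i_1i_2\cdots i_l j^\infty\in\Sigma^{(m)}: i_l\ne j,\ |b_j|=p_j,\ |t_j|\ne 1\}.$$ Then for every $\sigma\in\Sigma^{(m)}$, the measure $\mu_\sigma$ is a spectral measure if and only if $p_{\sigma_n}\mid b_{\sigma_n}$ for all $n\ge 2$ and $\sigma\notin\bigcup_{l=1}^\infty \Pi_l$.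
   Context: For a finite nonempty set $E\subset\mathbb R$, $\delta_E=\frac1{\#E}\sum_{e\in E}\delta_e$, where $\delta_e$ is the Dirac point mass at $e$; $*$ denotes convolution. The infinite convolution is the weak limit of its finite partial convolutions; here it exists and is a compactly supported Borel probability measure. The word $i_1\cdots i_l j^\infty$ is the infinite word beginning with $i_1\cdots i_l$ followed by the symbol $j$ repeated forever. A compactly supported Borel probability measure $\mu$ on $\mathbb R$ is a spectral measure if there is a countable discrete set $\Lambda\subset\mathbb R$ (a spectrum of $\mu$) such that $\{e^{2\pi i\lambda x}:\lambda\in\Lambda\}$ is an orthogonal basis of $L^2(\mu)$. *)

theory Defs
  imports "HOL-Probability.Probability"
begin

definition unif :: "real set \<Rightarrow> real measure" where
  "unif E = distr (measure_pmf (pmf_of_set E)) borel (\<lambda>x. x)"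

text \<open>The measure \<^term>\<open>unif E\<close> is the normalised sum of the Dirac masses
  at the points of a finite nonempty set \<^term>\<open>E\<close>.\<close>

lemma emeasure_unif:
  assumes "finite E" "E \<noteq> {}" "A \<in> sets borel"
  shows "emeasure (unif E) A = ennreal (1 / card E) * (\<Sum>e\<in>E. emeasure (return borel e) A)"
proof -
  have "emeasure (unif E) A = ennreal (card (E \<inter> A) / card E)"
    using assms by (simp add: unif_def emeasure_distr emeasure_pmf_of_set)
  also have "\<dots> = ennreal (1 / card E) * ennreal (card (E \<inter> A))"
    by (subst ennreal_mult[symmetric]) auto
  also have "ennreal (card (E \<inter> A)) = (\<Sum>e\<in>E. emeasure (return borel e) A)"
    using assms by (simp add: indicator_def sum.If_cases ennreal_of_nat_eq_real_of_nat Int_def)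
  finally show ?thesis .
qed

text \<open>The \<open>n\<close>-th partial convolution \<open>\<nu> 1 \<star> \<dots> \<star> \<nu> n\<close>; the Dirac mass at \<open>0\<close> is
  the unit of convolution.\<close>

primrec partial_conv :: "(nat \<Rightarrow> real measure) \<Rightarrow> nat \<Rightarrow> real measure" where
  "partial_conv \<nu> 0 = return borel 0"
| "partial_conv \<nu> (Suc n) = (partial_conv \<nu> n \<star> \<nu> (Suc n))"

text \<open>Weak limits of Borel probability measures are unique, so the description below
  denotes the infinite convolution as soon as it exists.\<close>

definition inf_conv :: "(nat \<Rightarrow> real measure) \<Rightarrow> real measure" where
  "inf_conv \<nu> = (THE M. real_distribution M \<and> weak_conv_m (partial_conv \<nu>) M)"

definition compactly_supported :: "real measure \<Rightarrow> bool" where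
  "compactly_supported M \<longleftrightarrow> (\<exists>K. compact K \<and> (AE x in M. x \<in> K))"

text \<open>Elements of \<open>L\<^sup>2(M)\<close> are represented by square-integrable functions.\<close>

definition L2_fun :: "real measure \<Rightarrow> (real \<Rightarrow> complex) set" where
  "L2_fun M = {f \<in> borel_measurable M. integrable M (\<lambda>x. (cmod (f x))\<^sup>2)}"

definition L2_inner :: "real measure \<Rightarrow> (real \<Rightarrow> complex) \<Rightarrow> (real \<Rightarrow> complex) \<Rightarrow> complex" where
  "L2_inner M f g = (LINT x|M. f x * cnj (g x))"

definition L2_norm :: "real measure \<Rightarrow> (real \<Rightarrow> complex) \<Rightarrow> real" where
  "L2_norm M f = sqrt (LINT x|M. (cmod (f x))\<^sup>2)"

definition expo :: "real \<Rightarrow> real \<Rightarrow> complex" where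
  "expo l x = exp (2 * of_real pi * \<i> * of_real l * of_real x)"

text \<open>An orthogonal basis of \<open>L\<^sup>2(M)\<close> is an orthogonal family whose finite linear combinations
  are dense. Exponentials have norm \<open>1\<close> in \<open>L\<^sup>2\<close> of a probability measure, so none of them
  vanishes.\<close>

definition is_spectrum :: "real measure \<Rightarrow> real set \<Rightarrow> bool" where
  "is_spectrum M \<Lambda> \<longleftrightarrow> countable \<Lambda> \<and> topological_space_class.discrete \<Lambda> \<and>
     (\<forall>l\<in>\<Lambda>. \<forall>l'\<in>\<Lambda>. l \<noteq> l' \<longrightarrow> L2_inner M (expo l) (expo l') = 0) \<and>
     (\<forall>f\<in>L2_fun M. \<forall>\<epsilon>>0. \<exists>F c. finite F \<and> F \<subseteq> \<Lambda> \<and>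
        L2_norm M (\<lambda>x. f x - (\<Sum>l\<in>F. c l * expo l x)) < \<epsilon>)"

definition spectral_measure :: "real measure \<Rightarrow> bool" where
  "spectral_measure M \<longleftrightarrow>
     real_distribution M \<and> compactly_supported M \<and> (\<exists>\<Lambda>. is_spectrum M \<Lambda>)"

text \<open>Words are indexed from \<open>1\<close>; extensionality fixes the irrelevant value at \<open>0\<close>.\<close>

definition words :: "nat \<Rightarrow> (nat \<Rightarrow> nat) set" where
  "words m = {1..} \<rightarrow>\<^sub>E {1..m}"

definition digits :: "int \<Rightarrow> int \<Rightarrow> int set" where
  "digits p t = (\<lambda>i. i * t) ` {0..p - 1}"

definition mu :: "(nat \<Rightarrow> int) \<Rightarrow> (nat \<Rightarrow> int) \<Rightarrow> (nat \<Rightarrow> int) \<Rightarrow> (nat \<Rightarrow> nat) \<Rightarrow> real measure" where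
  "mu b p t \<sigma> = inf_conv (\<lambda>n. unif
     ((\<lambda>d. inverse (\<Prod>k=1..n. of_int (b (\<sigma> k))) * of_int d) ` digits (p (\<sigma> n)) (t (\<sigma> n))))"

definition exceptional ::
    "nat \<Rightarrow> (nat \<Rightarrow> int) \<Rightarrow> (nat \<Rightarrow> int) \<Rightarrow> (nat \<Rightarrow> int) \<Rightarrow> nat \<Rightarrow> (nat \<Rightarrow> nat) set" where
  "exceptional m b p t l = {\<sigma> \<in> words m. \<exists>j\<in>{1..m}. (\<forall>n>l. \<sigma> n = j) \<and> \<sigma> l \<noteq> j \<and>
     \<bar>b j\<bar> = p j \<and> \<bar>t j\<bar> \<noteq> 1}"

end

theory Submission
  imports Defs "HOL-Computational_Algebra.Primes"
begin

text \<open>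
  The Fourier transform of \<open>\<mu>\<^sub>\<sigma>\<close> is an infinite product of Dirichlet kernels, and \<open>\<Lambda>\<close> is a spectrum iff the squared
  moduli of its translates by \<open>\<Lambda>\<close> sum to \<open>1\<close> everywhere.

  Necessity rests on one principle: if a convolution of uniform measures on arithmetic progressions has a spectrum, then a
  factor can be removed, and a spectrum of the remaining convolution is obtained by keeping, in each coset of a suitable
  lattice, any one residue class of the old spectrum. The freedom in this choice produces contradictions. Choosing
  points by an \<open>r\<close>-adic digit shows that no two factors with the same prime \<open>r\<close> have zeros of the same \<open>r\<close>-adic
  valuation, which gives \<open>p\<^sub>\<sigma>\<^sub>n dvd b\<^sub>\<sigma>\<^sub>n\<close>; for an exceptional word one reduces to \<open>i j\<^sup>\<infinity>\<close>, where the
  chosen points are integers up to a translation but would have to be a spectrum of an interval of length \<open>|t\<^sub>j| \<ge> 2\<close>.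

  For sufficiency, spectra of the finite convolutions are glued along infinitely many levels. The points of the
  next level may be translated by multiples of \<open>b\<^sub>\<sigma>\<^sub>1 \<cdots> b\<^sub>\<sigma>\<^sub>n\<close> so that the transform of the tail stays bounded away from \<open>0\<close>. This is
  possible at the levels where two adjacent symbols differ, or where the word has become constant with an
  admissible symbol, because no coset of the integers then consists of zeros of the tail. A constant word is rescaled to \<open>t = 1\<close>.
\<close>

section \<open>Products of Dirichlet kernels\<close>

text \<open>For sufficiency the obstacle is a loss of mass. At every finite level the squared moduli
  add up to 1, but the limit of these sums may be smaller, because points of late levels can come
  near zeros of the tail. Translating a point by \<kappa> times the product of the first n ratios
  leaves the first n kernels unchanged and moves the argument of the tail by the integer \<kappa>.
  So the only hopeless situation is a coset of the integers that consists of zeros of the tail. If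
  |b_j| = p_j and the word is constantly j from some place on, the zeros of the tail are exactly the
  nonzero multiples of 1 / t_j, and for |t_j| \<noteq> 1 the coset of 1 / t_j is hopeless. This is
  the origin of the exceptional words.

  For necessity the point is that all coefficients are rational. Hence all zeros are rational, a
  spectrum is rational up to a translation, and at an irrational point every kernel and every tail
  is nonzero. There a set that misses an orthogonal point, or that stays orthogonal after one factor
  too many is dropped, contradicts Bessel's inequality.\<close>

definition ker :: "nat \<Rightarrow> real \<Rightarrow> complex" where
  "ker q x = (\<Sum>k<q. expo (real k) x) / of_nat q"

definition ker_prod :: "(nat \<Rightarrow> real) \<Rightarrow> (nat \<Rightarrow> nat) \<Rightarrow> real \<Rightarrow> complex" where
  "ker_prod c q x = lim (\<lambda>N. \<Prod>n<N. ker (q n) (c n * x))"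

text \<open>\<open>q n * |c n|\<close> bounds the support of the \<open>n\<close>-th factor and, up
  to \<open>2 * pi\<close>, its Lipschitz constant. Summability therefore gives convergence of the
  product and a compact support.\<close>

definition admissible :: "(nat \<Rightarrow> real) \<Rightarrow> (nat \<Rightarrow> nat) \<Rightarrow> bool" where
  "admissible c q \<longleftrightarrow> (\<forall>n. 1 \<le> q n) \<and> summable (\<lambda>n. real (q n) * \<bar>c n\<bar>)"

lemma expo_cis: "expo l x = cis (2 * pi * (l * x))"
  by (simp add: expo_def cis_conv_exp mult_ac)

lemma expo_add: "expo l (x + y) = expo l x * expo l y"
  by (simp add: expo_cis cis_mult algebra_simps)

lemma expo_add_left: "expo (l + l') x = expo l x * expo l' x"
  by (simp add: expo_cis cis_mult algebra_simps)

lemma expo_0 [simp]: "expo l 0 = 1" "expo 0 x = 1"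
  by (simp_all add: expo_cis)

lemma norm_expo [simp]: "cmod (expo l x) = 1"
  by (simp add: expo_cis)

lemma cnj_expo: "cnj (expo l x) = expo (- l) x"
  by (simp add: expo_cis cis_cnj)

lemma expo_power: "expo (real k) x = expo 1 x ^ k"
  by (simp add: expo_cis Complex.DeMoivre mult_ac)

lemma expo_eq_1_iff: "expo 1 x = 1 \<longleftrightarrow> x \<in> \<int>"
proof
  assume "expo 1 x = 1"
  then have "exp (\<i> * of_real (2 * pi * x)) = 1" by (simp add: expo_cis cis_conv_exp)
  then obtain n :: int where "2 * pi * x = of_int (2 * n) * pi"
    by (auto simp: exp_eq_1)
  then have "x = of_int n" by simp
  then show "x \<in> \<int>" by simp
next
  assume "x \<in> \<int>"
  then obtain n where "x = of_int n" by (elim Ints_cases)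
  then show "expo 1 x = 1" by (simp add: expo_cis)
qed

lemma norm_iexp_minus_1: "cmod (iexp t - 1) \<le> \<bar>t\<bar>"
  using iexp_approx1[of t 0] by simp

lemma norm_expo_diff: "cmod (expo l x - expo l y) \<le> 2 * pi * \<bar>l\<bar> * \<bar>x - y\<bar>"
proof -
  have "expo l x = expo l y * expo l (x - y)"
    by (simp add: expo_add[symmetric])
  moreover have "expo l (x - y) = iexp (2 * pi * l * (x - y))"
    by (simp add: expo_cis cis_conv_exp mult.assoc)
  ultimately have "expo l x - expo l y = expo l y * (iexp (2 * pi * l * (x - y)) - 1)"
    by (simp only: right_diff_distrib mult_1_right)
  then have "cmod (expo l x - expo l y) = cmod (iexp (2 * pi * l * (x - y)) - 1)"
    by (simp only: norm_mult norm_expo mult_1_left)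
  also have "\<dots> \<le> \<bar>2 * pi * l * (x - y)\<bar>"
    by (rule norm_iexp_minus_1)
  finally show ?thesis by (simp only: abs_mult abs_numeral abs_of_pos[OF pi_gt_zero])
qed

lemma ker_0 [simp]: "1 \<le> q \<Longrightarrow> ker q 0 = 1"
  by (simp add: ker_def)

lemma ker_1 [simp]: "ker 1 x = 1" "ker (Suc 0) x = 1"
  by (simp_all add: ker_def)

lemma norm_ker_le_1: "cmod (ker q x) \<le> 1"
proof (cases "q = 0")
  case False
  have "cmod (\<Sum>k<q. expo (real k) x) \<le> (\<Sum>k<q. 1)"
    by (rule sum_norm_le) simp
  with False show ?thesis by (simp add: ker_def norm_divide)
qed (simp add: ker_def)

lemma norm_ker_diff: "cmod (ker q x - ker q y) \<le> 2 * pi * real q * \<bar>x - y\<bar>"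
proof (cases "q = 0")
  case False
  have "cmod (\<Sum>k<q. expo (real k) x - expo (real k) y) \<le> (\<Sum>k<q. 2 * pi * real q * \<bar>x - y\<bar>)"
  proof (rule sum_norm_le)
    fix k assume "k \<in> {..<q}"
    then have "2 * pi * \<bar>real k\<bar> * \<bar>x - y\<bar> \<le> 2 * pi * real q * \<bar>x - y\<bar>"
      by (intro mult_right_mono mult_left_mono) auto
    then show "cmod (expo (real k) x - expo (real k) y) \<le> 2 * pi * real q * \<bar>x - y\<bar>"
      using norm_expo_diff[of "real k" x y] by linarith
  qed
  then have "cmod (\<Sum>k<q. expo (real k) x - expo (real k) y) / real q \<le> 2 * pi * real q * \<bar>x - y\<bar>"
    using False by (simp add: divide_le_eq mult.commute)
  moreover have "ker q x - ker q y = (\<Sum>k<q. expo (real k) x - expo (real k) y) / of_nat q"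
    by (simp add: ker_def sum_subtractf diff_divide_distrib)
  ultimately show ?thesis by (simp add: norm_divide)
qed (simp add: ker_def)

text \<open>The geometric sum with its denominator cleared, so that integral \<open>x\<close> is
  included.\<close>

lemma ker_mult_diff: "of_nat q * ker q x * (expo 1 x - 1) = expo 1 (real q * x) - 1"
proof (cases "q = 0")
  case False
  have "of_nat q * ker q x = (\<Sum>k<q. expo 1 x ^ k)"
    using False by (simp add: ker_def expo_power)
  moreover have "(\<Sum>k<q. expo 1 x ^ k) * (expo 1 x - 1) = expo 1 x ^ q - 1"
    by (cases "expo 1 x = 1") (simp_all add: geometric_sum)
  moreover have "expo 1 x ^ q = expo 1 (real q * x)"
    by (simp add: expo_cis Complex.DeMoivre mult_ac)
  ultimately show ?thesis by simp
qed (simp add: ker_def)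

lemma ker_eq_0_iff:
  assumes "1 \<le> q"
  shows "ker q x = 0 \<longleftrightarrow> real q * x \<in> \<int> \<and> x \<notin> \<int>"
proof (cases "x \<in> \<int>")
  case True
  then have "expo 1 x = 1" by (simp add: expo_eq_1_iff)
  then have "ker q x = 1" using assms by (simp add: ker_def expo_power)
  with True show ?thesis by simp
next
  case False
  then have "expo 1 x - 1 \<noteq> 0" by (simp add: expo_eq_1_iff)
  then have "ker q x = 0 \<longleftrightarrow> expo 1 (real q * x) - 1 = 0"
    using assms by (metis ker_mult_diff mult_eq_0_iff mult_zero_left of_nat_eq_0_iff not_one_le_zero)
  with False show ?thesis by (simp add: expo_eq_1_iff)
qed

text \<open>Each \<open>k < w * h\<close> is uniquely \<open>i + w * l\<close> with
  \<open>i < w\<close> and \<open>l < h\<close>. So a digit set of composite size is a sum of two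
  digit sets, and a block of digits can be split off at either end.\<close>

lemma ker_mult: "ker (w * h) x = ker w x * ker h (real w * x)"
proof -
  have "(\<Sum>k<w * h. expo (real k) x) = (\<Sum>k<w. expo (real k) x) * (\<Sum>l<h. expo (real l) (real w * x))"
  proof (induction h)
    case (Suc h)
    have "{..<w * Suc h} = {..<w * h} \<union> {w * h..<w * h + w}" by auto
    then have "(\<Sum>k<w * Suc h. expo (real k) x) =
        (\<Sum>k<w * h. expo (real k) x) + (\<Sum>k\<in>{w * h..<w * h + w}. expo (real k) x)"
      by (simp add: sum.union_disjoint[symmetric] ivl_disj_int)
    also have "(\<Sum>k\<in>{w * h..<w * h + w}. expo (real k) x) = (\<Sum>k<w. expo (real (w * h + k)) x)"
      using sum.shift_bounds_nat_ivl[of "\<lambda>k. expo (real k) x" 0 "w * h" w]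
      by (simp add: atLeast0LessThan add.commute)
    also have "\<dots> = (\<Sum>k<w. expo (real k) x) * expo (real h) (real w * x)"
      unfolding sum_distrib_right by (intro sum.cong refl) (simp add: expo_cis cis_mult algebra_simps)
    finally show ?case by (simp only: Suc sum.lessThan_Suc distrib_left)
  qed simp
  then show ?thesis by (simp add: ker_def)
qed

lemma ker_periodic: "k \<in> \<int> \<Longrightarrow> ker q (x + k) = ker q x"
  using expo_eq_1_iff[of k] by (simp add: ker_def expo_power expo_add)

lemma norm_ker_minus: "cmod (ker q (- x)) = cmod (ker q x)"
proof -
  have "ker q (- x) = cnj (ker q x)"
    by (simp add: ker_def expo_cis cis_cnj)
  then show ?thesis by simp
qed

text \<open>Already the first two summands, \<open>1\<close> and \<open>expo 1 x\<close>, point in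
  different directions.\<close>

lemma norm_ker_less_1:
  assumes "2 \<le> q" "x \<notin> \<int>"
  shows "cmod (ker q x) < 1"
proof -
  have "cmod (1 + expo 1 x) < 2"
  proof (rule ccontr)
    assume "\<not> ?thesis"
    then have "4 \<le> (cmod (1 + expo 1 x))\<^sup>2" using power_mono[of 2 "cmod (1 + expo 1 x)" 2] by simp
    moreover have "(cmod (1 + expo 1 x))\<^sup>2 = 2 + 2 * cos (2 * pi * x)"
    proof -
      have "(cmod (1 + expo 1 x))\<^sup>2 = (1 + cos (2 * pi * x))\<^sup>2 + (sin (2 * pi * x))\<^sup>2"
        by (simp add: expo_cis cmod_power2)
      then show ?thesis
        using sin_cos_squared_add2[of "2 * pi * x"] by (simp only: power2_sum) simp
    qed
    ultimately have "cos (2 * pi * x) = 1" using cos_le_one[of "2 * pi * x"] by linarith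
    then have "expo 1 x = 1"
      using cos_one_sin_zero[of "2 * pi * x"] by (simp add: expo_cis complex_eq_iff)
    then show False using assms by (simp add: expo_eq_1_iff)
  qed
  moreover have "(\<Sum>k<q. expo (real k) x) = 1 + expo 1 x + (\<Sum>k\<in>{2..<q}. expo (real k) x)"
  proof -
    have "{..<q} = insert 0 (insert 1 {2..<q})" using assms by auto
    then show ?thesis by simp
  qed
  moreover have "cmod (\<Sum>k\<in>{2..<q}. expo (real k) x) \<le> (\<Sum>k\<in>{2..<q}. 1)"
    by (rule sum_norm_le) simp
  ultimately have "cmod (\<Sum>k<q. expo (real k) x) < real q"
    using norm_triangle_ineq[of "1 + expo 1 x" "\<Sum>k\<in>{2..<q}. expo (real k) x"] assms by (simp add: of_nat_diff)
  then show ?thesis using assms by (simp add: ker_def norm_divide)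
qed

text \<open>Parseval's identity on the integers modulo \<open>q\<close>: as \<open>s\<close> is a
  unit modulo \<open>q\<close>, the shifts \<open>s * j / q\<close> form a spectrum of the digits
  \<open>0, ..., q - 1\<close>. In the expanded squares the character sums \<open>w (k - l)\<close>
  vanish off the diagonal.\<close>

lemma sum_ker_shift:
  assumes "1 \<le> q" "coprime s (int q)"
  shows "(\<Sum>j<q. (cmod (ker q (x - of_int s * real j / real q)))\<^sup>2) = 1"
proof -
  have q: "real q \<noteq> 0" using assms by simp
  define w where "w d = (\<Sum>j<q. expo 1 (- of_int (d * s) * real j / real q))" for d :: int
  have w: "w d = (if int q dvd d then of_nat q else 0)" for d
  proof -
    let ?y = "- of_int (d * s) / real q"
    have "w d = (\<Sum>j<q. expo (real j) ?y)"
      unfolding w_def by (intro sum.cong refl) (simp add: expo_cis mult_ac)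
    then have wk: "w d = of_nat q * ker q ?y" using assms by (simp add: ker_def)
    have int: "real q * ?y \<in> \<int>" using q by simp
    have iff: "?y \<in> \<int> \<longleftrightarrow> int q dvd d"
    proof
      assume "?y \<in> \<int>"
      then obtain n where "?y = of_int n" by (elim Ints_cases)
      then have "of_int (- (d * s)) = (of_int (n * int q) :: real)" using q by (simp add: field_simps)
      then have "- (d * s) = n * int q" by linarith
      then have "int q dvd d * s" by (metis dvd_minus_iff dvd_triv_right)
      then show "int q dvd d" using assms coprime_dvd_mult_left_iff coprime_commute by blast
    next
      assume "int q dvd d"
      then obtain e where "d = int q * e" ..
      then show "?y \<in> \<int>" using q by simp
    qed
    show ?thesis
    proof (cases "int q dvd d")
      case True
      then have "?y \<in> \<int>" using iff by simp
      then have "ker q ?y = ker q 0" using ker_periodic[of ?y q 0] by simp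
      then show ?thesis using True wk assms by simp
    next
      case False
      then have "ker q ?y = 0" using iff int assms by (simp add: ker_eq_0_iff)
      then show ?thesis using False wk by simp
    qed
  qed
  have "of_real ((real q)\<^sup>2 * (\<Sum>j<q. (cmod (ker q (x - of_int s * real j / real q)))\<^sup>2)) =
    (\<Sum>j<q. (of_nat q * ker q (x - of_int s * real j / real q)) * cnj (of_nat q * ker q (x - of_int s * real j / real q)))"
    unfolding complex_norm_square[symmetric] by (simp add: norm_mult power_mult_distrib sum_distrib_left)
  also have "\<dots> = (\<Sum>j<q. \<Sum>k<q. \<Sum>l<q. expo (real k) (x - of_int s * real j / real q) *
       cnj (expo (real l) (x - of_int s * real j / real q)))"
    using q by (simp add: ker_def sum_product)
  also have "\<dots> = (\<Sum>j<q. \<Sum>k<q. \<Sum>l<q. expo (real k - real l) x * expo 1 (- of_int ((int k - int l) * s) * real j / real q))"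
    by (intro sum.cong refl) (simp add: expo_cis cis_mult cis_cnj algebra_simps diff_divide_distrib)
  also have "\<dots> = (\<Sum>k<q. \<Sum>l<q. \<Sum>j<q. expo (real k - real l) x * expo 1 (- of_int ((int k - int l) * s) * real j / real q))"
    by (subst sum.swap) (rule sum.cong[OF refl sum.swap])
  also have "\<dots> = (\<Sum>k<q. \<Sum>l<q. expo (real k - real l) x * w (int k - int l))"
    by (simp add: w_def sum_distrib_left)
  also have "\<dots> = (\<Sum>k<q. \<Sum>l<q. if l = k then of_nat q else 0)"
  proof (intro sum.cong refl)
    fix k l assume "k \<in> {..<q}" "l \<in> {..<q}"
    then have "int q dvd int k - int l \<longleftrightarrow> l = k"
      using zdvd_imp_le[of "int q" "int k - int l"] zdvd_imp_le[of "int q" "int l - int k"]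
      by (cases k l rule: linorder_cases) (auto simp: dvd_diff_commute)
    then show "expo (real k - real l) x * w (int k - int l) = (if l = k then of_nat q else 0)"
      by (simp add: w)
  qed
  also have "\<dots> = of_real ((real q)\<^sup>2)"
    by (simp add: power2_eq_square)
  finally have "(real q)\<^sup>2 * (\<Sum>j<q. (cmod (ker q (x - of_int s * real j / real q)))\<^sup>2) = (real q)\<^sup>2"
    by (simp only: of_real_eq_iff)
  then show ?thesis using q by simp
qed


section \<open>Infinite products\<close>

lemma admissibleD: "admissible c q \<Longrightarrow> 1 \<le> q n" "admissible c q \<Longrightarrow> summable (\<lambda>n. real (q n) * \<bar>c n\<bar>)"
  by (auto simp: admissible_def)

lemma admissible_shift: "admissible c q \<Longrightarrow> admissible (\<lambda>n. c (n + N)) (\<lambda>n. q (n + N))"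
  by (auto simp: admissible_def summable_iff_shift[of "\<lambda>n. real (q n) * \<bar>c n\<bar>"])

lemma admissible_scale: "admissible c q \<Longrightarrow> admissible (\<lambda>n. a * c n) q"
  using summable_mult[of "\<lambda>n. real (q n) * \<bar>c n\<bar>" "\<bar>a\<bar>"]
  by (auto simp: admissible_def abs_mult mult_ac)

lemma admissible_upd:
  assumes "admissible c q" "1 \<le> q'"
  shows "admissible (c(n := c')) (q(n := q'))"
proof -
  have "summable (\<lambda>k. real ((q(n := q')) k) * \<bar>(c(n := c')) k\<bar>) \<longleftrightarrow> summable (\<lambda>k. real (q k) * \<bar>c k\<bar>)"
    by (rule summable_cong, use eventually_gt_at_top[of n] in eventually_elim) auto
  with assms show ?thesis by (auto simp: admissible_def)
qed

lemma ker_factor_diff: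
  "cmod (ker (q n) (c n * x) - ker (q n) (c n * y)) \<le> 2 * pi * \<bar>x - y\<bar> * (real (q n) * \<bar>c n\<bar>)"
proof -
  have "\<bar>c n * x - c n * y\<bar> = \<bar>c n\<bar> * \<bar>x - y\<bar>"
    by (metis abs_mult right_diff_distrib)
  then show ?thesis using norm_ker_diff[of "q n" "c n * x" "c n * y"] by (simp add: mult_ac)
qed

text \<open>The partial products have modulus at most \<open>1\<close>, so each increment is bounded
  by the distance of the new factor from \<open>1\<close>, and these distances are summable.\<close>

lemma ker_prod_LIMSEQ:
  assumes "admissible c q"
  shows "(\<lambda>N. \<Prod>n<N. ker (q n) (c n * x)) \<longlonglongrightarrow> ker_prod c q x"
proof -
  define X where "X N = (\<Prod>n<N. ker (q n) (c n * x))" for N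
  have "summable (\<lambda>N. X (Suc N) - X N)"
  proof (rule summable_comparison_test')
    show "summable (\<lambda>n. 2 * pi * \<bar>x\<bar> * (real (q n) * \<bar>c n\<bar>))"
      by (intro summable_mult admissibleD[OF assms])
    fix n
    have "X (Suc n) - X n = X n * (ker (q n) (c n * x) - ker (q n) (c n * 0))"
      using admissibleD(1)[OF assms, of n] by (simp add: X_def algebra_simps)
    moreover have "cmod (X n) \<le> 1"
      unfolding X_def prod_norm[symmetric] by (intro prod_le_1) (auto simp: norm_ker_le_1)
    ultimately have "cmod (X (Suc n) - X n) \<le> 1 * cmod (ker (q n) (c n * x) - ker (q n) (c n * 0))"
      by (simp only: norm_mult) (intro mult_right_mono, auto)
    also have "\<dots> \<le> 2 * pi * \<bar>x\<bar> * (real (q n) * \<bar>c n\<bar>)"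
      using ker_factor_diff[of q n c x 0] by simp
    finally show "norm (X (Suc n) - X n) \<le> 2 * pi * \<bar>x\<bar> * (real (q n) * \<bar>c n\<bar>)" .
  qed
  then have "convergent (\<lambda>N. \<Sum>n<N. X (Suc n) - X n)"
    by (simp add: summable_iff_convergent)
  then have "convergent (\<lambda>N. X N - X 0)"
    by (simp add: sum_lessThan_telescope)
  then have "convergent X"
    using convergent_diff_const_right_iff by blast
  then show ?thesis
    unfolding ker_prod_def X_def by (simp add: convergent_LIMSEQ_iff)
qed

lemma ker_prod_eqI:
  assumes "admissible c q" "(\<lambda>N. \<Prod>n<N. ker (q n) (c n * x)) \<longlonglongrightarrow> l"
  shows "ker_prod c q x = l"
  using LIMSEQ_unique[OF ker_prod_LIMSEQ[OF assms(1)] assms(2)] .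

lemma ker_prod_split:
  assumes "admissible c q"
  shows "ker_prod c q x = (\<Prod>n<N. ker (q n) (c n * x)) * ker_prod (\<lambda>n. c (n + N)) (\<lambda>n. q (n + N)) x"
proof -
  have eq: "(\<Prod>n<K + N. ker (q n) (c n * x)) = (\<Prod>n<N. ker (q n) (c n * x)) * (\<Prod>n<K. ker (q (n + N)) (c (n + N) * x))" for K
    by (induction K) (simp_all add: mult_ac)
  have "(\<lambda>K. \<Prod>n<K + N. ker (q n) (c n * x)) \<longlonglongrightarrow> ker_prod c q x"
    using LIMSEQ_ignore_initial_segment[OF ker_prod_LIMSEQ[OF assms]] .
  moreover have "(\<lambda>K. \<Prod>n<K + N. ker (q n) (c n * x)) \<longlonglongrightarrow>
      (\<Prod>n<N. ker (q n) (c n * x)) * ker_prod (\<lambda>n. c (n + N)) (\<lambda>n. q (n + N)) x"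
    unfolding eq by (intro tendsto_mult tendsto_const ker_prod_LIMSEQ admissible_shift assms)
  ultimately show ?thesis by (rule LIMSEQ_unique)
qed

lemma ker_prod_0 [simp]: "admissible c q \<Longrightarrow> ker_prod c q 0 = 1"
  by (rule ker_prod_eqI) (simp_all add: ker_0[OF admissibleD(1)])

lemma norm_ker_prod_diff:
  assumes "admissible c q"
  shows "cmod (ker_prod c q x - ker_prod c q y) \<le> 2 * pi * (\<Sum>n. real (q n) * \<bar>c n\<bar>) * \<bar>x - y\<bar>"
proof (rule LIMSEQ_le_const2)
  show "(\<lambda>N. cmod ((\<Prod>n<N. ker (q n) (c n * x)) - (\<Prod>n<N. ker (q n) (c n * y)))) \<longlonglongrightarrow>
     cmod (ker_prod c q x - ker_prod c q y)"
    by (intro tendsto_intros ker_prod_LIMSEQ assms)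
  have "cmod ((\<Prod>n<N. ker (q n) (c n * x)) - (\<Prod>n<N. ker (q n) (c n * y)))
      \<le> 2 * pi * (\<Sum>n. real (q n) * \<bar>c n\<bar>) * \<bar>x - y\<bar>" for N
  proof -
    have "cmod ((\<Prod>n<N. ker (q n) (c n * x)) - (\<Prod>n<N. ker (q n) (c n * y)))
        \<le> (\<Sum>n<N. cmod (ker (q n) (c n * x) - ker (q n) (c n * y)))"
      by (rule norm_prod_diff) (auto intro: norm_ker_le_1)
    also have "\<dots> \<le> (\<Sum>n<N. 2 * pi * \<bar>x - y\<bar> * (real (q n) * \<bar>c n\<bar>))"
      by (intro sum_mono ker_factor_diff)
    also have "\<dots> = 2 * pi * \<bar>x - y\<bar> * (\<Sum>n<N. real (q n) * \<bar>c n\<bar>)"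
      by (simp add: sum_distrib_left)
    also have "\<dots> \<le> 2 * pi * \<bar>x - y\<bar> * (\<Sum>n. real (q n) * \<bar>c n\<bar>)"
      by (intro mult_left_mono sum_le_suminf admissibleD[OF assms]) auto
    finally show ?thesis by (simp add: mult_ac)
  qed
  then show "\<exists>N. \<forall>n\<ge>N. cmod ((\<Prod>n<n. ker (q n) (c n * x)) - (\<Prod>n<n. ker (q n) (c n * y)))
      \<le> 2 * pi * (\<Sum>n. real (q n) * \<bar>c n\<bar>) * \<bar>x - y\<bar>" by blast
qed

lemma ker_prod_tail_ge:
  assumes "admissible c q" "2 * pi * (\<Sum>n. real (q n) * \<bar>c n\<bar>) * \<bar>x\<bar> \<le> 1/2"
  shows "1/2 \<le> cmod (ker_prod c q x)"
proof -
  have "cmod (ker_prod c q x - 1) \<le> 1/2"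
    using norm_ker_prod_diff[OF assms(1), of x 0] assms by simp
  moreover have "1 - cmod (ker_prod c q x) \<le> cmod (1 - ker_prod c q x)"
    using norm_triangle_ineq2[of 1 "ker_prod c q x"] by simp
  ultimately show ?thesis by (simp add: norm_minus_commute)
qed

text \<open>Some tail has modulus at least \<open>1/2\<close> at \<open>x\<close>, so a zero of the
  product comes from the finite head.\<close>

lemma ker_prod_eq_0_iff:
  assumes "admissible c q"
  shows "ker_prod c q x = 0 \<longleftrightarrow> (\<exists>n. ker (q n) (c n * x) = 0)"
proof
  assume "\<exists>n. ker (q n) (c n * x) = 0"
  then obtain n where "ker (q n) (c n * x) = 0" ..
  then have "(\<Prod>n<Suc n. ker (q n) (c n * x)) = 0" by simp
  then show "ker_prod c q x = 0" using ker_prod_split[OF assms, of x "Suc n"] by simp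
next
  assume 0: "ker_prod c q x = 0"
  have "summable (\<lambda>n. 2 * pi * \<bar>x\<bar> * (real (q n) * \<bar>c n\<bar>))"
    by (intro summable_mult admissibleD[OF assms])
  from suminf_exist_split[OF _ this, of "1/2"]
  obtain N where "norm (\<Sum>n. 2 * pi * \<bar>x\<bar> * (real (q (n + N)) * \<bar>c (n + N)\<bar>)) < 1/2" by auto
  then have "2 * pi * \<bar>x\<bar> * (\<Sum>n. real (q (n + N)) * \<bar>c (n + N)\<bar>) < 1/2"
    using admissibleD(2)[OF admissible_shift[OF assms, of N]] by (simp add: suminf_mult)
  then have "1/2 \<le> cmod (ker_prod (\<lambda>n. c (n + N)) (\<lambda>n. q (n + N)) x)"
    by (intro ker_prod_tail_ge admissible_shift assms) (simp add: mult_ac)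
  then have "(\<Prod>n<N. ker (q n) (c n * x)) = 0"
    using 0 ker_prod_split[OF assms, of x N] by auto
  then show "\<exists>n. ker (q n) (c n * x) = 0" by auto
qed

text \<open>A factor is replaced in place, so the others keep their indices. With
  \<open>q' = 1\<close> the new kernel is constantly \<open>1\<close>, which amounts to
  deletion.\<close>

lemma ker_prod_upd:
  assumes "admissible c q" "1 \<le> q'" "ker (q n) (c n * x) = z * ker q' (c' * x)"
  shows "ker_prod c q x = z * ker_prod (c(n := c')) (q(n := q')) x"
proof (rule ker_prod_eqI[OF assms(1)])
  let ?c = "c(n := c')" and ?q = "q(n := q')"
  have "(\<lambda>N. z * (\<Prod>k<N. ker (?q k) (?c k * x))) \<longlonglongrightarrow> z * ker_prod ?c ?q x"
    by (intro tendsto_mult tendsto_const ker_prod_LIMSEQ admissible_upd assms)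
  moreover have "\<forall>\<^sub>F N in sequentially. z * (\<Prod>k<N. ker (?q k) (?c k * x)) = (\<Prod>k<N. ker (q k) (c k * x))"
    unfolding eventually_sequentially
  proof (intro exI allI impI)
    fix N assume "Suc n \<le> N"
    then have "n \<in> {..<N}" by simp
    then show "z * (\<Prod>k<N. ker (?q k) (?c k * x)) = (\<Prod>k<N. ker (q k) (c k * x))"
      by (simp add: prod.remove[of "{..<N}" n] assms(3))
  qed
  ultimately show "(\<lambda>N. \<Prod>n<N. ker (q n) (c n * x)) \<longlonglongrightarrow> z * ker_prod ?c ?q x"
    by (rule Lim_transform_eventually)
qed

lemma ker_prod_delete:
  "admissible c q \<Longrightarrow> ker_prod c q x = ker (q n) (c n * x) * ker_prod c (q(n := 1)) x"
  using ker_prod_upd[of c q 1 n x "ker (q n) (c n * x)" "c n"] by simp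

lemma norm_ker_prod_minus:
  assumes "admissible c q"
  shows "cmod (ker_prod c q (- x)) = cmod (ker_prod c q x)"
proof (rule LIMSEQ_unique)
  show "(\<lambda>N. cmod (\<Prod>n<N. ker (q n) (c n * (- x)))) \<longlonglongrightarrow> cmod (ker_prod c q (- x))"
    by (intro tendsto_norm ker_prod_LIMSEQ assms)
  have "(\<lambda>N. cmod (\<Prod>n<N. ker (q n) (c n * (- x)))) = (\<lambda>N. cmod (\<Prod>n<N. ker (q n) (c n * x)))"
    by (simp add: prod_norm[symmetric] norm_ker_minus)
  then show "(\<lambda>N. cmod (\<Prod>n<N. ker (q n) (c n * (- x)))) \<longlonglongrightarrow> cmod (ker_prod c q x)"
    using tendsto_norm[OF ker_prod_LIMSEQ[OF assms]] by simp
qed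

lemma ker_prod_scale: "ker_prod (\<lambda>n. a * c n) q x = ker_prod c q (a * x)"
  by (simp add: ker_prod_def mult_ac)

section \<open>The infinite convolution and its Fourier transform\<close>

lemma real_distribution_unif:
  assumes "finite E" "E \<noteq> {}"
  shows "real_distribution (unif E)"
proof -
  interpret prob_space "unif E"
    unfolding unif_def by (rule prob_space.prob_space_distr[OF measure_pmf.prob_space_axioms]) simp
  show ?thesis by standard (simp add: unif_def)
qed

lemma char_unif:
  assumes "finite E" "E \<noteq> {}"
  shows "char (unif E) t = (\<Sum>x\<in>E. iexp (t * x)) / of_nat (card E)"
  unfolding char_def unif_def using assms
  by (subst integral_distr, simp_all)
     (subst integral_measure_pmf[of E], auto simp: scaleR_conv_of_real sum_divide_distrib)

lemma AE_unif:
  assumes "finite E" "E \<noteq> {}" "\<And>x. x \<in> E \<Longrightarrow> \<bar>x\<bar> \<le> a"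
  shows "AE x in unif E. \<bar>x\<bar> \<le> a"
  unfolding unif_def using assms
  by (subst AE_distr_iff) (simp_all add: AE_measure_pmf_iff set_pmf_of_set)

lemma real_distribution_convolution:
  assumes "real_distribution M" "real_distribution N"
  shows "real_distribution (M \<star> N)"
proof -
  interpret M: real_distribution M by fact
  interpret N: real_distribution N by fact
  interpret pair_prob_space M N ..
  interpret prob_space "M \<star> N"
    unfolding convolution_def by (rule prob_space_distr) measurable
  show ?thesis by standard simp
qed

lemma char_convolution:
  assumes "real_distribution M" "real_distribution N"
  shows "char (M \<star> N) t = char M t * char N t"
proof -
  interpret M: real_distribution M by fact
  interpret N: real_distribution N by fact
  interpret pair_prob_space M N ..
  let ?f = "\<lambda>z. iexp (t * (fst z + snd z))"
  have "integrable (M \<Otimes>\<^sub>M N) ?f"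
    by (rule integrable_const_bound[of _ 1]) (auto simp: norm_exp_i_times)
  then have "(LINT x|M. LINT y|N. iexp (t * (x + y))) = integral\<^sup>L (M \<Otimes>\<^sub>M N) ?f"
    using integral_fst'[of ?f] by simp
  moreover have "char (M \<star> N) t = integral\<^sup>L (M \<Otimes>\<^sub>M N) ?f"
    unfolding char_def convolution_def by (subst integral_distr) (auto simp: case_prod_beta)
  moreover have "(LINT x|M. LINT y|N. iexp (t * (x + y))) = (LINT x|M. iexp (t * x) * (LINT y|N. iexp (t * y)))"
    by (simp add: distrib_left exp_add)
  ultimately show ?thesis by (simp add: char_def)
qed

lemma AE_convolution:
  assumes "real_distribution M" "real_distribution N"
    and "AE x in M. \<bar>x\<bar> \<le> a" "AE x in N. \<bar>x\<bar> \<le> b"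
  shows "AE x in M \<star> N. \<bar>x\<bar> \<le> a + b"
proof -
  interpret M: real_distribution M by fact
  interpret N: real_distribution N by fact
  have "(\<integral>\<^sup>+z. indicator {z. \<not> \<bar>z\<bar> \<le> a + b} z \<partial>(M \<star> N)) =
      (\<integral>\<^sup>+x. \<integral>\<^sup>+y. indicator {z. \<not> \<bar>z\<bar> \<le> a + b} (x + y) \<partial>N \<partial>M)"
    by (intro nn_integral_convolution M.finite_measure_axioms N.finite_measure_axioms) auto
  also have "\<dots> = (\<integral>\<^sup>+x. 0 \<partial>M)"
  proof (rule nn_integral_cong_AE, use assms(3) in eventually_elim)
    fix x assume x: "\<bar>x\<bar> \<le> a"
    have "(\<integral>\<^sup>+y. indicator {z. \<not> \<bar>z\<bar> \<le> a + b} (x + y) \<partial>N) = (\<integral>\<^sup>+y. 0 \<partial>N)"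
      by (rule nn_integral_cong_AE, use assms(4) in eventually_elim) (use x in auto)
    then show "(\<integral>\<^sup>+y. indicator {z. \<not> \<bar>z\<bar> \<le> a + b} (x + y) \<partial>N) = 0" by simp
  qed
  finally have "(\<integral>\<^sup>+z. indicator {z. \<not> \<bar>z\<bar> \<le> a + b} z \<partial>(M \<star> N)) = 0" by simp
  then have "emeasure (M \<star> N) {z. \<not> \<bar>z\<bar> \<le> a + b} = 0"
    by (subst (asm) nn_integral_indicator) auto
  then show ?thesis by (intro AE_I[where N="{z. \<not> \<bar>z\<bar> \<le> a + b}"]) auto
qed

lemma real_distribution_return: "real_distribution (return borel (x::real))"
proof -
  interpret prob_space "return borel x" by (rule prob_space_return) simp
  show ?thesis by standard simp
qed

lemma real_distribution_partial_conv:
  "(\<And>n. real_distribution (\<nu> (Suc n))) \<Longrightarrow> real_distribution (partial_conv \<nu> N)"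
  by (induction N) (auto intro: real_distribution_convolution real_distribution_return)

lemma char_partial_conv:
  "(\<And>n. real_distribution (\<nu> (Suc n))) \<Longrightarrow> char (partial_conv \<nu> N) t = (\<Prod>n<N. char (\<nu> (Suc n)) t)"
proof (induction N)
  case 0
  show ?case by (simp add: char_def integral_return)
next
  case (Suc N)
  then show ?case by (simp add: char_convolution real_distribution_partial_conv)
qed

lemma AE_partial_conv:
  assumes "\<And>n. real_distribution (\<nu> (Suc n))" "\<And>n. AE x in \<nu> (Suc n). \<bar>x\<bar> \<le> a n"
  shows "AE x in partial_conv \<nu> N. \<bar>x\<bar> \<le> (\<Sum>n<N. a n)"
proof (induction N)
  case 0
  show ?case unfolding partial_conv.simps by (subst AE_return) auto
next
  case (Suc N)
  then show ?case
    unfolding partial_conv.simps sum.lessThan_Suc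
    by (intro AE_convolution assms real_distribution_partial_conv)
qed

text \<open>The common bounded support makes the partial convolutions tight, so a subsequence has a
  weak limit, whose transform is \<open>\<phi>\<close>. Levy's continuity theorem then gives weak
  convergence of the whole sequence, and the transform determines the limit.\<close>

lemma inf_conv:
  fixes \<nu> :: "nat \<Rightarrow> real measure" and a :: "nat \<Rightarrow> real"
  assumes \<nu>: "\<And>n. real_distribution (\<nu> (Suc n))" and AE: "\<And>n. AE x in \<nu> (Suc n). \<bar>x\<bar> \<le> a n"
    and a: "\<And>n. 0 \<le> a n" "summable a"
    and lim: "\<And>t. (\<lambda>N. \<Prod>n<N. char (\<nu> (Suc n)) t) \<longlonglongrightarrow> \<phi> t"
  shows "real_distribution (inf_conv \<nu>)" "char (inf_conv \<nu>) = \<phi>"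
    "AE x in inf_conv \<nu>. \<bar>x\<bar> \<le> suminf a"
proof -
  let ?P = "partial_conv \<nu>" and ?K = "suminf a"
  note rd = real_distribution_partial_conv[of \<nu>, OF \<nu>]
  have supp: "AE x in ?P N. \<bar>x\<bar> \<le> ?K" for N
  proof -
    have "(\<Sum>n<N. a n) \<le> ?K" using a by (intro sum_le_suminf) auto
    then show ?thesis using AE_partial_conv[of \<nu> a N, OF \<nu> AE] by (auto elim: eventually_mono)
  qed
  have "tight ?P"
    unfolding tight_def
  proof (intro conjI allI impI)
    fix \<epsilon> :: real assume \<epsilon>: "0 < \<epsilon>"
    have "0 \<le> ?K" using a by (intro suminf_nonneg) auto
    moreover have "measure (?P n) {- ?K - 1<..?K + 1} = 1" for n
    proof -
      interpret P: real_distribution "?P n" by (rule rd)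
      have "AE x in ?P n. x \<in> {- ?K - 1<..?K + 1}"
        using supp[of n] by (auto elim!: eventually_mono)
      then show ?thesis by (subst P.prob_eq_1) auto
    qed
    ultimately show "\<exists>a b. a < b \<and> (\<forall>n. 1 - \<epsilon> < measure (?P n) {a<..b})"
      using \<epsilon> by (intro exI[of _ "- ?K - 1"] exI[of _ "?K + 1"]) auto
  qed (rule rd)
  from tight_imp_convergent_subsubsequence[OF this strict_mono_id]
  obtain r M where r: "strict_mono r" and M: "real_distribution M" and wc: "weak_conv_m (?P \<circ> id \<circ> r) M"
    by blast
  have char: "(\<lambda>N. char (?P N) t) \<longlonglongrightarrow> \<phi> t" for t
    using lim by (simp add: char_partial_conv[of \<nu>, OF \<nu>])
  have chM: "char M t = \<phi> t" for t
  proof (rule LIMSEQ_unique)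
    show "(\<lambda>n. char ((?P \<circ> id \<circ> r) n) t) \<longlonglongrightarrow> char M t"
      by (rule levy_continuity1[OF _ M wc]) (simp add: rd)
    show "(\<lambda>n. char ((?P \<circ> id \<circ> r) n) t) \<longlonglongrightarrow> \<phi> t"
      using LIMSEQ_subseq_LIMSEQ[OF char r] by (simp add: o_def)
  qed
  have wM: "weak_conv_m ?P M"
    by (rule levy_continuity[OF rd M]) (simp add: char chM)
  have "inf_conv \<nu> = M"
    unfolding inf_conv_def
  proof (rule the_equality)
    fix M' assume M': "real_distribution M' \<and> weak_conv_m ?P M'"
    have "char M' t = char M t" for t
      using LIMSEQ_unique[OF levy_continuity1[OF rd _ conjunct2[OF M']] char] M' chM by simp
    then show "M' = M" using M M' by (intro Levy_uniqueness ext) auto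
  qed (use M wM in simp)
  moreover have "AE x in M. \<bar>x\<bar> \<le> ?K"
  proof -
    interpret M: real_distribution M by fact
    \<comment> \<open>\<open>f\<close> is bounded, continuous and vanishes exactly on the interval
      of radius \<open>?K\<close>, so integral \<open>0\<close> in the limit confines
      \<open>M\<close> to this interval.\<close>
    define f where "f x = min 1 (max 0 (\<bar>x\<bar> - ?K))" for x :: real
    have cont: "continuous_on UNIV f" unfolding f_def by (intro continuous_intros)
    have [measurable]: "f \<in> borel_measurable borel"
      by (intro borel_measurable_continuous_onI cont)
    have "(\<lambda>n. integral\<^sup>L (?P n) f) \<longlonglongrightarrow> integral\<^sup>L M f"
    proof (rule weak_conv_imp_integral_bdd_continuous_conv[OF rd M wM])
      show "isCont f x" for x using cont by (simp add: continuous_on_eq_continuous_at)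
      show "norm (f x) \<le> 1" for x by (auto simp: f_def)
    qed
    moreover have "integral\<^sup>L (?P n) f = 0" for n
    proof -
      have "AE x in ?P n. f x = 0" using supp[of n] by (auto simp: f_def elim!: eventually_mono)
      then show ?thesis by (rule integral_eq_zero_AE)
    qed
    ultimately have "integral\<^sup>L M f = 0"
      by (simp add: LIMSEQ_const_iff)
    moreover have "integrable M f"
      by (rule M.integrable_const_bound[of _ 1]) (auto simp: f_def)
    ultimately have "AE x in M. f x = 0"
      by (subst (asm) integral_nonneg_eq_0_iff_AE) (auto simp: f_def)
    then show ?thesis
    proof eventually_elim
      fix x assume "f x = 0"
      then show "\<bar>x\<bar> \<le> ?K" by (rule contrapos_pp) (auto simp: f_def min_def)
    qed
  qed
  ultimately show "real_distribution (inf_conv \<nu>)" "char (inf_conv \<nu>) = \<phi>"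
    "AE x in inf_conv \<nu>. \<bar>x\<bar> \<le> suminf a" using M chM by auto
qed

text \<open>The member with index \<open>0\<close> of the family below, where \<open>n - 1\<close> is truncated, is never used by
  \<^const>\<open>partial_conv\<close>.\<close>

definition kconv :: "(nat \<Rightarrow> real) \<Rightarrow> (nat \<Rightarrow> nat) \<Rightarrow> real measure" where
  "kconv c q = inf_conv (\<lambda>n. unif ((\<lambda>k. c (n - 1) * real k) ` {..<q (n - 1)}))"

lemma kconv:
  assumes "admissible c q"
  shows "real_distribution (kconv c q)" "char (kconv c q) (2 * pi * x) = ker_prod c q x"
    "AE x in kconv c q. \<bar>x\<bar> \<le> (\<Sum>n. real (q n) * \<bar>c n\<bar>)"
proof -
  define \<nu> where "\<nu> n = unif ((\<lambda>k. c (n - 1) * real k) ` {..<q (n - 1)})" for n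
  have ne: "(\<lambda>k. c n * real k) ` {..<q n} \<noteq> {}" for n
    using admissibleD(1)[OF assms, of n] by (auto simp: lessThan_empty_iff)
  have char: "char (\<nu> (Suc n)) t = ker (q n) (c n * (t / (2 * pi)))" for n t
  proof (cases "c n = 0")
    case True
    then have "(\<lambda>k. c n * real k) ` {..<q n} = {0}" using ne[of n] by auto
    then show ?thesis using True admissibleD(1)[OF assms, of n] by (simp add: \<nu>_def char_unif)
  next
    case False
    then have inj: "inj_on (\<lambda>k. c n * real k) {..<q n}" by (auto simp: inj_on_def)
    have "(\<Sum>k<q n. iexp (t * (c n * real k))) = (\<Sum>k<q n. expo (real k) (c n * (t / (2 * pi))))"
      by (intro sum.cong refl) (simp add: expo_cis cis_conv_exp mult_ac)
    then show ?thesis using ne[of n]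
      by (simp add: \<nu>_def char_unif sum.reindex[OF inj] card_image[OF inj] ker_def)
  qed
  have 1: "real_distribution (\<nu> (Suc n))" for n
    unfolding \<nu>_def using ne by (intro real_distribution_unif) auto
  have 2: "AE x in \<nu> (Suc n). \<bar>x\<bar> \<le> real (q n) * \<bar>c n\<bar>" for n
    unfolding \<nu>_def using ne
    by (intro AE_unif) (auto simp: abs_mult mult.commute[of "real (q n)"] intro!: mult_left_mono)
  have 3: "(\<lambda>N. \<Prod>n<N. char (\<nu> (Suc n)) t) \<longlonglongrightarrow> ker_prod c q (t / (2 * pi))" for t
    unfolding char by (rule ker_prod_LIMSEQ[OF assms])
  note * = inf_conv[OF 1 2 _ admissibleD(2)[OF assms] 3]
  have eq: "inf_conv \<nu> = kconv c q"
    by (simp add: kconv_def \<nu>_def[abs_def])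
  show "real_distribution (kconv c q)" "AE x in kconv c q. \<bar>x\<bar> \<le> (\<Sum>n. real (q n) * \<bar>c n\<bar>)"
    using *(1,3) unfolding eq by auto
  have "char (kconv c q) = (\<lambda>t. ker_prod c q (t / (2 * pi)))"
    using *(2) unfolding eq by auto
  then show "char (kconv c q) (2 * pi * x) = ker_prod c q x" by simp
qed


section \<open>Spectra through the Fourier transform\<close>

definition orth :: "(real \<Rightarrow> complex) \<Rightarrow> real set \<Rightarrow> bool" where
  "orth \<phi> \<Lambda> \<longleftrightarrow> (\<forall>l\<in>\<Lambda>. \<forall>l'\<in>\<Lambda>. l \<noteq> l' \<longrightarrow> \<phi> (l - l') = 0)"

text \<open>Parseval's identity for \<open>expo x\<close> in one-sided form; the reverse inequality
  is Bessel's. Finite subsets replace an infinite sum over \<open>\<Lambda>\<close>.\<close>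

definition complete_at :: "(real \<Rightarrow> complex) \<Rightarrow> real set \<Rightarrow> real \<Rightarrow> bool" where
  "complete_at \<phi> \<Lambda> x \<longleftrightarrow> (\<forall>\<epsilon>>0. \<exists>F. finite F \<and> F \<subseteq> \<Lambda> \<and> 1 - \<epsilon> < (\<Sum>l\<in>F. (cmod (\<phi> (x - l)))\<^sup>2))"

definition trig :: "real set \<Rightarrow> (real \<Rightarrow> complex) set" where
  "trig \<Lambda> = {g. \<exists>F c. finite F \<and> F \<subseteq> \<Lambda> \<and> g = (\<lambda>x. \<Sum>l\<in>F. c l * expo l x)}"

lemma expo_measurable [measurable]: "expo l \<in> borel_measurable borel"
  unfolding expo_def by (intro borel_measurable_continuous_onI continuous_intros)

lemma trig_expo: "l \<in> \<Lambda> \<Longrightarrow> expo l \<in> trig \<Lambda>"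
  unfolding trig_def by (intro CollectI exI[of _ "{l}"] exI[of _ "\<lambda>_. 1"]) auto

lemma trig_add:
  assumes "f \<in> trig \<Lambda>" "g \<in> trig \<Lambda>"
  shows "(\<lambda>x. f x + g x) \<in> trig \<Lambda>"
proof -
  obtain F c where F: "finite F" "F \<subseteq> \<Lambda>" "f = (\<lambda>x. \<Sum>l\<in>F. c l * expo l x)"
    using assms(1) by (auto simp: trig_def)
  obtain G d where G: "finite G" "G \<subseteq> \<Lambda>" "g = (\<lambda>x. \<Sum>l\<in>G. d l * expo l x)"
    using assms(2) by (auto simp: trig_def)
  let ?c = "\<lambda>l. (if l \<in> F then c l else 0) + (if l \<in> G then d l else 0)"
  have "f x + g x = (\<Sum>l\<in>F \<union> G. ?c l * expo l x)" for x
  proof -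
    have "(\<Sum>l\<in>F \<union> G. ?c l * expo l x) = (\<Sum>l\<in>F \<union> G. (if l \<in> F then c l else 0) * expo l x)
        + (\<Sum>l\<in>F \<union> G. (if l \<in> G then d l else 0) * expo l x)"
      by (simp add: distrib_right sum.distrib)
    also have "(\<Sum>l\<in>F \<union> G. (if l \<in> F then c l else 0) * expo l x) = f x"
      unfolding F(3) using F G by (intro sum.mono_neutral_cong_right) auto
    also have "(\<Sum>l\<in>F \<union> G. (if l \<in> G then d l else 0) * expo l x) = g x"
      unfolding G(3) using F G by (intro sum.mono_neutral_cong_right) auto
    finally show ?thesis by simp
  qed
  then show ?thesis
    unfolding trig_def using F G by (intro CollectI exI[of _ "F \<union> G"] exI[of _ ?c]) auto
qed

lemma trig_scale: "f \<in> trig \<Lambda> \<Longrightarrow> (\<lambda>x. a * f x) \<in> trig \<Lambda>"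
proof -
  assume "f \<in> trig \<Lambda>"
  then obtain F c where "finite F" "F \<subseteq> \<Lambda>" "f = (\<lambda>x. \<Sum>l\<in>F. c l * expo l x)"
    by (auto simp: trig_def)
  then show ?thesis
    unfolding trig_def
    by (intro CollectI exI[of _ F] exI[of _ "\<lambda>l. a * c l"]) (auto simp: sum_distrib_left mult.assoc)
qed

lemma trig_0: "(\<lambda>x. 0) \<in> trig \<Lambda>"
  unfolding trig_def by (intro CollectI exI[of _ "{}"]) auto

lemma trig_sum: "finite I \<Longrightarrow> (\<And>i. i \<in> I \<Longrightarrow> f i \<in> trig \<Lambda>) \<Longrightarrow> (\<lambda>x. \<Sum>i\<in>I. f i x) \<in> trig \<Lambda>"
  by (induction I rule: finite_induct) (auto intro: trig_add trig_0)

lemma trig_mult: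
  assumes "f \<in> trig UNIV" "g \<in> trig UNIV"
  shows "(\<lambda>x. f x * g x) \<in> trig UNIV"
proof -
  obtain F c where F: "finite F" "f = (\<lambda>x. \<Sum>l\<in>F. c l * expo l x)"
    using assms(1) by (auto simp: trig_def)
  obtain G d where G: "finite G" "g = (\<lambda>x. \<Sum>l\<in>G. d l * expo l x)"
    using assms(2) by (auto simp: trig_def)
  have "(\<lambda>x. \<Sum>l\<in>F. \<Sum>k\<in>G. (c l * d k) * expo (l + k) x) \<in> trig UNIV"
    by (intro trig_sum trig_scale trig_expo F G) auto
  then show ?thesis by (simp add: F G sum_product expo_add_left mult_ac)
qed

lemma trig_bounded_measurable:
  assumes "f \<in> trig \<Lambda>"
  shows "f \<in> borel_measurable borel" "\<exists>B. \<forall>x. cmod (f x) \<le> B"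
proof -
  obtain F c where F: "finite F" "f = (\<lambda>x. \<Sum>l\<in>F. c l * expo l x)"
    using assms by (auto simp: trig_def)
  show "f \<in> borel_measurable borel" unfolding F by measurable
  have "cmod (f x) \<le> (\<Sum>l\<in>F. cmod (c l))" for x
    unfolding F by (rule order_trans[OF norm_sum]) (simp add: norm_mult)
  then show "\<exists>B. \<forall>x. cmod (f x) \<le> B" by blast
qed

lemma cmod_add_sq: "(cmod (a + b))\<^sup>2 \<le> 2 * (cmod a)\<^sup>2 + 2 * (cmod b)\<^sup>2"
proof -
  have "(cmod (a + b))\<^sup>2 \<le> (cmod a + cmod b)\<^sup>2"
    by (intro power_mono norm_triangle_ineq) auto
  also have "\<dots> \<le> 2 * (cmod a)\<^sup>2 + 2 * (cmod b)\<^sup>2"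
    using zero_le_power2[of "cmod a - cmod b"] by (simp add: power2_sum power2_diff)
  finally show ?thesis .
qed

section \<open>Closed spans of exponentials in L^2\<close>

context real_distribution
begin

definition nrm2 :: "(real \<Rightarrow> complex) \<Rightarrow> real" where
  "nrm2 f = (LINT x|M. (cmod (f x))\<^sup>2)"

lemma L2_fun_measurable: "f \<in> L2_fun M \<Longrightarrow> f \<in> borel_measurable borel"
  using measurable_cong_sets[OF events_eq_borel refl] by (auto simp: L2_fun_def)

lemma L2_fun_bounded:
  assumes [measurable]: "f \<in> borel_measurable borel" and B: "\<And>x. cmod (f x) \<le> B"
  shows "f \<in> L2_fun M"
proof -
  have "integrable M (\<lambda>x. (cmod (f x))\<^sup>2)"
    by (rule integrable_const_bound[of _ "B\<^sup>2"]) (auto intro!: power_mono B)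
  then show ?thesis by (simp add: L2_fun_def)
qed

lemma L2_fun_trig: "f \<in> trig \<Lambda> \<Longrightarrow> f \<in> L2_fun M"
  using trig_bounded_measurable[of f \<Lambda>] L2_fun_bounded[of f] by auto

lemma L2_fun_scale: "f \<in> L2_fun M \<Longrightarrow> (\<lambda>x. a * f x) \<in> L2_fun M"
  by (auto simp: L2_fun_def norm_mult power_mult_distrib)

lemma nrm2_scale: "nrm2 (\<lambda>x. a * f x) = (cmod a)\<^sup>2 * nrm2 f"
  by (simp add: nrm2_def norm_mult power_mult_distrib)

lemma L2_fun_add:
  assumes "f \<in> L2_fun M" "g \<in> L2_fun M"
  shows "(\<lambda>x. f x + g x) \<in> L2_fun M" "nrm2 (\<lambda>x. f x + g x) \<le> 2 * nrm2 f + 2 * nrm2 g"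
proof -
  have [measurable]: "f \<in> borel_measurable M" "g \<in> borel_measurable M"
    and fg: "integrable M (\<lambda>x. (cmod (f x))\<^sup>2)" "integrable M (\<lambda>x. (cmod (g x))\<^sup>2)"
    using assms by (auto simp: L2_fun_def)
  then have *: "integrable M (\<lambda>x. 2 * (cmod (f x))\<^sup>2 + 2 * (cmod (g x))\<^sup>2)" by auto
  have i: "integrable M (\<lambda>x. (cmod (f x + g x))\<^sup>2)"
    by (rule Bochner_Integration.integrable_bound[OF *]) (auto simp: cmod_add_sq)
  then show "(\<lambda>x. f x + g x) \<in> L2_fun M" by (simp add: L2_fun_def)
  have "nrm2 (\<lambda>x. f x + g x) \<le> (LINT x|M. 2 * (cmod (f x))\<^sup>2 + 2 * (cmod (g x))\<^sup>2)"
    unfolding nrm2_def by (intro integral_mono i * cmod_add_sq)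
  also have "\<dots> = 2 * nrm2 f + 2 * nrm2 g"
    unfolding nrm2_def using fg by simp
  finally show "nrm2 (\<lambda>x. f x + g x) \<le> 2 * nrm2 f + 2 * nrm2 g" .
qed

lemma L2_fun_diff:
  assumes "f \<in> L2_fun M" "g \<in> L2_fun M"
  shows "(\<lambda>x. f x - g x) \<in> L2_fun M"
  using L2_fun_add(1)[OF assms(1) L2_fun_scale[OF assms(2), of "-1"]] by simp

definition trig_closure :: "real set \<Rightarrow> (real \<Rightarrow> complex) set" where
  "trig_closure \<Lambda> = {f \<in> L2_fun M. \<forall>\<epsilon>>0. \<exists>g\<in>trig \<Lambda>. nrm2 (\<lambda>x. f x - g x) < \<epsilon>}"

lemma trig_closureI:
  assumes "f \<in> L2_fun M" "\<And>\<epsilon>. 0 < \<epsilon> \<Longrightarrow> \<exists>g\<in>trig_closure \<Lambda>. nrm2 (\<lambda>x. f x - g x) < \<epsilon>"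
  shows "f \<in> trig_closure \<Lambda>"
  unfolding trig_closure_def
proof (intro CollectI conjI allI impI assms(1))
  fix \<epsilon> :: real assume "0 < \<epsilon>"
  then obtain g where g: "g \<in> trig_closure \<Lambda>" "nrm2 (\<lambda>x. f x - g x) < \<epsilon> / 4"
    using assms(2)[of "\<epsilon> / 4"] by auto
  then obtain h where h: "h \<in> trig \<Lambda>" "nrm2 (\<lambda>x. g x - h x) < \<epsilon> / 4"
    using \<open>0 < \<epsilon>\<close> by (auto simp: trig_closure_def dest!: spec[of _ "\<epsilon> / 4"])
  have "g \<in> L2_fun M" using g by (simp add: trig_closure_def)
  then have "nrm2 (\<lambda>x. (f x - g x) + (g x - h x)) \<le> 2 * nrm2 (\<lambda>x. f x - g x) + 2 * nrm2 (\<lambda>x. g x - h x)"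
    by (intro L2_fun_add L2_fun_diff assms L2_fun_trig[OF h(1)])
  then show "\<exists>g\<in>trig \<Lambda>. nrm2 (\<lambda>x. f x - g x) < \<epsilon>"
    using g h by (intro bexI[of _ h]) auto
qed

lemma trig_closure_L2: "f \<in> trig_closure \<Lambda> \<Longrightarrow> f \<in> L2_fun M"
  by (simp add: trig_closure_def)

lemma trig_closureD: "f \<in> trig_closure \<Lambda> \<Longrightarrow> 0 < \<epsilon> \<Longrightarrow> \<exists>g\<in>trig \<Lambda>. nrm2 (\<lambda>x. f x - g x) < \<epsilon>"
  by (simp add: trig_closure_def)

lemma trig_closure_add:
  assumes "f \<in> trig_closure \<Lambda>" "g \<in> trig_closure \<Lambda>"
  shows "(\<lambda>x. f x + g x) \<in> trig_closure \<Lambda>"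
  unfolding trig_closure_def
proof (intro CollectI conjI allI impI)
  show "(\<lambda>x. f x + g x) \<in> L2_fun M" by (intro L2_fun_add trig_closure_L2[OF assms(1)] trig_closure_L2[OF assms(2)])
  fix \<epsilon> :: real assume "0 < \<epsilon>"
  then obtain h k where hk: "h \<in> trig \<Lambda>" "nrm2 (\<lambda>x. f x - h x) < \<epsilon> / 4" "k \<in> trig \<Lambda>" "nrm2 (\<lambda>x. g x - k x) < \<epsilon> / 4"
    using trig_closureD[OF assms(1), of "\<epsilon> / 4"] trig_closureD[OF assms(2), of "\<epsilon> / 4"] by auto
  have "nrm2 (\<lambda>x. (f x - h x) + (g x - k x)) \<le> 2 * nrm2 (\<lambda>x. f x - h x) + 2 * nrm2 (\<lambda>x. g x - k x)"
    by (intro L2_fun_add L2_fun_diff trig_closure_L2[OF assms(1)] trig_closure_L2[OF assms(2)]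
        L2_fun_trig[OF hk(1)] L2_fun_trig[OF hk(3)])
  then show "\<exists>g'\<in>trig \<Lambda>. nrm2 (\<lambda>x. f x + g x - g' x) < \<epsilon>"
    using hk by (intro bexI[of _ "\<lambda>x. h x + k x"]) (auto intro: trig_add simp: algebra_simps)
qed

lemma trig_closure_trig: "f \<in> trig \<Lambda> \<Longrightarrow> f \<in> trig_closure \<Lambda>"
  by (auto simp: trig_closure_def L2_fun_trig nrm2_def intro!: bexI[of _ f])

lemma trig_closure_scale:
  assumes "f \<in> trig_closure \<Lambda>"
  shows "(\<lambda>x. a * f x) \<in> trig_closure \<Lambda>"
proof (cases "a = 0")
  case True
  then show ?thesis using trig_closure_trig[OF trig_0] by simp
next
  case False
  show ?thesis
    unfolding trig_closure_def
  proof (intro CollectI conjI allI impI)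
    show "(\<lambda>x. a * f x) \<in> L2_fun M" by (intro L2_fun_scale trig_closure_L2[OF assms])
    fix \<epsilon> :: real assume "0 < \<epsilon>"
    then have "0 < \<epsilon> / (cmod a)\<^sup>2" using False by simp
    then obtain g where g: "g \<in> trig \<Lambda>" "nrm2 (\<lambda>x. f x - g x) < \<epsilon> / (cmod a)\<^sup>2"
      using assms unfolding trig_closure_def by blast
    have "nrm2 (\<lambda>x. a * f x - a * g x) < \<epsilon>"
      using g(2) False by (simp add: right_diff_distrib[symmetric] nrm2_scale less_divide_eq mult.commute)
    then show "\<exists>g\<in>trig \<Lambda>. nrm2 (\<lambda>x. a * f x - g x) < \<epsilon>"
      by (intro bexI[of _ "\<lambda>x. a * g x"] trig_scale g)
  qed
qed

lemma trig_closure_sum: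
  "finite I \<Longrightarrow> (\<And>i. i \<in> I \<Longrightarrow> f i \<in> trig_closure \<Lambda>) \<Longrightarrow> (\<lambda>x. \<Sum>i\<in>I. f i x) \<in> trig_closure \<Lambda>"
  by (induction I rule: finite_induct) (auto intro: trig_closure_add trig_closure_trig[OF trig_0])

lemma trig_closure_LIMSEQ:
  assumes g: "\<And>n. g n \<in> trig_closure \<Lambda>" and f: "f \<in> borel_measurable borel"
    and lim: "\<And>x. (\<lambda>n. g n x) \<longlonglongrightarrow> f x"
    and w: "integrable M w" "\<And>n x. (cmod (f x - g n x))\<^sup>2 \<le> w x" and f2: "f \<in> L2_fun M"
  shows "f \<in> trig_closure \<Lambda>"
proof (rule trig_closureI[OF f2])
  fix \<epsilon> :: real assume \<epsilon>: "0 < \<epsilon>"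
  have [measurable]: "g n \<in> borel_measurable borel" for n
    by (rule L2_fun_measurable[OF trig_closure_L2[OF g[of n]]])
  note f[measurable]
  have "(\<lambda>n. nrm2 (\<lambda>x. f x - g n x)) \<longlonglongrightarrow> (LINT x|M. 0)"
    unfolding nrm2_def
  proof (rule integral_dominated_convergence[OF _ _ w(1)])
    show "AE x in M. (\<lambda>n. (cmod (f x - g n x))\<^sup>2) \<longlonglongrightarrow> 0"
    proof (rule AE_I2)
      fix x
      have "(\<lambda>n. (cmod (f x - g n x))\<^sup>2) \<longlonglongrightarrow> (cmod (f x - f x))\<^sup>2"
        by (intro tendsto_intros lim)
      then show "(\<lambda>n. (cmod (f x - g n x))\<^sup>2) \<longlonglongrightarrow> 0" by simp
    qed
  qed (use w(2) in auto)
  then have "\<forall>\<^sub>F n in sequentially. nrm2 (\<lambda>x. f x - g n x) < \<epsilon>"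
    using order_tendstoD(2)[of _ _ _ \<epsilon>] \<epsilon> by fastforce
  then obtain n where "nrm2 (\<lambda>x. f x - g n x) < \<epsilon>" by (auto simp: eventually_sequentially)
  then show "\<exists>g\<in>trig_closure \<Lambda>. nrm2 (\<lambda>x. f x - g x) < \<epsilon>" using g by blast
qed

end

lemma trig_real_dense:
  assumes "continuous_on {-K..K} r" "0 < e"
  shows "\<exists>t. (\<lambda>x. complex_of_real (t x)) \<in> trig UNIV \<and> (\<forall>x\<in>{-K..K}. \<bar>r x - t x\<bar> < e)"
proof -
  let ?R = "{t :: real \<Rightarrow> real. continuous_on {-K..K} t \<and> (\<lambda>x. complex_of_real (t x)) \<in> trig UNIV}"
  interpret function_ring_on ?R "{-K..K}"
  proof
    show "compact {-K..K}" by simp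
  next
    fix f g assume "f \<in> ?R" "g \<in> ?R"
    then show "(\<lambda>x. f x + g x) \<in> ?R" "(\<lambda>x. f x * g x) \<in> ?R"
      using trig_add[of "\<lambda>x. complex_of_real (f x)" UNIV "\<lambda>x. complex_of_real (g x)"]
        trig_mult[of "\<lambda>x. complex_of_real (f x)" "\<lambda>x. complex_of_real (g x)"]
      by (auto intro!: continuous_intros)
  next
    fix c :: real
    show "(\<lambda>_. c) \<in> ?R" using trig_scale[OF trig_expo[of 0 UNIV], of "complex_of_real c"] by simp
  next
    fix x y assume xy: "x \<in> {-K..K}" "y \<in> {-K..K}" "x \<noteq> y"
    \<comment> \<open>\<open>|x - y|\<close> is at most \<open>2 * K\<close>, so
      \<open>\<xi> * |x - y| < 1\<close> and this single frequency separates the points of the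
      interval.\<close>
    define \<xi> where "\<xi> = 1 / (4 * (K + 1))"
    have K: "0 \<le> K" using xy by auto
    have "complex_of_real (cos (2 * pi * (\<xi> * x))) = 1/2 * (expo \<xi> x + expo (- \<xi>) x)" for x
      by (simp add: expo_cis complex_eq_iff)
    then have eq: "(\<lambda>x. complex_of_real (cos (2 * pi * (\<xi> * x)))) = (\<lambda>x. 1/2 * (expo \<xi> x + expo (- \<xi>) x))"
      by blast
    have c: "(\<lambda>x. cos (2 * pi * (\<xi> * x))) \<in> ?R"
      using trig_scale[OF trig_add[OF trig_expo[OF UNIV_I, of \<xi>] trig_expo[OF UNIV_I, of "- \<xi>"]], of "1/2"]
      unfolding mem_Collect_eq eq by (intro conjI continuous_intros)
    have "complex_of_real (sin (2 * pi * (\<xi> * x))) = - \<i>/2 * (expo \<xi> x + -1 * expo (- \<xi>) x)" for x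
      by (simp add: expo_cis complex_eq_iff)
    then have eq: "(\<lambda>x. complex_of_real (sin (2 * pi * (\<xi> * x)))) = (\<lambda>x. - \<i>/2 * (expo \<xi> x + -1 * expo (- \<xi>) x))"
      by blast
    have s: "(\<lambda>x. sin (2 * pi * (\<xi> * x))) \<in> ?R"
      using trig_scale[OF trig_add[OF trig_expo[OF UNIV_I, of \<xi>] trig_scale[OF trig_expo[OF UNIV_I, of "- \<xi>"], of "-1"]], of "- \<i>/2"]
      unfolding mem_Collect_eq eq by (intro conjI continuous_intros)
    show "\<exists>f\<in>?R. f x \<noteq> f y"
    proof (rule ccontr)
      assume "\<not> ?thesis"
      then have all: "\<forall>f\<in>?R. f x = f y" by simp
      have "expo \<xi> x = expo \<xi> y"
        using bspec[OF all c] bspec[OF all s] by (simp add: expo_cis complex_eq_iff)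
      moreover have "expo \<xi> (x - y) * expo \<xi> y = expo \<xi> x" by (simp add: expo_add[symmetric])
      moreover have "expo \<xi> y \<noteq> 0" using norm_expo[of \<xi> y] by force
      ultimately have "expo \<xi> (x - y) = 1" by simp
      then have "expo 1 (\<xi> * (x - y)) = 1" by (simp add: expo_cis)
      then have "\<xi> * (x - y) \<in> \<int>" by (simp only: expo_eq_1_iff)
      moreover have "\<bar>\<xi> * (x - y)\<bar> < 1"
        using xy K by (auto simp: \<xi>_def abs_mult divide_simps)
      ultimately have "\<xi> * (x - y) = 0" using Ints_nonzero_abs_less1 by blast
      then show False using xy K by (simp add: \<xi>_def)
    qed
  qed auto
  from Stone_Weierstrass_basic[OF assms] show ?thesis by auto
qed

context real_distribution
begin

lemma trig_closure_continuous:
  assumes K: "AE x in M. \<bar>x\<bar> \<le> K" and r: "continuous_on UNIV r" "\<And>x. \<bar>r x\<bar> \<le> B"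
  shows "(\<lambda>x. complex_of_real (r x)) \<in> trig_closure UNIV"
proof (rule trig_closureI)
  have [measurable]: "r \<in> borel_measurable borel"
    by (intro borel_measurable_continuous_onI r)
  show L: "(\<lambda>x. complex_of_real (r x)) \<in> L2_fun M"
    using r by (intro L2_fun_bounded[of _ B]) auto
  fix \<epsilon> :: real assume \<epsilon>: "0 < \<epsilon>"
  obtain t where t: "(\<lambda>x. complex_of_real (t x)) \<in> trig UNIV" "\<forall>x\<in>{-K..K}. \<bar>r x - t x\<bar> < sqrt (\<epsilon> / 2)"
    using trig_real_dense[of K r "sqrt (\<epsilon> / 2)"] r \<epsilon> by (auto intro: continuous_on_subset)
  have "AE x in M. (cmod (complex_of_real (r x) - complex_of_real (t x)))\<^sup>2 \<le> \<epsilon> / 2"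
    using K
  proof eventually_elim
    fix x assume "\<bar>x\<bar> \<le> K"
    then have "x \<in> {-K..K}" by (auto simp: abs_le_iff)
    then have "\<bar>r x - t x\<bar> \<le> sqrt (\<epsilon> / 2)" using t(2) by (intro less_imp_le) blast
    then have "\<bar>r x - t x\<bar>\<^sup>2 \<le> (sqrt (\<epsilon> / 2))\<^sup>2" by (intro power_mono) auto
    then show "(cmod (complex_of_real (r x) - complex_of_real (t x)))\<^sup>2 \<le> \<epsilon> / 2"
      using \<epsilon> by (simp only: of_real_diff[symmetric] norm_of_real) simp
  qed
  then have "nrm2 (\<lambda>x. complex_of_real (r x) - complex_of_real (t x)) \<le> (LINT x|M. \<epsilon> / 2)"
    unfolding nrm2_def using L2_fun_diff[OF L L2_fun_trig[OF t(1)]]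
    by (intro integral_mono_AE) (auto simp: L2_fun_def)
  then show "\<exists>g\<in>trig_closure UNIV. nrm2 (\<lambda>x. complex_of_real (r x) - g x) < \<epsilon>"
    using \<epsilon> prob_space trig_closure_trig[OF t(1)] by (intro bexI[of _ "\<lambda>x. complex_of_real (t x)"]) auto
qed

text \<open>Half-lines are pointwise limits of continuous steps and form an intersection-stable
  generator of the Borel sets. The sets whose indicators lie in the closure are stable under
  complements and countable disjoint unions.\<close>

lemma trig_closure_indicator:
  assumes K: "AE x in M. \<bar>x\<bar> \<le> K" and A: "A \<in> sets borel"
  shows "(\<lambda>x. indicator A x) \<in> trig_closure UNIV"
proof -
  have step: "(\<lambda>x. indicator {..a} x) \<in> trig_closure UNIV" for a :: real
  proof (rule trig_closure_LIMSEQ[of "\<lambda>n x. complex_of_real (cts_step a (a + 1 / real (Suc n)) x)" _ _ "\<lambda>_. 4"])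
    fix n
    have "uniformly_continuous_on UNIV (cts_step a (a + 1 / real (Suc n)))"
      by (rule cts_step_uniformly_continuous) simp
    moreover have "\<bar>cts_step a (a + 1 / real (Suc n)) x\<bar> \<le> 1" for x
      by (auto simp: cts_step_def divide_simps)
    ultimately show "(\<lambda>x. complex_of_real (cts_step a (a + 1 / real (Suc n)) x)) \<in> trig_closure UNIV"
      by (intro trig_closure_continuous[OF K, of _ 1] uniformly_continuous_imp_continuous)
  next
    fix x
    show "(\<lambda>n. complex_of_real (cts_step a (a + 1 / real (Suc n)) x)) \<longlonglongrightarrow> indicator {..a} x"
    proof (cases "x \<le> a")
      case True
      then show ?thesis by (simp add: cts_step_def)
    next
      case False
      then have "0 < x - a" by simp
      then obtain N where N: "inverse (real (Suc N)) < x - a" using reals_Archimedean by blast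
      have "cts_step a (a + 1 / real (Suc n)) x = 0" if "N \<le> n" for n
      proof -
        have "1 / real (Suc n) \<le> 1 / real (Suc N)" using that by (intro divide_left_mono) auto
        then show ?thesis using N False by (simp add: cts_step_def inverse_eq_divide)
      qed
      then have "\<forall>\<^sub>F n in sequentially. complex_of_real (cts_step a (a + 1 / real (Suc n)) x) = 0"
        by (auto simp: eventually_sequentially)
      then show ?thesis using False by (simp add: tendsto_eventually)
    qed
  next
    fix n x
    have "cts_step a (a + 1 / real (Suc n)) x \<in> {0..1}" by (auto simp: cts_step_def divide_simps)
    then have "cmod (indicator {..a} x - complex_of_real (cts_step a (a + 1 / real (Suc n)) x)) \<le> 1 + 1"
      by (intro order_trans[OF norm_triangle_ineq4] add_mono) (auto simp: indicator_def)
    then show "(cmod (indicator {..a} x - complex_of_real (cts_step a (a + 1 / real (Suc n)) x)))\<^sup>2 \<le> 4"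
      using power_mono[of _ "2::real" 2] by fastforce
  qed (auto intro!: L2_fun_bounded[of _ 1] simp: indicator_def)
  have one: "(\<lambda>x. 1) \<in> trig_closure UNIV"
    using trig_closure_trig[OF trig_expo[of 0 UNIV]] by (simp add: expo_0(2)[abs_def])
  have "sigma_sets UNIV (range (\<lambda>a::real. {..a})) = sets borel"
    by (simp add: borel_eq_atMost)
  with A have *: "A \<in> sigma_sets UNIV (range (\<lambda>a::real. {..a}))" by simp
  have "Int_stable (range (\<lambda>a::real. {..a}))"
    by (auto simp: Int_stable_def)
  moreover have "range (\<lambda>a::real. {..a}) \<subseteq> Pow UNIV" by simp
  moreover note *
  ultimately show ?thesis
  proof (induction rule: sigma_sets_induct_disjoint)
    case (basic A)
    then show ?case using step by auto
  next
    case empty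
    then show ?case using trig_closure_trig[OF trig_0] by simp
  next
    case (compl A)
    have "(\<lambda>x. indicator (UNIV - A) x) = (\<lambda>x. (1::complex) + (-1) * indicator A x)"
      by (auto simp: indicator_def)
    then show ?case using trig_closure_add[OF one trig_closure_scale[OF compl(2), of "-1"]] by simp
  next
    case (union A)
    have [measurable]: "A i \<in> sets borel" for i using union(2) by (auto simp: borel_eq_atMost)
    have eq: "(\<Sum>i<n. indicator (A i) x) = (indicator (\<Union>i<n. A i) x :: complex)" for n x
      using union(1) by (intro indicator_UN_disjoint[symmetric]) (auto simp: disjoint_family_on_def)
    show ?case
    proof (rule trig_closure_LIMSEQ[of "\<lambda>n x. \<Sum>i<n. indicator (A i) x" _ _ "\<lambda>_. 1"])
      show "(\<lambda>x. \<Sum>i<n. indicator (A i) x) \<in> trig_closure UNIV" for n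
        using union by (intro trig_closure_sum) auto
      show "(\<lambda>n. \<Sum>i<n. indicator (A i) x) \<longlonglongrightarrow> (indicator (\<Union>i. A i) x :: complex)" for x
        unfolding eq by (rule LIMSEQ_indicator_UN)
      show "(cmod (indicator (\<Union>i. A i) x - (\<Sum>i<n. indicator (A i) x)))\<^sup>2 \<le> 1" for n x
        unfolding eq by (auto simp: indicator_def)
    qed (auto intro!: L2_fun_bounded[of _ 1] simp: indicator_def)
  qed
qed

theorem trig_dense:
  assumes K: "AE x in M. \<bar>x\<bar> \<le> K" and f: "f \<in> L2_fun M"
  shows "f \<in> trig_closure UNIV"
proof -
  have [measurable]: "f \<in> borel_measurable borel" and i: "integrable M (\<lambda>x. (cmod (f x))\<^sup>2)"
    using f L2_fun_measurable[OF f] by (auto simp: L2_fun_def)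
  from borel_measurable_implies_sequence_metric[OF \<open>f \<in> borel_measurable borel\<close>, of 0]
  obtain s where s: "\<And>i. simple_function borel (s i)" "\<And>x. (\<lambda>i. s i x) \<longlonglongrightarrow> f x"
     "\<And>i x. cmod (s i x) \<le> 2 * cmod (f x)" by auto
  show ?thesis
  proof (rule trig_closure_LIMSEQ[of s _ _ "\<lambda>x. 9 * (cmod (f x))\<^sup>2"])
    fix n
    have fin: "finite (range (s n))" using s(1)[of n] by (simp add: simple_function_def)
    have "(\<lambda>x. \<Sum>y\<in>range (s n). y * indicator (s n -` {y}) x) \<in> trig_closure UNIV"
      using s(1)[of n]
      by (intro trig_closure_sum trig_closure_scale trig_closure_indicator[OF K] fin) (auto simp: simple_function_def)
    also have "(\<lambda>x. \<Sum>y\<in>range (s n). y * indicator (s n -` {y}) x) = s n"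
      by (intro ext) (simp add: indicator_def fin if_distrib[of "(*) _"] sum.delta cong: if_cong)
    finally show "s n \<in> trig_closure UNIV" .
    fix x
    have "cmod (f x - s n x) \<le> 3 * cmod (f x)"
      using norm_triangle_ineq4[of "f x" "s n x"] s(3)[of n x] by simp
    then have "(cmod (f x - s n x))\<^sup>2 \<le> (3 * cmod (f x))\<^sup>2" by (intro power_mono) auto
    then show "(cmod (f x - s n x))\<^sup>2 \<le> 9 * (cmod (f x))\<^sup>2" by (simp add: power_mult_distrib)
  qed (use s(2) i f in auto)
qed

section \<open>Bessel's inequality and the criterion for a spectrum\<close>

lemma integrable_expo: "integrable M (expo l)"
  by (rule integrable_const_bound[of _ 1]) auto

lemma integral_expo: "(LINT x|M. expo l x) = char M (2 * pi * l)"
  unfolding char_def by (intro Bochner_Integration.integral_cong) (simp_all add: expo_cis cis_conv_exp mult.assoc)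

lemma L2_inner_expo: "L2_inner M (expo l) (expo l') = char M (2 * pi * (l - l'))"
  by (simp add: L2_inner_def cnj_expo expo_add_left[symmetric] integral_expo)

text \<open>Completing the square: the best coefficients are \<open>\<phi> (y - l)\<close>, and the
  last sum is the cost of other ones. This identity yields Bessel's inequality and both directions
  of the criterion below.\<close>

lemma nrm2_expo_expansion:
  fixes \<phi> defines "\<phi> \<equiv> \<lambda>l. char M (2 * pi * l)"
  assumes F: "finite F" "orth \<phi> F"
  shows "nrm2 (\<lambda>x. expo y x - (\<Sum>l\<in>F. a l * expo l x)) =
     1 - (\<Sum>l\<in>F. (cmod (\<phi> (y - l)))\<^sup>2) + (\<Sum>l\<in>F. (cmod (a l - \<phi> (y - l)))\<^sup>2)"
proof -
  have int: "(LINT x|M. expo l x) = \<phi> l" for l by (simp add: integral_expo \<phi>_def)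
  have cnj: "\<phi> (- l) = cnj (\<phi> l)" for l
    unfolding int[symmetric] by (simp add: cnj_expo[symmetric, abs_def])
  have 0: "\<phi> 0 = 1" by (simp add: \<phi>_def char_zero)
  let ?g = "\<lambda>x. expo y x - (\<Sum>l\<in>F. a l * expo l x)"
  have "complex_of_real (nrm2 ?g) = (LINT x|M. ?g x * cnj (?g x))"
    unfolding nrm2_def complex_norm_square[symmetric] by (simp only: integral_complex_of_real)
  also have "\<dots> = (LINT x|M. expo 0 x - (\<Sum>l\<in>F. cnj (a l) * expo (y - l) x) - (\<Sum>l\<in>F. a l * expo (- (y - l)) x)
      + (\<Sum>l\<in>F. \<Sum>k\<in>F. a k * cnj (a l) * expo (k - l) x))"
    by (intro Bochner_Integration.integral_cong refl)
       (simp add: sum_product sum_distrib_left cnj_expo expo_add_left[symmetric] algebra_simps)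
  also have "\<dots> = 1 - (\<Sum>l\<in>F. cnj (a l) * \<phi> (y - l)) - (\<Sum>l\<in>F. a l * cnj (\<phi> (y - l)))
      + (\<Sum>l\<in>F. \<Sum>k\<in>F. a k * cnj (a l) * \<phi> (k - l))"
    by (simp add: integrable_expo int 0 cnj del: expo_0 minus_diff_eq)
  also have "(\<Sum>l\<in>F. \<Sum>k\<in>F. a k * cnj (a l) * \<phi> (k - l)) = (\<Sum>l\<in>F. \<Sum>k\<in>F. if k = l then a l * cnj (a l) else 0)"
    using F by (intro sum.cong refl) (auto simp: orth_def 0)
  also have "\<dots> = (\<Sum>l\<in>F. a l * cnj (a l))" using F by simp
  also have "1 - (\<Sum>l\<in>F. cnj (a l) * \<phi> (y - l)) - (\<Sum>l\<in>F. a l * cnj (\<phi> (y - l))) + (\<Sum>l\<in>F. a l * cnj (a l))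
      = 1 - (\<Sum>l\<in>F. \<phi> (y - l) * cnj (\<phi> (y - l))) + (\<Sum>l\<in>F. (a l - \<phi> (y - l)) * cnj (a l - \<phi> (y - l)))"
    by (simp add: algebra_simps sum.distrib sum_subtractf)
  also have "\<dots> = of_real (1 - (\<Sum>l\<in>F. (cmod (\<phi> (y - l)))\<^sup>2) + (\<Sum>l\<in>F. (cmod (a l - \<phi> (y - l)))\<^sup>2))"
    unfolding complex_norm_square[symmetric] by simp
  finally show ?thesis by (simp only: of_real_eq_iff)
qed

end

lemma bessel:
  assumes "admissible c q" "finite F" "orth (ker_prod c q) F"
  shows "(\<Sum>l\<in>F. (cmod (ker_prod c q (y - l)))\<^sup>2) \<le> 1"
proof -
  interpret real_distribution "kconv c q" by (rule kconv[OF assms(1)])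
  have "0 \<le> nrm2 (\<lambda>x. expo y x - (\<Sum>l\<in>F. ker_prod c q (y - l) * expo l x))"
    by (simp add: nrm2_def)
  then show ?thesis
    using nrm2_expo_expansion[of F y "\<lambda>l. ker_prod c q (y - l)"] assms by (simp add: kconv(2))
qed

text \<open>Approximating \<open>expo y\<close> gives completeness at \<open>y\<close>. Conversely,
  completeness everywhere puts all exponentials into the closed span of those from
  \<open>\<Lambda>\<close>, and trigonometric polynomials are dense.\<close>

lemma spectral_kconv_iff:
  assumes adm: "admissible c q"
  shows "spectral_measure (kconv c q) \<longleftrightarrow>
    (\<exists>\<Lambda>. countable \<Lambda> \<and> orth (ker_prod c q) \<Lambda> \<and> (\<forall>y. complete_at (ker_prod c q) \<Lambda> y))"
proof -
  let ?M = "kconv c q" and ?\<phi> = "ker_prod c q"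
  interpret real_distribution ?M by (rule kconv[OF assms(1)])
  note K = kconv(3)[OF adm]
  have \<phi>: "char ?M (2 * pi * l) = ?\<phi> l" for l by (rule kconv(2)[OF adm])
  have orth: "(\<forall>l\<in>\<Lambda>. \<forall>l'\<in>\<Lambda>. l \<noteq> l' \<longrightarrow> L2_inner ?M (expo l) (expo l') = 0) \<longleftrightarrow> orth ?\<phi> \<Lambda>" for \<Lambda>
    by (simp add: orth_def L2_inner_expo \<phi>)
  have expand: "nrm2 (\<lambda>x. expo y x - (\<Sum>l\<in>F. a l * expo l x)) =
     1 - (\<Sum>l\<in>F. (cmod (?\<phi> (y - l)))\<^sup>2) + (\<Sum>l\<in>F. (cmod (a l - ?\<phi> (y - l)))\<^sup>2)"
    if "finite F" "F \<subseteq> \<Lambda>" "orth ?\<phi> \<Lambda>" for F \<Lambda> y a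
    using nrm2_expo_expansion[of F y a] that by (auto simp: \<phi> orth_def subset_iff)
  have "compactly_supported ?M"
    unfolding compactly_supported_def
    by (rule exI[of _ "{- (\<Sum>n. real (q n) * \<bar>c n\<bar>)..(\<Sum>n. real (q n) * \<bar>c n\<bar>)}"])
       (use K in \<open>auto simp: abs_le_iff minus_le_iff elim: eventually_mono\<close>)
  then have "spectral_measure ?M \<longleftrightarrow> (\<exists>\<Lambda>. is_spectrum ?M \<Lambda>)"
    by (simp add: spectral_measure_def real_distribution_axioms)
  also have "\<dots> \<longleftrightarrow> (\<exists>\<Lambda>. countable \<Lambda> \<and> orth ?\<phi> \<Lambda> \<and> (\<forall>y. complete_at ?\<phi> \<Lambda> y))"
  proof (intro iff_exI iffI)
    fix \<Lambda> assume sp: "is_spectrum ?M \<Lambda>"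
    then have o: "orth ?\<phi> \<Lambda>" by (simp add: is_spectrum_def orth)
    have "complete_at ?\<phi> \<Lambda> y" for y
      unfolding complete_at_def
    proof (intro allI impI)
      fix \<epsilon> :: real assume \<epsilon>: "0 < \<epsilon>"
      have "expo y \<in> L2_fun ?M" by (rule L2_fun_bounded[of _ 1]) auto
      then obtain F a where F: "finite F" "F \<subseteq> \<Lambda>" "L2_norm ?M (\<lambda>x. expo y x - (\<Sum>l\<in>F. a l * expo l x)) < sqrt \<epsilon>"
        using sp \<epsilon> unfolding is_spectrum_def by (meson real_sqrt_gt_zero)
      then have "nrm2 (\<lambda>x. expo y x - (\<Sum>l\<in>F. a l * expo l x)) < \<epsilon>"
        by (simp add: L2_norm_def nrm2_def)
      moreover have "0 \<le> (\<Sum>l\<in>F. (cmod (a l - ?\<phi> (y - l)))\<^sup>2)" by (intro sum_nonneg) auto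
      ultimately show "\<exists>F. finite F \<and> F \<subseteq> \<Lambda> \<and> 1 - \<epsilon> < (\<Sum>l\<in>F. (cmod (?\<phi> (y - l)))\<^sup>2)"
        using F expand[OF F(1,2) o, of y a] by (intro exI[of _ F]) auto
    qed
    then show "countable \<Lambda> \<and> orth ?\<phi> \<Lambda> \<and> (\<forall>y. complete_at ?\<phi> \<Lambda> y)"
      using sp o by (simp add: is_spectrum_def)
  next
    fix \<Lambda> assume \<Lambda>: "countable \<Lambda> \<and> orth ?\<phi> \<Lambda> \<and> (\<forall>y. complete_at ?\<phi> \<Lambda> y)"
    then have o: "orth ?\<phi> \<Lambda>" by simp
    have "expo y \<in> trig_closure \<Lambda>" for y
      unfolding trig_closure_def
    proof (intro CollectI conjI allI impI)
      show "expo y \<in> L2_fun ?M" by (rule L2_fun_bounded[of _ 1]) auto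
      fix \<epsilon> :: real assume "0 < \<epsilon>"
      then obtain F where F: "finite F" "F \<subseteq> \<Lambda>" "1 - \<epsilon> < (\<Sum>l\<in>F. (cmod (?\<phi> (y - l)))\<^sup>2)"
        using \<Lambda> unfolding complete_at_def by blast
      then have "nrm2 (\<lambda>x. expo y x - (\<Sum>l\<in>F. ?\<phi> (y - l) * expo l x)) < \<epsilon>"
        using expand[OF F(1,2) o, of y "\<lambda>l. ?\<phi> (y - l)"] by simp
      moreover have "(\<lambda>x. \<Sum>l\<in>F. ?\<phi> (y - l) * expo l x) \<in> trig \<Lambda>"
        using F by (intro trig_sum trig_scale trig_expo) auto
      ultimately show "\<exists>g\<in>trig \<Lambda>. nrm2 (\<lambda>x. expo y x - g x) < \<epsilon>"
        by (intro bexI[of _ "\<lambda>x. \<Sum>l\<in>F. ?\<phi> (y - l) * expo l x"])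
    qed
    then have sub: "trig UNIV \<subseteq> trig_closure \<Lambda>"
      by (auto simp: trig_def intro!: trig_closure_sum trig_closure_scale)
    have dense: "f \<in> trig_closure \<Lambda>" if f: "f \<in> L2_fun ?M" for f
      using trig_closureD[OF trig_dense[OF K f]] sub by (intro trig_closureI[OF f]) (meson subsetD)
    have "\<exists>F a. finite F \<and> F \<subseteq> \<Lambda> \<and> L2_norm ?M (\<lambda>x. f x - (\<Sum>l\<in>F. a l * expo l x)) < \<epsilon>"
      if f: "f \<in> L2_fun ?M" and "0 < \<epsilon>" for f \<epsilon>
    proof -
      have "0 < \<epsilon>\<^sup>2" using that by simp
      then obtain g where g: "g \<in> trig \<Lambda>" "nrm2 (\<lambda>x. f x - g x) < \<epsilon>\<^sup>2"
        using dense[OF f] unfolding trig_closure_def by blast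
      then have "L2_norm ?M (\<lambda>x. f x - g x) < \<epsilon>"
        using real_sqrt_less_mono[OF g(2)] that by (simp add: L2_norm_def nrm2_def)
      with g show ?thesis by (auto simp: trig_def)
    qed
    moreover have "topological_space_class.discrete \<Lambda>"
    proof -
      \<comment> \<open>The transform is \<open>1\<close> at \<open>0\<close> and has Lipschitz
        constant \<open>s\<close>, so its zeros, among them all differences of points of
        \<open>\<Lambda>\<close>, keep a fixed distance from \<open>0\<close>.\<close>
      define s where "s = 2 * pi * (\<Sum>n. real (q n) * \<bar>c n\<bar>)"
      have "0 \<le> s" unfolding s_def by (intro mult_nonneg_nonneg suminf_nonneg admissibleD[OF adm]) auto
      have sep: "1 / (s + 1) \<le> \<bar>l - l'\<bar>" if "l \<in> \<Lambda>" "l' \<in> \<Lambda>" "l \<noteq> l'" for l l'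
      proof -
        have "?\<phi> (l - l') = 0" using o that by (simp add: orth_def)
        then have "1 \<le> s * \<bar>l - l'\<bar>"
          using norm_ker_prod_diff[OF adm, of "l - l'" 0] adm by (simp add: s_def)
        also have "\<dots> \<le> (s + 1) * \<bar>l - l'\<bar>" by (intro mult_right_mono) auto
        finally show ?thesis using \<open>0 \<le> s\<close> by (simp add: divide_le_eq mult.commute)
      qed
      have "\<exists>d>0. \<forall>l'\<in>UNIV. l' \<noteq> l \<and> dist l' l < d \<longrightarrow> l' \<notin> \<Lambda>" if "l \<in> \<Lambda>" for l
        using sep that \<open>0 \<le> s\<close> by (intro exI[of _ "1 / (s + 1)"]) (force simp: dist_real_def)
      then show ?thesis by (simp add: discrete_altdef eventually_at)
    qed
    ultimately show "is_spectrum ?M \<Lambda>"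
      using \<Lambda> by (simp add: is_spectrum_def orth)
  qed
  finally show ?thesis .
qed


section \<open>Removing a factor from a spectral product\<close>

lemma ex_irrational: "\<exists>y::real. y \<notin> \<rat>"
proof (rule ccontr)
  assume "\<not> ?thesis"
  then have "(UNIV :: real set) = \<rat>" by auto
  then show False using uncountable_UNIV_real countable_rat by metis
qed

lemma sum_fibres:
  assumes "finite F" "finite G" "\<And>x. x \<in> F \<Longrightarrow> f x \<in> G \<and> g x \<in> I" "finite I"
  shows "(\<Sum>x\<in>F. h x) = (\<Sum>a\<in>G. \<Sum>i\<in>I. \<Sum>x\<in>{x \<in> F. f x = a \<and> g x = i}. h x)"
proof -
  have "(\<Sum>x\<in>F. h x) = (\<Sum>p\<in>G \<times> I. \<Sum>x\<in>{x \<in> F. (f x, g x) = p}. h x)"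
    using assms by (intro sum.group[symmetric]) auto
  then show ?thesis by (simp add: sum.cartesian_product case_prod_beta prod_eq_iff)
qed

text \<open>Let \<open>\<phi>\<close> be the product of the kernel \<open>ker r (a * x)\<close> and of \<open>\<psi>\<close>. In every coset of \<open>u \<int>\<close> keep only the
  points of \<open>\<Lambda>\<close> in one of the \<open>r\<close> classes modulo \<open>r u \<int>\<close>, namely in the class of \<open>\<rho>\<close>. The differences that remain are zeros of
  \<open>\<psi>\<close>, whatever the choice of classes. On a class the weight \<open>|ker r (a * (y - l))|\<^sup>2\<close> is constant, and over the \<open>r\<close> classes
  of a coset the weights add up to \<open>1\<close>. Hence the sum \<open>1\<close> for \<open>\<phi>\<close> is at most the sum for \<open>\<psi>\<close> over the best
  class of each coset, and this is at most \<open>1\<close> by Bessel's inequality. So there is equality, and all classes of a coset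
  are equally good.\<close>

lemma selection:
  fixes \<phi> \<psi> :: "real \<Rightarrow> complex" and a u y :: real
  assumes r: "1 \<le> r" and a: "a \<in> \<rat>" "a \<noteq> 0" and u: "u = 1 / (a * real r)"
    and factor: "\<And>x. \<phi> x = ker r (a * x) * \<psi> x"
    and bes: "\<And>F. finite F \<Longrightarrow> orth \<psi> F \<Longrightarrow> (\<Sum>l\<in>F. (cmod (\<psi> (y - l)))\<^sup>2) \<le> 1"
    and \<Lambda>: "\<Lambda> \<subseteq> \<rat>" "orth \<phi> \<Lambda>" "complete_at \<phi> \<Lambda> y" and y: "y \<notin> \<rat>"
    and \<rho>1: "\<And>x. \<exists>k::int. \<rho> x = x + of_int k * u" and \<rho>2: "\<And>x k. \<rho> (x + of_int k * u) = \<rho> x"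
  defines "\<Lambda>s \<equiv> {l \<in> \<Lambda>. \<exists>k::int. l - \<rho> l = of_int k * (real r * u)}"
  shows "orth \<psi> \<Lambda>s" "complete_at \<psi> \<Lambda>s y"
proof -
  have u0: "u \<noteq> 0" and au: "a * u = 1 / real r" using a r u by auto
  have "\<exists>k::int. x - \<rho> x = of_int k * u" for x
  proof -
    obtain k :: int where "\<rho> x = x + of_int k * u" using \<rho>1 by blast
    then show ?thesis by (intro exI[of _ "- k"]) simp
  qed
  then obtain d :: "real \<Rightarrow> int" where d: "\<And>x. x - \<rho> x = of_int (d x) * u" by metis
  \<comment> \<open>\<open>e x\<close> numbers the class of \<open>x\<close> modulo
    \<open>r * u\<close> inside its coset, counted from \<open>\<rho> x\<close>.\<close>
  define e where "e x = nat (d x mod int r)" for x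
  have e: "e x < r" "int (e x) = d x mod int r" for x using r by (auto simp: e_def nat_less_iff)
  have \<Lambda>s: "\<Lambda>s = {l \<in> \<Lambda>. e l = 0}"
  proof -
    have "(\<exists>k::int. l - \<rho> l = of_int k * (real r * u)) \<longleftrightarrow> e l = 0" for l
    proof -
      have "(\<exists>k::int. l - \<rho> l = of_int k * (real r * u)) \<longleftrightarrow> (\<exists>k::int. real_of_int (d l) = of_int (k * int r))"
        unfolding d using u0 by (simp add: mult.assoc[symmetric])
      also have "\<dots> \<longleftrightarrow> int r dvd d l" by (simp only: of_int_eq_iff) (auto simp: dvd_def mult.commute)
      also have "\<dots> \<longleftrightarrow> e l = 0" using e(2)[of l] by (simp add: dvd_eq_mod_eq_0 del: of_nat_eq_0_iff add: of_nat_eq_0_iff[where 'a=int, symmetric])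
      finally show ?thesis .
    qed
    then show ?thesis by (auto simp: \<Lambda>s_def)
  qed
  have sel: "orth \<psi> S" if S: "S \<subseteq> \<Lambda>" "\<And>l. l \<in> S \<Longrightarrow> e l = s (\<rho> l)" for S s
    unfolding orth_def
  proof (intro ballI impI)
    fix l l' assume l: "l \<in> S" "l' \<in> S" "l \<noteq> l'"
    have "\<phi> (l - l') = 0" using l S \<Lambda>(2) by (auto simp: orth_def)
    moreover have "ker r (a * (l - l')) \<noteq> 0"
    proof
      assume "ker r (a * (l - l')) = 0"
      then have *: "real r * (a * (l - l')) \<in> \<int>" "a * (l - l') \<notin> \<int>" using r by (auto simp: ker_eq_0_iff)
      then obtain k where k: "real r * (a * (l - l')) = of_int k" by (elim Ints_cases)
      then have "l = l' + of_int k * u" using a r by (simp add: u field_simps)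
      then have "\<rho> l = \<rho> l'" using \<rho>2 by simp
      then have "e l = e l'" using S l by auto
      then have "d l mod int r = d l' mod int r" using e(2) by metis
      then have "int r dvd d l - d l'" by (simp add: mod_eq_dvd_iff)
      then obtain j where j: "d l - d l' = int r * j" ..
      have "l - l' = of_int (d l - d l') * u"
        using d[of l] d[of l'] \<open>\<rho> l = \<rho> l'\<close> by (simp only: of_int_diff left_diff_distrib)
      then have "a * (l - l') = of_int j * real r * (a * u)" by (simp add: j mult_ac)
      then have "a * (l - l') = of_int j" unfolding au using r by simp
      then show False using * by simp
    qed
    ultimately show "\<psi> (l - l') = 0" using factor by simp
  qed
  show "orth \<psi> \<Lambda>s" by (rule sel[of _ "\<lambda>_. 0"]) (auto simp: \<Lambda>s)
  \<comment> \<open>\<open>m g i\<close> is the weight common to the points in class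
    \<open>i\<close> of the coset of \<open>g\<close>, and \<open>N F g i\<close> is the mass that
    \<open>\<psi>\<close> gives to the points of \<open>F\<close> in this class.\<close>
  define m where "m g i = (cmod (ker r (a * (y - g) - real i / real r)))\<^sup>2" for g i
  define N where "N F g i = (\<Sum>l\<in>{l \<in> F. \<rho> l = g \<and> e l = i}. (cmod (\<psi> (y - l)))\<^sup>2)" for F g i
  have m1: "(\<Sum>i<r. m g i) = 1" for g
    unfolding m_def using sum_ker_shift[of r 1 "a * (y - g)"] r by simp
  have mN: "(\<Sum>l\<in>F. (cmod (\<phi> (y - l)))\<^sup>2) = (\<Sum>g\<in>\<rho> ` F. \<Sum>i<r. m g i * N F g i)" if F: "finite F" for F
  proof -
    have "(cmod (\<phi> (y - l)))\<^sup>2 = m (\<rho> l) (e l) * (cmod (\<psi> (y - l)))\<^sup>2" for l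
    proof -
      have "d l = int (e l) + int r * (d l div int r)" using e(2)[of l] by simp
      then have "real_of_int (d l) = real (e l) + real r * of_int (d l div int r)"
        by (metis of_int_add of_int_mult of_int_of_nat_eq)
      then have "real_of_int (d l) / real r = real (e l) / real r + of_int (d l div int r)"
        using r by (simp add: add_divide_distrib)
      moreover have "a * (y - l) = a * (y - \<rho> l) - a * (l - \<rho> l)" by (simp add: algebra_simps)
      then have "a * (y - l) = a * (y - \<rho> l) - real_of_int (d l) / real r"
        using mult.left_commute[of a "of_int (d l)" u] au by (simp add: d)
      ultimately have "a * (y - l) = (a * (y - \<rho> l) - real (e l) / real r) + of_int (- (d l div int r))"
        by simp
      then have "ker r (a * (y - l)) = ker r (a * (y - \<rho> l) - real (e l) / real r)"
        using ker_periodic[of "of_int (- (d l div int r))"] Ints_of_int by metis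
      then show ?thesis by (simp add: factor m_def norm_mult power_mult_distrib)
    qed
    then have "(\<Sum>l\<in>F. (cmod (\<phi> (y - l)))\<^sup>2) = (\<Sum>l\<in>F. m (\<rho> l) (e l) * (cmod (\<psi> (y - l)))\<^sup>2)" by simp
    also have "\<dots> = (\<Sum>g\<in>\<rho> ` F. \<Sum>i<r. \<Sum>l\<in>{l \<in> F. \<rho> l = g \<and> e l = i}. m (\<rho> l) (e l) * (cmod (\<psi> (y - l)))\<^sup>2)"
      using F e(1) by (intro sum_fibres) auto
    finally show ?thesis by (simp add: N_def sum_distrib_left)
  qed
  have m0: "0 < m (\<rho> l) 0" if "l \<in> \<Lambda>" for l
  proof -
    obtain k :: int where "\<rho> l = l + of_int k * u" using \<rho>1 by blast
    then have "\<rho> l \<in> \<rat>" using that \<Lambda>(1) a u by auto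
    have "ker r (a * (y - \<rho> l)) \<noteq> 0"
    proof
      assume "ker r (a * (y - \<rho> l)) = 0"
      then obtain k where "real r * (a * (y - \<rho> l)) = of_int k" using r by (auto simp: ker_eq_0_iff elim: Ints_cases)
      then have "y = \<rho> l + of_int k / (real r * a)" using r a by (simp add: field_simps)
      then show False using y a \<open>\<rho> l \<in> \<rat>\<close> by simp
    qed
    then show ?thesis by (simp add: m_def)
  qed
  show "complete_at \<psi> \<Lambda>s y"
    unfolding complete_at_def
  proof (intro allI impI)
    fix \<epsilon> :: real assume \<epsilon>: "0 < \<epsilon>"
    then obtain F0 where F0: "finite F0" "F0 \<subseteq> \<Lambda>" "1 - \<epsilon> / 2 < (\<Sum>l\<in>F0. (cmod (\<phi> (y - l)))\<^sup>2)"
      using \<Lambda>(3) unfolding complete_at_def by (metis half_gt_zero)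
    define G0 where "G0 = \<rho> ` F0"
    \<comment> \<open>The least weight of a selected class among the finitely many cosets met by
      \<open>F0\<close>; it is positive because \<open>y\<close> is irrational.\<close>
    define \<mu> where "\<mu> = Min (insert 1 ((\<lambda>g. m g 0) ` G0))"
    have \<mu>: "0 < \<mu>" "\<And>g. g \<in> G0 \<Longrightarrow> \<mu> \<le> m g 0"
      unfolding \<mu>_def G0_def using F0 m0 by (auto intro: Min_le)
    have "0 < \<epsilon> * \<mu> / 2" using \<epsilon> \<mu> by simp
    then obtain F1 where F1: "finite F1" "F1 \<subseteq> \<Lambda>" "1 - \<epsilon> * \<mu> / 2 < (\<Sum>l\<in>F1. (cmod (\<phi> (y - l)))\<^sup>2)"
      using \<Lambda>(3) unfolding complete_at_def by blast
    define F where "F = F0 \<union> F1"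
    define G where "G = \<rho> ` F"
    have F: "finite F" "F \<subseteq> \<Lambda>" "F0 \<subseteq> F" "finite G" "G0 \<subseteq> G" using F0 F1 by (auto simp: F_def G_def G0_def)
    have F1': "1 - \<epsilon> * \<mu> / 2 < (\<Sum>l\<in>F. (cmod (\<phi> (y - l)))\<^sup>2)"
      using F1(3) sum_mono2[of F F1 "\<lambda>l. (cmod (\<phi> (y - l)))\<^sup>2"] F(1) by (auto simp: F_def)
    have "\<exists>i<r. \<forall>j<r. N F g j \<le> N F g i" for g
    proof -
      have "finite (N F g ` {..<r})" "N F g ` {..<r} \<noteq> {}" using r by (auto simp: lessThan_empty_iff)
      moreover from this have "Max (N F g ` {..<r}) \<in> N F g ` {..<r}" by (rule Max_in)
      then obtain i where "Max (N F g ` {..<r}) = N F g i" "i \<in> {..<r}" by (rule imageE)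
      ultimately show ?thesis using Max_ge[of "N F g ` {..<r}"] by (intro exI[of _ i]) auto
    qed
    then obtain s where s: "\<And>g. s g < r" "\<And>g j. j < r \<Longrightarrow> N F g j \<le> N F g (s g)" by metis
    have NN: "(\<Sum>g\<in>G. N F g (s g)) \<le> 1"
    proof -
      let ?S = "{l \<in> F. e l = s (\<rho> l)}"
      have "(\<Sum>g\<in>G. N F g (s g)) = (\<Sum>g\<in>G. \<Sum>l\<in>{l \<in> ?S. \<rho> l = g}. (cmod (\<psi> (y - l)))\<^sup>2)"
        unfolding N_def by (intro sum.cong refl arg_cong2[where f=sum]) auto
      also have "\<dots> = (\<Sum>l\<in>?S. (cmod (\<psi> (y - l)))\<^sup>2)"
        using F by (intro sum.group) (auto simp: G_def)
      also have "\<dots> \<le> 1" using F by (intro bes sel[of _ s]) auto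
      finally show ?thesis .
    qed
    \<comment> \<open>Where the selected class falls short of the best one, the weighted mean falls
      short by at least \<open>\<mu>\<close> times as much. The total loss is below
      \<open>\<epsilon> * \<mu> / 2\<close>, so the shortfalls add up to less than
      \<open>\<epsilon> / 2\<close>.\<close>
    have "\<mu> * (\<Sum>g\<in>G0. N F g (s g) - N F g 0) \<le> (\<Sum>g\<in>G0. m g 0 * (N F g (s g) - N F g 0))"
      unfolding sum_distrib_left using \<mu> s(2) r by (intro sum_mono mult_right_mono) auto
    also have "\<dots> \<le> (\<Sum>g\<in>G0. \<Sum>i<r. m g i * (N F g (s g) - N F g i))"
    proof (intro sum_mono)
      fix g
      show "m g 0 * (N F g (s g) - N F g 0) \<le> (\<Sum>i<r. m g i * (N F g (s g) - N F g i))"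
        using r s(2) by (intro member_le_sum[where f="\<lambda>i. m g i * (N F g (s g) - N F g i)"]) (auto simp: m_def)
    qed
    also have "\<dots> \<le> (\<Sum>g\<in>G. \<Sum>i<r. m g i * (N F g (s g) - N F g i))"
      using F s(2) by (intro sum_mono2) (auto simp: m_def intro!: sum_nonneg)
    also have "\<dots> = (\<Sum>g\<in>G. N F g (s g)) - (\<Sum>l\<in>F. (cmod (\<phi> (y - l)))\<^sup>2)"
      by (simp add: mN F G_def right_diff_distrib sum_subtractf sum_distrib_right[symmetric] m1)
    also have "\<dots> < \<epsilon> * \<mu> / 2" using NN F1' by simp
    finally have "(\<Sum>g\<in>G0. N F g (s g) - N F g 0) < \<epsilon> / 2" using \<mu>(1) by (simp add: field_simps)
    moreover have "(\<Sum>l\<in>F0. (cmod (\<phi> (y - l)))\<^sup>2) \<le> (\<Sum>g\<in>G0. N F g (s g))"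
    proof -
      have "N F0 g i \<le> N F g i" for g i
        unfolding N_def using F by (intro sum_mono2) auto
      then have "N F0 g i \<le> N F g (s g)" if "i < r" for g i
        using s(2)[OF that, of g] order_trans by blast
      then have "(\<Sum>i<r. m g i * N F0 g i) \<le> (\<Sum>i<r. m g i * N F g (s g))" for g
        by (intro sum_mono mult_left_mono) (auto simp: m_def)
      then show ?thesis
        unfolding mN[OF F0(1)] G0_def by (intro sum_mono) (simp add: sum_distrib_right[symmetric] m1)
    qed
    ultimately have "1 - \<epsilon> < (\<Sum>g\<in>G0. N F g 0)" using F0(3) by (simp add: sum_subtractf)
    also have "\<dots> = (\<Sum>g\<in>G0. \<Sum>l\<in>{l \<in> {l \<in> F. \<rho> l \<in> G0 \<and> e l = 0}. \<rho> l = g}. (cmod (\<psi> (y - l)))\<^sup>2)"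
      unfolding N_def by (intro sum.cong refl arg_cong2[where f=sum]) auto
    also have "\<dots> = (\<Sum>l\<in>{l \<in> F. \<rho> l \<in> G0 \<and> e l = 0}. (cmod (\<psi> (y - l)))\<^sup>2)"
      using F F0 by (intro sum.group) (auto simp: G0_def)
    finally show "\<exists>F. finite F \<and> F \<subseteq> \<Lambda>s \<and> 1 - \<epsilon> < (\<Sum>l\<in>F. (cmod (\<psi> (y - l)))\<^sup>2)"
      using F by (intro exI[of _ "{l \<in> F. \<rho> l \<in> G0 \<and> e l = 0}"]) (auto simp: \<Lambda>s)
  qed
qed

text \<open>The sum over \<open>\<Lambda>\<close> already reaches \<open>1\<close>, so one more
  orthogonal point with a nonzero term would violate Bessel's inequality.\<close>

lemma complete_at_no_extra_point:
  assumes "complete_at \<psi> \<Lambda> y" "orth \<psi> (insert z \<Lambda>)" "z \<notin> \<Lambda>" "\<psi> (y - z) \<noteq> 0"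
    and bes: "\<And>F. finite F \<Longrightarrow> orth \<psi> F \<Longrightarrow> (\<Sum>l\<in>F. (cmod (\<psi> (y - l)))\<^sup>2) \<le> 1"
  shows False
proof -
  have "0 < (cmod (\<psi> (y - z)))\<^sup>2" using assms(4) by simp
  then obtain F where F: "finite F" "F \<subseteq> \<Lambda>" "1 - (cmod (\<psi> (y - z)))\<^sup>2 < (\<Sum>l\<in>F. (cmod (\<psi> (y - l)))\<^sup>2)"
    using assms(1) unfolding complete_at_def by blast
  have "orth \<psi> (insert z F)" using assms(2) F(2) unfolding orth_def by blast
  then have "(\<Sum>l\<in>insert z F. (cmod (\<psi> (y - l)))\<^sup>2) \<le> 1" using F(1) by (intro bes) auto
  moreover have "z \<notin> F" using assms(3) F(2) by auto
  ultimately show False using F by simp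
qed

text \<open>Parseval for \<open>\<phi>\<close> and Bessel for \<open>\<psi>\<close> squeeze the two
  sums together, although the term at \<open>z\<close> is strictly smaller for
  \<open>\<phi>\<close>.\<close>

lemma complete_at_factor_needed:
  assumes factor: "\<And>x. \<phi> x = \<kappa> x * \<psi> x" and "complete_at \<phi> \<Lambda> y" "orth \<psi> \<Lambda>"
    and z: "z \<in> \<Lambda>" "\<psi> (y - z) \<noteq> 0" "cmod (\<kappa> (y - z)) < 1" and le: "\<And>x. cmod (\<kappa> x) \<le> 1"
    and bes: "\<And>F. finite F \<Longrightarrow> orth \<psi> F \<Longrightarrow> (\<Sum>l\<in>F. (cmod (\<psi> (y - l)))\<^sup>2) \<le> 1"
  shows False
proof -
  have le2: "(cmod (\<phi> x))\<^sup>2 \<le> (cmod (\<psi> x))\<^sup>2" for x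
    unfolding factor norm_mult by (intro power_mono mult_left_le_one_le le) auto
  have "cmod (\<kappa> (y - z)) * cmod (\<psi> (y - z)) < 1 * cmod (\<psi> (y - z))"
    using z by (intro mult_strict_right_mono) auto
  then have "(cmod (\<phi> (y - z)))\<^sup>2 < (cmod (\<psi> (y - z)))\<^sup>2"
    unfolding factor norm_mult by (intro power_strict_mono) auto
  then have "0 < (cmod (\<psi> (y - z)))\<^sup>2 - (cmod (\<phi> (y - z)))\<^sup>2" by simp
  then obtain F where F: "finite F" "F \<subseteq> \<Lambda>"
      "1 - ((cmod (\<psi> (y - z)))\<^sup>2 - (cmod (\<phi> (y - z)))\<^sup>2) < (\<Sum>l\<in>F. (cmod (\<phi> (y - l)))\<^sup>2)"
    using assms(2) unfolding complete_at_def by blast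
  have "(\<Sum>l\<in>F - {z}. (cmod (\<phi> (y - l)))\<^sup>2) \<le> (\<Sum>l\<in>F - {z}. (cmod (\<psi> (y - l)))\<^sup>2)"
    by (intro sum_mono le2)
  moreover have "(\<Sum>l\<in>F. (cmod (\<phi> (y - l)))\<^sup>2) \<le> (\<Sum>l\<in>insert z F. (cmod (\<phi> (y - l)))\<^sup>2)"
    using F by (intro sum_mono2) auto
  moreover have "orth \<psi> (insert z F)" using assms(3) z(1) F(2) unfolding orth_def by blast
  then have "(\<Sum>l\<in>insert z F. (cmod (\<psi> (y - l)))\<^sup>2) \<le> 1" using F(1) by (intro bes) auto
  ultimately show False
    using F by (simp add: sum.insert_remove)
qed

section \<open>Rational spectra and operations that preserve them\<close>

definition rational_adm :: "(nat \<Rightarrow> real) \<Rightarrow> (nat \<Rightarrow> nat) \<Rightarrow> bool" where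
  "rational_adm c q \<longleftrightarrow> admissible c q \<and> (\<forall>n. c n \<in> \<rat> \<and> c n \<noteq> 0)"

text \<open>Completeness is only recorded at irrational points: there no factor of the product vanishes.\<close>

definition rational_spectrum :: "(nat \<Rightarrow> real) \<Rightarrow> (nat \<Rightarrow> nat) \<Rightarrow> real set \<Rightarrow> bool" where
  "rational_spectrum c q \<Lambda> \<longleftrightarrow> \<Lambda> \<subseteq> \<rat> \<and> orth (ker_prod c q) \<Lambda> \<and>
     (\<forall>y. y \<notin> \<rat> \<longrightarrow> complete_at (ker_prod c q) \<Lambda> y)"

text \<open>With \<open>0\<close> in the spectrum, its other points are themselves zeros of the
  transform.\<close>

definition qspec :: "(nat \<Rightarrow> real) \<Rightarrow> (nat \<Rightarrow> nat) \<Rightarrow> bool" where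
  "qspec c q \<longleftrightarrow> rational_adm c q \<and> (\<exists>\<Lambda>. 0 \<in> \<Lambda> \<and> rational_spectrum c q \<Lambda>)"

lemma rational_admD: "rational_adm c q \<Longrightarrow> admissible c q" "rational_adm c q \<Longrightarrow> c n \<in> \<rat>"
    "rational_adm c q \<Longrightarrow> c n \<noteq> 0" "rational_adm c q \<Longrightarrow> 1 \<le> q n"
  by (auto simp: rational_adm_def admissible_def)

lemma rational_adm_delete: "rational_adm c q \<Longrightarrow> rational_adm c (q(n := 1))"
  using admissible_upd[of c q 1 n "c n"] by (simp add: rational_adm_def)

lemma ker_zero_rational:
  assumes "rational_adm c q" "ker (q n) (c n * x) = 0"
  shows "x \<in> \<rat>"
proof -
  have "real (q n) * (c n * x) \<in> \<int>"
    using assms rational_admD(4)[OF assms(1), of n] by (simp add: ker_eq_0_iff)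
  then obtain k where "real (q n) * (c n * x) = of_int k" by (elim Ints_cases)
  then have "x = of_int k / (real (q n) * c n)"
    using rational_admD(2-4)[OF assms(1), of n] by (simp add: field_simps)
  then show ?thesis using rational_admD(2)[OF assms(1), of n] by simp
qed

lemma ker_prod_zero_rational: "rational_adm c q \<Longrightarrow> ker_prod c q x = 0 \<Longrightarrow> x \<in> \<rat>"
  using ker_zero_rational by (auto simp: ker_prod_eq_0_iff rational_admD)

lemma rational_spectrum_nonempty: "rational_spectrum c q \<Lambda> \<Longrightarrow> \<Lambda> \<noteq> {}"
proof
  assume "rational_spectrum c q \<Lambda>" "\<Lambda> = {}"
  moreover obtain y :: real where "y \<notin> \<rat>" using ex_irrational by blast
  ultimately have "complete_at (ker_prod c q) {} y" by (auto simp: rational_spectrum_def)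
  then show False unfolding complete_at_def by (auto dest!: spec[of _ 1])
qed

lemma orth_translate: "orth \<phi> \<Lambda> \<Longrightarrow> orth \<phi> ((\<lambda>l. l - z) ` \<Lambda>)"
  unfolding orth_def by auto

lemma complete_at_translate:
  assumes "complete_at \<phi> \<Lambda> (y + z)"
  shows "complete_at \<phi> ((\<lambda>l. l - z) ` \<Lambda>) y"
  unfolding complete_at_def
proof (intro allI impI)
  fix \<epsilon> :: real assume "0 < \<epsilon>"
  then obtain F where F: "finite F" "F \<subseteq> \<Lambda>" "1 - \<epsilon> < (\<Sum>l\<in>F. (cmod (\<phi> (y + z - l)))\<^sup>2)"
    using assms unfolding complete_at_def by blast
  have "(\<Sum>l\<in>(\<lambda>l. l - z) ` F. (cmod (\<phi> (y - l)))\<^sup>2) = (\<Sum>l\<in>F. (cmod (\<phi> (y + z - l)))\<^sup>2)"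
    by (subst sum.reindex) (auto simp: inj_on_def algebra_simps)
  then show "\<exists>F. finite F \<and> F \<subseteq> (\<lambda>l. l - z) ` \<Lambda> \<and> 1 - \<epsilon> < (\<Sum>l\<in>F. (cmod (\<phi> (y - l)))\<^sup>2)"
    using F by (intro exI[of _ "(\<lambda>l. l - z) ` F"]) auto
qed

lemma qspecI:
  assumes "rational_adm c q" "rational_spectrum c q \<Lambda>"
  shows "qspec c q"
proof -
  obtain z where z: "z \<in> \<Lambda>" using rational_spectrum_nonempty[OF assms(2)] by blast
  then have "z \<in> \<rat>" using assms by (auto simp: rational_spectrum_def)
  have "rational_spectrum c q ((\<lambda>l. l - z) ` \<Lambda>)"
    unfolding rational_spectrum_def
  proof (intro conjI allI impI)
    show "(\<lambda>l. l - z) ` \<Lambda> \<subseteq> \<rat>" using assms \<open>z \<in> \<rat>\<close> by (auto simp: rational_spectrum_def)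
    show "orth (ker_prod c q) ((\<lambda>l. l - z) ` \<Lambda>)" using assms by (auto simp: rational_spectrum_def intro: orth_translate)
    fix y :: real assume "y \<notin> \<rat>"
    then have "y + z \<notin> \<rat>" using Rats_diff[of "y + z" z] \<open>z \<in> \<rat>\<close> by auto
    then show "complete_at (ker_prod c q) ((\<lambda>l. l - z) ` \<Lambda>) y"
      using assms by (intro complete_at_translate) (auto simp: rational_spectrum_def)
  qed
  then show ?thesis using z assms(1) by (auto simp: qspec_def intro!: exI[of _ "(\<lambda>l. l - z) ` \<Lambda>"])
qed

text \<open>Differences of spectral points are zeros, hence rational; moving one point to
  \<open>0\<close> makes the whole spectrum rational.\<close>

lemma spectral_imp_qspec:
  assumes adm: "rational_adm c q" and "spectral_measure (kconv c q)"
  shows "qspec c q"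
proof -
  obtain \<Lambda> where \<Lambda>: "orth (ker_prod c q) \<Lambda>" "\<And>y. complete_at (ker_prod c q) \<Lambda> y"
    using assms spectral_kconv_iff[of c q] by (auto simp: rational_admD)
  have "\<Lambda> \<noteq> {}"
  proof
    assume "\<Lambda> = {}"
    then show False using \<Lambda>(2)[of 0] unfolding complete_at_def by (auto dest!: spec[of _ 1])
  qed
  then obtain z where z: "z \<in> \<Lambda>" by blast
  have "l - z \<in> \<rat>" if "l \<in> \<Lambda>" for l
    using \<Lambda>(1) that z ker_prod_zero_rational[OF adm, of "l - z"] by (cases "l = z") (auto simp: orth_def)
  then have "rational_spectrum c q ((\<lambda>l. l - z) ` \<Lambda>)"
    using \<Lambda> by (auto simp: rational_spectrum_def intro: orth_translate complete_at_translate)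
  then show ?thesis by (rule qspecI[OF adm])
qed

lemma coset_shift:
  "(\<exists>i::int. z = x + of_int k * u + of_int i * u) \<longleftrightarrow> (\<exists>i::int. z = x + of_int i * (u :: real))"
proof
  assume "\<exists>i::int. z = x + of_int k * u + of_int i * u"
  then obtain i :: int where "z = x + of_int k * u + of_int i * u" by blast
  then show "\<exists>i::int. z = x + of_int i * u" by (intro exI[of _ "k + i"]) (simp add: algebra_simps)
next
  assume "\<exists>i::int. z = x + of_int i * u"
  then obtain i :: int where "z = x + of_int i * u" by blast
  then show "\<exists>i::int. z = x + of_int k * u + of_int i * u" by (intro exI[of _ "i - k"]) (simp add: algebra_simps)
qed

text \<open>The representative of the coset of \<open>0\<close> can be prescribed: in a selection
  with at least two classes, \<open>j = 0\<close> keeps the point \<open>0\<close> and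
  \<open>j = 1\<close> discards it.\<close>

lemma coset_representative:
  obtains \<rho> :: "real \<Rightarrow> real" where "\<And>x. \<exists>k::int. \<rho> x = x + of_int k * u" "\<And>x k::int. \<rho> (x + of_int k * u) = \<rho> x"
    "\<rho> 0 = of_int j * u"
proof -
  define \<rho> where "\<rho> x = (if \<exists>k::int. x = of_int k * u then of_int j * u else (SOME z. \<exists>k::int. z = x + of_int k * u))" for x
  have *: "\<exists>z. \<exists>k::int. z = x + of_int k * u" for x by blast
  have "\<exists>k::int. \<rho> x = x + of_int k * u" for x
  proof (cases "\<exists>k::int. x = of_int k * u")
    case True
    then obtain k :: int where "x = of_int k * u" by blast
    then show ?thesis using True by (auto simp: \<rho>_def algebra_simps intro!: exI[of _ "j - k"])
  next
    case False
    then have "\<rho> x = (SOME z. \<exists>k::int. z = x + of_int k * u)" unfolding \<rho>_def by (rule if_not_P)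
    then show ?thesis using someI_ex[OF *[of x]] by simp
  qed
  moreover have "\<rho> (x + of_int k * u) = \<rho> x" for x and k :: int
  proof -
    have 1: "(\<exists>i::int. x + of_int k * u = of_int i * u) \<longleftrightarrow> (\<exists>i::int. x = of_int i * u)"
      by (metis add_diff_cancel_right' left_diff_distrib distrib_right diff_add_cancel of_int_add of_int_diff)
    show ?thesis unfolding \<rho>_def 1 coset_shift ..
  qed
  moreover have "\<rho> 0 = of_int j * u" by (auto simp: \<rho>_def intro: exI[of _ 0])
  ultimately show thesis by (rule that)
qed

lemma rational_spectrum_select:
  assumes adm: "rational_adm c q" and adm': "rational_adm c' q'"
    and r: "1 \<le> r" and a: "a \<in> \<rat>" "a \<noteq> 0" and u: "u = 1 / (a * real r)"
    and factor: "\<And>x. ker_prod c q x = ker r (a * x) * ker_prod c' q' x"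
    and \<Lambda>: "rational_spectrum c q \<Lambda>"
    and \<rho>: "\<And>x. \<exists>k::int. \<rho> x = x + of_int k * u" "\<And>x k. \<rho> (x + of_int k * u) = \<rho> x"
  shows "rational_spectrum c' q' {l \<in> \<Lambda>. \<exists>k::int. l - \<rho> l = of_int k * (real r * u)}"
proof -
  have sp: "\<Lambda> \<subseteq> \<rat>" "orth (ker_prod c q) \<Lambda>" "\<And>y. y \<notin> \<rat> \<Longrightarrow> complete_at (ker_prod c q) \<Lambda> y"
    using \<Lambda> by (auto simp: rational_spectrum_def)
  obtain y0 :: real where y0: "y0 \<notin> \<rat>" using ex_irrational by blast
  note sel = selection[OF r a u factor bessel[OF rational_admD(1)[OF adm']] sp(1,2) sp(3) _ \<rho>]
  show ?thesis
    unfolding rational_spectrum_def using sel y0 sp(1) by blast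
qed

lemma qspec_remove_factor:
  assumes "qspec c q" "1 \<le> q'" "c' \<in> \<rat>" "c' \<noteq> 0" "1 \<le> r" "a \<in> \<rat>" "a \<noteq> 0"
    and "\<And>x. ker (q n) (c n * x) = ker r (a * x) * ker q' (c' * x)"
  shows "qspec (c(n := c')) (q(n := q'))"
proof -
  obtain \<Lambda> where adm: "rational_adm c q" and \<Lambda>: "rational_spectrum c q \<Lambda>"
    using assms(1) by (auto simp: qspec_def)
  have adm': "rational_adm (c(n := c')) (q(n := q'))"
    using adm assms(2-4) admissible_upd[of c q q' n c'] by (auto simp: rational_adm_def)
  obtain \<rho> :: "real \<Rightarrow> real" where \<rho>: "\<And>x. \<exists>k::int. \<rho> x = x + of_int k * (1 / (a * real r))"
      "\<And>x k::int. \<rho> (x + of_int k * (1 / (a * real r))) = \<rho> x" "\<rho> 0 = of_int 0 * (1 / (a * real r))"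
    by (rule coset_representative[of "1 / (a * real r)" 0]) (rule that)
  have factor: "ker_prod c q x = ker r (a * x) * ker_prod (c(n := c')) (q(n := q')) x" for x
    using assms by (intro ker_prod_upd rational_admD(1)[OF adm]) auto
  show ?thesis
    by (rule qspecI[OF adm' rational_spectrum_select[OF adm adm' assms(5-7) refl factor \<Lambda> \<rho>(1,2)]])
qed

text \<open>The digits are a sum of a low, a middle and a high block, of sizes \<open>w\<close>,
  \<open>q'\<close> and \<open>h\<close>. Only the middle block, with a step \<open>w\<close> times
  as large, survives. For \<open>q' = r\<close> prime and \<open>w\<close> a power of
  \<open>r\<close> this isolates one \<open>r\<close>-adic digit.\<close>

lemma qspec_reduce:
  assumes sp: "qspec c q" and q: "q n = w * q' * h" and "1 \<le> q'"
  shows "qspec (c(n := c n * real w)) (q(n := q'))"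
proof -
  have adm: "rational_adm c q" using sp by (simp add: qspec_def)
  have "1 \<le> q n" by (rule rational_admD[OF adm])
  then have w: "1 \<le> w" and h: "1 \<le> h" using q by (auto simp: Suc_le_eq)
  have 1: "qspec (c(n := c n * real w)) (q(n := q' * h))"
    using w h assms rational_admD(2-4)[OF adm, of n] ker_mult[of w "q' * h"]
    by (intro qspec_remove_factor[OF sp, of _ _ w "c n"]) (auto simp: mult_ac Suc_le_eq)
  have "qspec ((c(n := c n * real w))(n := c n * real w)) ((q(n := q' * h))(n := q'))"
    using w h assms rational_admD(2-4)[OF adm, of n] ker_mult[of q' h]
    by (intro qspec_remove_factor[OF 1, of _ _ h "real q' * (c n * real w)"]) (auto simp: mult_ac)
  then show ?thesis by simp
qed

lemma qspec_shift:
  assumes sp: "qspec c q"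
  shows "qspec (\<lambda>n. c (Suc n)) (\<lambda>n. q (Suc n))"
proof -
  have "qspec (c(0 := c 0 * real 1)) (q(0 := 1))"
    by (rule qspec_reduce[OF sp, where h="q 0"]) auto
  then have 1: "qspec c (q(0 := 1))" by simp
  have adm: "admissible c (q(0 := 1))" using 1 by (simp add: qspec_def rational_adm_def)
  have eq: "ker_prod c (q(0 := 1)) = ker_prod (\<lambda>n. c (Suc n)) (\<lambda>n. q (Suc n))"
    using ker_prod_split[OF adm, of _ 1] by auto
  have "rational_adm (\<lambda>n. c (Suc n)) (\<lambda>n. q (Suc n))"
    using 1 admissible_shift[OF adm, of 1] by (auto simp: qspec_def rational_adm_def)
  moreover obtain \<Lambda> where "rational_spectrum c (q(0 := 1)) \<Lambda>" using 1 unfolding qspec_def by blast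
  then have "rational_spectrum (\<lambda>n. c (Suc n)) (\<lambda>n. q (Suc n)) \<Lambda>"
    unfolding rational_spectrum_def eq .
  ultimately show ?thesis by (rule qspecI)
qed

lemma complete_at_scale:
  assumes "complete_at \<phi> \<Lambda> (a * y)" "a \<noteq> 0"
  shows "complete_at (\<lambda>x. \<phi> (a * x)) ((\<lambda>l. l / a) ` \<Lambda>) y"
  unfolding complete_at_def
proof (intro allI impI)
  fix \<epsilon> :: real assume "0 < \<epsilon>"
  then obtain F where F: "finite F" "F \<subseteq> \<Lambda>" "1 - \<epsilon> < (\<Sum>l\<in>F. (cmod (\<phi> (a * y - l)))\<^sup>2)"
    using assms(1) unfolding complete_at_def by blast
  have "(\<Sum>l\<in>(\<lambda>l. l / a) ` F. (cmod (\<phi> (a * (y - l))))\<^sup>2) = (\<Sum>l\<in>F. (cmod (\<phi> (a * y - l)))\<^sup>2)"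
    using assms(2) by (subst sum.reindex) (auto simp: inj_on_def algebra_simps)
  then show "\<exists>F. finite F \<and> F \<subseteq> (\<lambda>l. l / a) ` \<Lambda> \<and> 1 - \<epsilon> < (\<Sum>l\<in>F. (cmod (\<phi> (a * (y - l))))\<^sup>2)"
    using F by (intro exI[of _ "(\<lambda>l. l / a) ` F"]) auto
qed

lemma orth_scale: "orth \<phi> \<Lambda> \<Longrightarrow> a \<noteq> 0 \<Longrightarrow> orth (\<lambda>x. \<phi> (a * x)) ((\<lambda>l. l / a) ` \<Lambda>)"
  unfolding orth_def by (auto simp: diff_divide_distrib[symmetric])

lemma qspec_scale:
  assumes "qspec c q" "a \<in> \<rat>" "a \<noteq> 0"
  shows "qspec (\<lambda>n. a * c n) q"
proof -
  obtain \<Lambda> where adm: "rational_adm c q" and \<Lambda>: "0 \<in> \<Lambda>" "rational_spectrum c q \<Lambda>"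
    using assms(1) by (auto simp: qspec_def)
  have eq: "ker_prod (\<lambda>n. a * c n) q = (\<lambda>x. ker_prod c q (a * x))"
    by (rule ext) (rule ker_prod_scale)
  have irr: "a * y \<notin> \<rat>" if "y \<notin> \<rat>" for y
    using Rats_divide[of "a * y" a] that assms by auto
  have "rational_spectrum (\<lambda>n. a * c n) q ((\<lambda>l. l / a) ` \<Lambda>)"
    using \<Lambda>(2) assms irr
    by (auto simp: rational_spectrum_def eq intro!: complete_at_scale orth_scale)
  moreover have "rational_adm (\<lambda>n. a * c n) q"
    using adm assms admissible_scale by (auto simp: rational_adm_def)
  ultimately show ?thesis by (rule qspecI[rotated])
qed

text \<open>If no point of the spectrum were a zero of the \<open>n\<close>-th factor, one could select an empty class
  in the coset of \<open>0\<close>; the selected set would be a spectrum of the reduced product, although \<open>0\<close> could be added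
  to it.\<close>

lemma rational_spectrum_zero_point:
  assumes adm: "rational_adm c q" and \<Lambda>: "rational_spectrum c q \<Lambda>" "0 \<in> \<Lambda>" and q: "2 \<le> q n"
  shows "\<exists>x\<in>\<Lambda>. ker (q n) (c n * x) = 0"
proof (rule ccontr)
  assume "\<not> ?thesis"
  then have nz: "\<And>x. x \<in> \<Lambda> \<Longrightarrow> ker (q n) (c n * x) \<noteq> 0" by blast
  let ?q = "q(n := 1)"
  define u where "u = 1 / (c n * real (q n))"
  have cn: "c n \<in> \<rat>" "c n \<noteq> 0" "1 \<le> q n" using rational_admD[OF adm] by auto
  have adm': "rational_adm c ?q"
    by (rule rational_adm_delete[OF adm])
  obtain \<rho> :: "real \<Rightarrow> real" where \<rho>: "\<And>x. \<exists>k::int. \<rho> x = x + of_int k * u"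
      "\<And>x k::int. \<rho> (x + of_int k * u) = \<rho> x" "\<rho> 0 = of_int 1 * u"
    by (rule coset_representative[of u 1]) (rule that)
  have factor: "ker_prod c q x = ker (q n) (c n * x) * ker_prod c ?q x" for x
    by (rule ker_prod_delete[OF rational_admD(1)[OF adm]])
  define \<Lambda>s where "\<Lambda>s = {l \<in> \<Lambda>. \<exists>k::int. l - \<rho> l = of_int k * (real (q n) * u)}"
  have sp: "rational_spectrum c ?q \<Lambda>s"
    unfolding \<Lambda>s_def by (rule rational_spectrum_select[OF adm adm' cn(3,1,2) u_def factor \<Lambda>(1) \<rho>(1,2)])
  have "0 \<notin> \<Lambda>s"
  proof
    assume "0 \<in> \<Lambda>s"
    then obtain k :: int where "- u = of_int k * (real (q n) * u)" using \<rho>(3) by (auto simp: \<Lambda>s_def)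
    then have "- 1 = real_of_int (k * int (q n))" using cn by (simp add: u_def field_simps)
    then have "- 1 = k * int (q n)" by linarith
    then have "int (q n) dvd 1" by (metis dvd_minus_iff dvd_triv_right)
    then show False using q by simp
  qed
  moreover have "orth (ker_prod c ?q) (insert 0 \<Lambda>s)"
  proof -
    have z: "ker_prod c ?q l = 0" if "l \<in> \<Lambda>s" for l
    proof -
      have "l \<in> \<Lambda>" "l \<noteq> 0" using that \<open>0 \<notin> \<Lambda>s\<close> by (auto simp: \<Lambda>s_def)
      then have "ker_prod c q (l - 0) = 0" using \<Lambda> unfolding rational_spectrum_def orth_def by blast
      then show ?thesis using nz[OF \<open>l \<in> \<Lambda>\<close>] factor[of l] by simp
    qed
    have z': "ker_prod c ?q (- l) = 0" if "l \<in> \<Lambda>s" for l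
      using z[OF that] norm_ker_prod_minus[OF rational_admD(1)[OF adm'], of l] by simp
    show ?thesis
      using sp z z' unfolding rational_spectrum_def orth_def by auto
  qed
  moreover obtain y :: real where "y \<notin> \<rat>" using ex_irrational by blast
  moreover have "ker_prod c ?q (y - 0) \<noteq> 0"
    using ker_prod_zero_rational[OF adm', of y] \<open>y \<notin> \<rat>\<close> by auto
  ultimately show False
    using complete_at_no_extra_point[of "ker_prod c ?q" \<Lambda>s y 0] sp bessel[OF rational_admD(1)[OF adm']]
    by (auto simp: rational_spectrum_def)
qed


section \<open>Arithmetic obstructions to spectrality\<close>

text \<open>The localisation of the integers at the prime \<open>r\<close>, as a set of reals. Valuations of rational
  numbers are expressed through it.\<close>

definition loc :: "int \<Rightarrow> real set" where
  "loc r = {x. \<exists>A B. \<not> r dvd B \<and> x * of_int B = of_int A}"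

lemma locI: "\<not> r dvd B \<Longrightarrow> x * of_int B = of_int A \<Longrightarrow> x \<in> loc r"
  by (auto simp: loc_def)

lemma loc_of_int: "prime r \<Longrightarrow> of_int k \<in> loc r"
  by (rule locI[of r 1 _ k]) (auto dest: not_prime_unit)

lemma loc_add:
  assumes "prime r" "x \<in> loc r" "y \<in> loc r"
  shows "x + y \<in> loc r"
proof -
  obtain A B C D where "\<not> r dvd B" "x * of_int B = of_int A" "\<not> r dvd D" "y * of_int D = of_int C"
    using assms by (auto simp: loc_def)
  moreover from this have "(x + y) * of_int (B * D) = of_int (A * D + C * B)"
    by (simp add: distrib_right) (metis mult.assoc mult.commute)
  ultimately show ?thesis using assms(1) by (intro locI[of r "B * D" _ "A * D + C * B"]) (auto simp: prime_dvd_mult_iff)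
qed

lemma loc_minus: "x \<in> loc r \<Longrightarrow> - x \<in> loc r"
proof -
  assume "x \<in> loc r"
  then obtain A B where "\<not> r dvd B" "x * of_int B = of_int A" by (auto simp: loc_def)
  then show ?thesis by (intro locI[of r B _ "- A"]) auto
qed

lemma loc_diff: "prime r \<Longrightarrow> x \<in> loc r \<Longrightarrow> y \<in> loc r \<Longrightarrow> x - y \<in> loc r"
  using loc_add[of r x "- y"] loc_minus[of y r] by simp

text \<open>As \<open>r\<close> does not divide \<open>\<alpha>\<close>, the factor \<open>r\<close>
  in the denominator cannot cancel.\<close>

lemma loc_not_unit_over:
  assumes "prime r" "\<not> r dvd \<alpha>" "x * of_int (\<beta> * r) = of_int \<alpha>"
  shows "x \<notin> loc r"
proof
  assume "x \<in> loc r"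
  then obtain A B where AB: "\<not> r dvd B" "x * of_int B = of_int A" by (auto simp: loc_def)
  have "real_of_int (\<alpha> * B) = x * of_int (\<beta> * r) * of_int B" by (simp only: assms(3) of_int_mult[of \<alpha> B])
  also have "\<dots> = (x * of_int B) * of_int (\<beta> * r)" by (simp only: mult_ac)
  also have "\<dots> = of_int (A * (\<beta> * r))" by (simp only: AB of_int_mult)
  finally have "\<alpha> * B = A * (\<beta> * r)" by (simp only: of_int_eq_iff)
  then have "r dvd \<alpha> * B" by simp
  then show False using assms AB by (simp add: prime_dvd_mult_iff)
qed

lemma multiplicity_split:
  fixes x p :: int
  assumes "x \<noteq> 0" "\<not> is_unit p"
  shows "\<exists>y. x = y * p ^ multiplicity p x \<and> \<not> p dvd y"
proof -
  obtain y where "x = p ^ multiplicity p x * y" "\<not> p dvd y"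
    by (rule multiplicity_decompose'[OF assms])
  then show ?thesis by (intro exI[of _ y]) (simp add: mult.commute)
qed

lemma Ints_coprime_mult:
  assumes "of_int A * x \<in> \<int>" "of_int B * x \<in> \<int>" "coprime A B"
  shows "(x::real) \<in> \<int>"
proof -
  obtain u v where "u * A + v * B = 1"
    using bezout_int[of A B] assms(3) by (auto simp: coprime_iff_gcd_eq_1)
  then have "real_of_int (u * A + v * B) = 1" by simp
  then have "x = (of_int (u * A + v * B)) * x" by simp
  also have "\<dots> = of_int u * (of_int A * x) + of_int v * (of_int B * x)"
    by (simp add: algebra_simps)
  finally have "x = of_int u * (of_int A * x) + of_int v * (of_int B * x)" .
  moreover have "of_int u * (of_int A * x) + of_int v * (of_int B * x) \<in> \<int>"
    by (intro Ints_add Ints_mult[OF Ints_of_int assms(1)] Ints_mult[OF Ints_of_int assms(2)])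
  ultimately show ?thesis by simp
qed

text \<open>Two factors with the same prime \<open>r\<close> whose zeros have the same \<open>r\<close>-adic valuation: select the points
  with a fixed \<open>r\<close>-adic digit at that place. This is a legitimate selection for the first factor and
  leaves no differences among the zeros of the second one.\<close>

lemma qspec_no_overlap:
  assumes sp: "qspec c q" and nk: "n \<noteq> k" and r: "prime r" and q: "q n = r" "q k = r"
    and ratio: "of_int \<alpha> * c k = of_int \<beta> * c n" "\<not> int r dvd \<alpha>" "\<not> int r dvd \<beta>"
  shows False
proof -
  have pr: "prime (int r)" using r by simp
  have r2: "2 \<le> r" using r by (rule prime_ge_2_nat)
  obtain \<Lambda> where adm: "rational_adm c q" and \<Lambda>: "rational_spectrum c q \<Lambda>"
    using sp by (auto simp: qspec_def)
  define u where "u = 1 / (c n * real r)"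
  have cn: "c n \<in> \<rat>" "c n \<noteq> 0" "c k \<in> \<rat>" "c k \<noteq> 0" using rational_admD(2,3)[OF adm] by auto
  have u0: "u \<noteq> 0" using cn r2 by (simp add: u_def)
  \<comment> \<open>\<open>h\<close> chooses one point from each class modulo \<open>u\<close> times
    the localisation. Such a class is a union of cosets of \<open>u\<close> times the integers, and
    two points whose difference is a zero of the second factor share a class.\<close>
  define h where "h x = (SOME z. (z - x) / u \<in> loc r)" for x
  have h: "(h x - x) / u \<in> loc r" for x
    unfolding h_def by (rule someI[of _ x]) (use loc_of_int[OF pr, of 0] in simp)
  have h_eq: "h x = h y" if "(x - y) / u \<in> loc r" for x y
  proof -
    have "(z - x) / u \<in> loc r \<longleftrightarrow> (z - y) / u \<in> loc r" for z
      using loc_add[OF pr, of "(z - x) / u" "(x - y) / u"] loc_diff[OF pr, of "(z - y) / u" "(x - y) / u"] that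
      by (auto simp: add_divide_distrib[symmetric] diff_divide_distrib[symmetric])
    then show ?thesis by (simp add: h_def)
  qed
  \<comment> \<open>\<open>z\<close> is a point of the coset of \<open>x\<close> whose
    \<open>r\<close>-adic digit relative to \<open>h x\<close> vanishes.\<close>
  define P where "P x z \<longleftrightarrow> (\<exists>i::int. z = x + of_int i * u) \<and> (z - h x) / (real r * u) \<in> loc r" for x z
  define \<rho> where "\<rho> x = (SOME z. P x z)" for x
  have "\<exists>z. P x z" for x
  proof -
    have "(x - h x) / u \<in> loc r" using loc_minus[OF h[of x]] by (simp add: minus_divide_left)
    then obtain A B where AB: "\<not> int r dvd B" "(x - h x) / u * of_int B = of_int A" by (auto simp: loc_def)
    have "coprime (int r) B" using AB pr by (simp add: prime_imp_coprime)
    then obtain a b where "a * int r + b * B = 1"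
      using bezout_int[of "int r" B] by (auto simp: coprime_iff_gcd_eq_1)
    then have "A * (a * int r + b * B) = A" by simp
    then have *: "A - A * b * B = A * a * int r" by (simp add: algebra_simps)
    \<comment> \<open>\<open>(x - h x) / u\<close> is \<open>A / B\<close>, and \<open>b\<close>
      inverts \<open>B\<close> modulo \<open>r\<close>. Subtracting the integer \<open>A * b\<close>
      leaves \<open>A * a * r / B\<close>, which is divisible by \<open>r\<close> in the
      localisation.\<close>
    define z where "z = x + of_int (- A * b) * u"
    have "(z - h x) / u * of_int B = of_int A - of_int (A * b * B)"
      using AB(2) u0 by (simp add: z_def add_divide_distrib diff_divide_distrib algebra_simps)
    also have "\<dots> = of_int (A * a * int r)" by (simp only: * of_int_diff[symmetric])
    finally have "((z - h x) / u * of_int B) / real r = of_int (A * a)" using r2 by simp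
    moreover have "(z - h x) / (real r * u) * of_int B = ((z - h x) / u * of_int B) / real r" by simp
    ultimately have "(z - h x) / (real r * u) * of_int B = of_int (A * a)" by simp
    then have "(z - h x) / (real r * u) \<in> loc r" by (rule locI[OF AB(1)])
    then have "P x z" unfolding P_def z_def by blast
    then show ?thesis by blast
  qed
  then have P: "P x (\<rho> x)" for x unfolding \<rho>_def by (rule someI_ex)
  have \<rho>2: "\<rho> (x + of_int i * u) = \<rho> x" for x i
  proof -
    have hh: "h (x + of_int i * u) = h x" using u0 loc_of_int[OF pr] by (intro h_eq) simp
    show ?thesis by (simp add: \<rho>_def P_def hh coset_shift)
  qed
  have \<rho>1: "\<exists>i::int. \<rho> x = x + of_int i * u" for x using P by (simp add: P_def)
  let ?q = "q(n := 1)" and ?q' = "q(n := 1, k := 1)"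
  have adm1: "rational_adm c ?q"
    by (rule rational_adm_delete[OF adm])
  have adm2: "rational_adm c ?q'"
    by (rule rational_adm_delete[OF adm1])
  have f1: "ker_prod c q x = ker r (c n * x) * ker_prod c ?q x" for x
    using ker_prod_delete[OF rational_admD(1)[OF adm], of x n] q by simp
  have f2: "ker_prod c ?q x = ker r (c k * x) * ker_prod c ?q' x" for x
    using ker_prod_delete[OF rational_admD(1)[OF adm1], of x k] q nk by simp
  define \<Lambda>s where "\<Lambda>s = {l \<in> \<Lambda>. \<exists>i::int. l - \<rho> l = of_int i * (real r * u)}"
  have sps: "rational_spectrum c ?q \<Lambda>s"
    unfolding \<Lambda>s_def using r2
    by (intro rational_spectrum_select[OF adm adm1 _ cn(1,2) u_def f1 \<Lambda> \<rho>1 \<rho>2]) simp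
  have digit: "(l - h l) / (real r * u) \<in> loc r" if "l \<in> \<Lambda>s" for l
  proof -
    obtain i :: int where "l - \<rho> l = of_int i * (real r * u)" using \<open>l \<in> \<Lambda>s\<close> by (auto simp: \<Lambda>s_def)
    then have "(l - \<rho> l) / (real r * u) \<in> loc r" using u0 r2 loc_of_int[OF pr] by simp
    moreover have "(\<rho> l - h l) / (real r * u) \<in> loc r" using P by (simp add: P_def)
    ultimately show ?thesis
      using loc_add[OF pr] by (fastforce simp: add_divide_distrib[symmetric])
  qed
  have "orth (ker_prod c ?q') \<Lambda>s"
    unfolding orth_def
  proof (intro ballI impI)
    fix l l' assume l: "l \<in> \<Lambda>s" "l' \<in> \<Lambda>s" "l \<noteq> l'"
    have "ker_prod c ?q (l - l') = 0" using sps l by (auto simp: rational_spectrum_def orth_def)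
    moreover have "ker r (c k * (l - l')) \<noteq> 0"
    proof
      assume "ker r (c k * (l - l')) = 0"
      then have *: "real r * (c k * (l - l')) \<in> \<int>" "c k * (l - l') \<notin> \<int>"
        using r2 by (auto simp: ker_eq_0_iff)
      then obtain e where e: "real r * (c k * (l - l')) = of_int e" by (elim Ints_cases)
      have re: "\<not> int r dvd e"
      proof
        assume "int r dvd e"
        then obtain f where "e = int r * f" ..
        then have "c k * (l - l') = of_int f" using e r2 by simp
        then show False using * by simp
      qed
      have "(l - l') / u * of_int \<beta> = (of_int \<beta> * c n) * real r * (l - l')"
        by (simp add: u_def)
      also have "\<dots> = of_int \<alpha> * (real r * (c k * (l - l')))" by (simp only: ratio(1)[symmetric] mult_ac)
      also have "\<dots> = of_int (\<alpha> * e)" by (simp only: e of_int_mult)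
      finally have w: "(l - l') / u * of_int \<beta> = of_int (\<alpha> * e)" .
      then have "(l - l') / u \<in> loc r" by (rule locI[OF ratio(3)])
      then have "h l = h l'" by (rule h_eq)
      then have "(l - l') / (real r * u) \<in> loc r"
        using loc_diff[OF pr digit[OF l(1)] digit[OF l(2)]] by (simp add: diff_divide_distrib[symmetric])
      moreover have "(l - l') / (real r * u) \<notin> loc r"
      proof (rule loc_not_unit_over[OF pr])
        show "\<not> int r dvd \<alpha> * e" using re ratio(2) pr by (simp add: prime_dvd_mult_iff)
        show "(l - l') / (real r * u) * of_int (\<beta> * int r) = of_int (\<alpha> * e)"
          using w r2 by simp
      qed
      ultimately show False by simp
    qed
    ultimately show "ker_prod c ?q' (l - l') = 0" using f2 by simp
  qed
  moreover obtain z where z: "z \<in> \<Lambda>s" using rational_spectrum_nonempty[OF sps] by blast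
  moreover have "z \<in> \<rat>" using z sps by (auto simp: rational_spectrum_def)
  moreover obtain y :: real where y: "y \<notin> \<rat>" using ex_irrational by blast
  ultimately have yz: "y - z \<notin> \<rat>" using Rats_add[of "y - z" z] by auto
  have "ker_prod c ?q' (y - z) \<noteq> 0" using ker_prod_zero_rational[OF adm2] yz by blast
  moreover have "cmod (ker r (c k * (y - z))) < 1"
  proof (rule norm_ker_less_1[OF r2])
    show "c k * (y - z) \<notin> \<int>"
    proof
      assume "c k * (y - z) \<in> \<int>"
      then have "c k * (y - z) / c k \<in> \<rat>" using cn Ints_subset_Rats by (intro Rats_divide) auto
      then show False using yz cn by simp
    qed
  qed
  moreover have "complete_at (ker_prod c ?q) \<Lambda>s y" using sps y by (auto simp: rational_spectrum_def)
  ultimately show False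
    using complete_at_factor_needed[of "ker_prod c ?q" "\<lambda>x. ker r (c k * x)" "ker_prod c ?q'" \<Lambda>s y z]
      f2 \<open>orth (ker_prod c ?q') \<Lambda>s\<close> z norm_ker_le_1 bessel[OF rational_admD(1)[OF adm2]] by blast
qed

text \<open>Only the ratios \<open>\<beta>\<close>, the multipliers \<open>s\<close> and the digit
  numbers \<open>q\<close> of the levels matter, not the word. The assumptions pass to tails, so any
  level can be moved to the front.\<close>

locale moran =
  fixes \<beta> s :: "nat \<Rightarrow> int" and q :: "nat \<Rightarrow> nat"
  assumes \<beta>: "2 \<le> \<bar>\<beta> n\<bar>" and s: "s n \<noteq> 0" and q: "2 \<le> q n" and cop: "coprime (s n) (int (q k))"
    and q_bounded: "\<exists>P. \<forall>n. q n \<le> P"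
begin

text \<open>The ratio \<open>\<beta> 0\<close> is left out: it only rescales the measure.\<close>

definition Q :: "nat \<Rightarrow> int" where "Q n = (\<Prod>k=1..n. \<beta> k)"

abbreviation c :: "nat \<Rightarrow> real" where "c n \<equiv> of_int (s n) / of_int (Q n)"

lemma Q_0 [simp]: "Q 0 = 1" and Q_Suc: "Q (Suc n) = Q n * \<beta> (Suc n)"
  by (simp_all add: Q_def)

lemma Q_nonzero: "Q n \<noteq> 0"
  using \<beta> by (auto simp: Q_def) (metis abs_0 not_numeral_le_zero)

text \<open>Since \<open>r\<close> does not divide \<open>s n\<close>, the zeros of the
  \<open>j\<close>-th \<open>r\<close>-adic digit of level \<open>n\<close> have valuation
  \<open>v (Q n) - j - 1\<close>. By \<open>eq\<close> the \<open>i\<close>-th digit of level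
  \<open>k\<close> has the same one, and isolating both digits produces an overlap.\<close>

lemma qspec_no_overlap_levels:
  assumes sp: "qspec c q" and nk: "n \<noteq> k" and r: "prime r"
    and j: "j < multiplicity (int r) (int (q n))" and i: "i < multiplicity (int r) (int (q k))"
    and eq: "i + multiplicity (int r) (Q n) = j + multiplicity (int r) (Q k)"
  shows False
proof -
  have pr: "prime (int r)" and nu: "\<not> is_unit (int r)" using r by auto
  have split: "\<exists>h. q n = r ^ j * r * h" if "j < multiplicity (int r) (int (q n))" for n j
  proof -
    have "int r ^ Suc j dvd int (q n)" using that by (intro multiplicity_dvd') simp
    then have "r ^ Suc j dvd q n" by (metis of_nat_dvd_iff of_nat_power)
    then show ?thesis by (auto simp: mult_ac elim!: dvdE)
  qed
  obtain h where h: "q n = r ^ j * r * h" using split[OF j] by blast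
  obtain h' where h': "q k = r ^ i * r * h'" using split[OF i] by blast
  have r1: "1 \<le> r" using r prime_ge_1_nat by blast
  let ?c1 = "c(n := c n * real (r ^ j))" and ?q1 = "q(n := r)"
  let ?c2 = "?c1(k := ?c1 k * real (r ^ i))" and ?q2 = "?q1(k := r)"
  have sp1: "qspec ?c1 ?q1" by (rule qspec_reduce[OF sp h r1])
  have "?q1 k = r ^ i * r * h'" using h' nk by simp
  from qspec_reduce[OF sp1 this r1] have sp2: "qspec ?c2 ?q2" .
  obtain Qn where Qn: "Q n = Qn * int r ^ multiplicity (int r) (Q n)" "\<not> int r dvd Qn"
    using multiplicity_split[OF Q_nonzero nu, of n] by blast
  obtain Qk where Qk: "Q k = Qk * int r ^ multiplicity (int r) (Q k)" "\<not> int r dvd Qk"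
    using multiplicity_split[OF Q_nonzero nu, of k] by blast
  have rq: "int r dvd int (q n)" "int r dvd int (q k)" by (simp_all add: h h')
  have rs: "\<not> int r dvd s l" for l
    using cop[of l n] rq(1) nu coprime_common_divisor by blast
  show False
  proof (rule qspec_no_overlap[OF sp2 nk r])
    show "?q2 n = r" "?q2 k = r" using nk by auto
    show "\<not> int r dvd s n * Qk" "\<not> int r dvd s k * Qn"
      using rs Qn(2) Qk(2) pr by (auto simp: prime_dvd_mult_iff)
    let ?vn = "multiplicity (int r) (Q n)" and ?vk = "multiplicity (int r) (Q k)"
    have "real r ^ i * real r ^ ?vn = real r ^ j * real r ^ ?vk"
      by (simp only: power_add[symmetric] eq)
    moreover have "real_of_int (Q n) = of_int Qn * real r ^ ?vn" "real_of_int (Q k) = of_int Qk * real r ^ ?vk"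
      using arg_cong[OF Qn(1), of real_of_int] arg_cong[OF Qk(1), of real_of_int] by simp_all
    moreover have "real_of_int Qn \<noteq> 0" "real_of_int Qk \<noteq> 0" using Qn(2) Qk(2) by auto
    ultimately show "of_int (s n * Qk) * ?c2 k = of_int (s k * Qn) * ?c2 n"
      using nk r1 by (simp add: field_simps)
  qed
qed

text \<open>Let \<open>r\<close> be a prime whose power in \<open>q 1\<close> exceeds that in \<open>\<beta> 1\<close>. If \<open>r\<close> divides \<open>q 0\<close>, then the levels \<open>0\<close> and \<open>1\<close>
  overlap. Otherwise let \<open>n\<close> be the level whose zeros have the least \<open>r\<close>-adic valuation \<open>e n < 0\<close>; by the previous
  lemma there is only one. Reduce it to a factor with \<open>r\<close> digits. A spectrum through \<open>0\<close> contains a zero \<open>a\<close> of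
  level \<open>0\<close> and a zero \<open>g\<close> of level \<open>n\<close>. The valuation of \<open>a - g\<close> leaves only level \<open>n\<close> as a
  place where \<open>a - g\<close> can be a zero, but \<open>a\<close> is not in the lattice of that level.\<close>

lemma qspec_dvd_first:
  assumes sp: "qspec c q"
  shows "int (q 1) dvd \<beta> 1"
proof (rule ccontr)
  assume ndvd: "\<not> int (q 1) dvd \<beta> 1"
  have "int (q 1) \<noteq> 0" using q[of 1] by simp
  then obtain r' :: int where r': "prime r'" "multiplicity r' (\<beta> 1) < multiplicity r' (int (q 1))"
    using multiplicity_le_imp_dvd[of "int (q 1)" "\<beta> 1"] ndvd not_le by blast
  define r where "r = nat r'"
  have rr: "r' = int r" using r'(1) prime_ge_0_int by (simp add: r_def)
  have r: "prime r" using r'(1) by (simp add: rr)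
  have pr: "prime (int r)" and nu: "\<not> is_unit (int r)" using r by auto
  define v where "v x = multiplicity (int r) x" for x :: int
  have v1: "v (\<beta> 1) < v (int (q 1))" using r'(2) by (simp add: v_def rr)
  have Q1: "Q 1 = \<beta> 1" by (simp add: Q_def)
  have v_pos: "int r dvd int (q n)" if "0 < v (int (q n))" for n
  proof (rule ccontr)
    assume "\<not> int r dvd int (q n)"
    then have "v (int (q n)) = 0" unfolding v_def by (rule not_dvd_imp_multiplicity_0)
    with that show False by simp
  qed
  have rs: "\<not> int r dvd s l" for l
  proof -
    have "int r dvd int (q 1)" using v_pos v1 by simp
    then show ?thesis using cop[of l 1] nu coprime_common_divisor by blast
  qed
  show False
  proof (cases "int r dvd int (q 0)")
    case True
    then have "0 < v (int (q 0))" using q[of 0] nu by (auto simp: v_def multiplicity_gt_zero_iff)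
    show False
    proof (rule qspec_no_overlap_levels[OF sp _ r])
      show "(0::nat) \<noteq> 1" by simp
      show "0 < multiplicity (int r) (int (q 0))" using \<open>0 < v (int (q 0))\<close> by (simp only: v_def)
      show "v (\<beta> 1) < multiplicity (int r) (int (q 1))" using v1 by (simp only: v_def)
      show "v (\<beta> 1) + multiplicity (int r) (Q 0) = 0 + multiplicity (int r) (Q 1)"
        by (simp only: Q1 v_def Q_0 multiplicity_one)
    qed
  next
    case False
    then have v0: "v (int (q 0)) = 0" by (simp add: v_def not_dvd_imp_multiplicity_0)
    \<comment> \<open>\<open>e k\<close> is the least \<open>r\<close>-adic valuation of a zero of
      level \<open>k\<close>.\<close>
    define e where "e k = int (v (Q k)) - int (v (int (q k)))" for k
    obtain P where P: "\<And>n. q n \<le> P" using q_bounded by blast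
    have vP: "v (int (q k)) \<le> P" for k
    proof -
      have "r ^ v (int (q k)) dvd q k"
        using multiplicity_dvd[of "int r" "int (q k)"] by (metis of_nat_dvd_iff of_nat_power v_def)
      then have "r ^ v (int (q k)) \<le> q k" using q[of k] by (intro dvd_imp_le) auto
      moreover have "v (int (q k)) < r ^ v (int (q k))" using prime_gt_1_nat[OF r] power_gt_expt by simp
      ultimately show ?thesis using P[of k] by linarith
    qed
    \<comment> \<open>The valuations are bounded below by \<open>-P\<close>, because
      \<open>q\<close> is bounded; adding \<open>P\<close> moves them into the natural numbers,
      where a least one exists.\<close>
    obtain n where n: "\<And>k. nat (e n + int P) \<le> nat (e k + int P)"
      using ex_has_least_nat[of "\<lambda>_. True" 0 "\<lambda>k. nat (e k + int P)"] by auto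
    have ek: "0 \<le> e k + int P" for k using vP[of k] by (simp add: e_def)
    have min: "e n \<le> e k" for k using n[of k] ek[of n] ek[of k] by simp
    have "e 1 < 0" using v1 Q1 by (simp add: e_def)
    then have en: "e n < 0" using min[of 1] by simp
    then have vn: "0 < v (int (q n))" by (simp add: e_def)
    have "0 \<le> e 0" by (simp add: e_def v0)
    with en have n0: "n \<noteq> 0" by (metis not_le)
    have strict: "e n < e k" if "k \<noteq> n" for k
    proof (rule ccontr)
      assume "\<not> e n < e k"
      then have eq: "e k = e n" using min[of k] by simp
      then have vk: "0 < v (int (q k))" using en by (simp add: e_def)
      have "v (int (q k)) - 1 + v (Q n) = v (int (q n)) - 1 + v (Q k)"
        using eq vk vn by (simp add: e_def)
      then show False
        using qspec_no_overlap_levels[OF sp that[symmetric] r, of "v (int (q n)) - 1" "v (int (q k)) - 1"] vk vn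
        unfolding v_def by linarith
    qed
    define j where "j = v (int (q n)) - 1"
    have j: "Suc j = v (int (q n))" using vn by (simp add: j_def)
    have "int r ^ Suc j dvd int (q n)" unfolding j v_def by (rule multiplicity_dvd)
    then have "r ^ Suc j dvd q n" by (metis of_nat_dvd_iff of_nat_power)
    then obtain h where "q n = r ^ Suc j * h" by (rule dvdE)
    then have h: "q n = r ^ j * r * h" by (simp add: mult_ac)
    have r1: "1 \<le> r" "2 \<le> r" using r prime_ge_1_nat prime_ge_2_nat by auto
    let ?c = "c(n := c n * real (r ^ j))" and ?q = "q(n := r)"
    have sp': "qspec ?c ?q" by (rule qspec_reduce[OF sp h r1(1)])
    then obtain \<Lambda> where adm: "rational_adm ?c ?q" and \<Lambda>: "rational_spectrum ?c ?q \<Lambda>" "0 \<in> \<Lambda>"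
      unfolding qspec_def by blast
    have "\<exists>a\<in>\<Lambda>. ker (?q 0) (?c 0 * a) = 0"
      using n0 q[of 0] by (intro rational_spectrum_zero_point[OF adm \<Lambda>]) auto
    then obtain a where a: "a \<in> \<Lambda>" "ker (q 0) (of_int (s 0) * a) = 0" using n0 by auto
    have "\<exists>g\<in>\<Lambda>. ker (?q n) (?c n * g) = 0"
      using r1 by (intro rational_spectrum_zero_point[OF adm \<Lambda>]) auto
    then obtain g where g: "g \<in> \<Lambda>" "ker r (c n * real (r ^ j) * g) = 0" by auto
    have a': "real (q 0) * (of_int (s 0) * a) \<in> \<int>" "of_int (s 0) * a \<notin> \<int>"
      using a(2) q[of 0] by (auto simp: ker_eq_0_iff)
    have g': "real r * (c n * real (r ^ j) * g) \<in> \<int>" "c n * real (r ^ j) * g \<notin> \<int>"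
      using g(2) r1 by (auto simp: ker_eq_0_iff)
    then obtain K where K: "real r * (c n * real (r ^ j) * g) = of_int K" by (elim Ints_cases)
    have rK: "\<not> int r dvd K"
    proof
      assume "int r dvd K"
      then obtain f where "K = int r * f" ..
      then have "real r * (c n * real (r ^ j) * g) = real r * of_int f"
        using K by (simp only: of_int_mult of_int_of_nat_eq)
      then have "c n * real (r ^ j) * g = of_int f"
        by (rule mult_left_cancel[THEN iffD1, rotated]) (use r1 in simp)
      then show False using g' by simp
    qed
    obtain Qn where Qn: "Q n = Qn * int r ^ v (Q n)" "\<not> int r dvd Qn"
      using multiplicity_split[OF Q_nonzero nu, of n] unfolding v_def by blast
    \<comment> \<open>Multiplication by \<open>r ^ E\<close> raises the valuation \<open>e n\<close>
      of the zeros of level \<open>n\<close> only to \<open>-1\<close>, but makes all zeros of the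
      other levels \<open>r\<close>-integral.\<close>
    define E where "E = nat (- e n) - 1"
    have E: "v (Q n) + Suc E = Suc j" using en by (simp add: E_def j e_def)
    have gloc: "g * real r ^ E \<notin> loc (int r)"
    proof (rule loc_not_unit_over[OF pr])
      show "\<not> int r dvd K * Qn" using rK Qn(2) pr by (simp add: prime_dvd_mult_iff)
      have 1: "real_of_int (Q n) = of_int Qn * real r ^ v (Q n)" using arg_cong[OF Qn(1), of real_of_int] by simp
      have 2: "real r * real r ^ j = real r ^ v (Q n) * real r ^ Suc E"
        by (simp only: power_Suc[symmetric] power_add[symmetric] E)
      have "of_int K * of_int (Q n) = of_int (s n) * (real r * real r ^ j) * g"
        using K Q_nonzero[of n] by (simp add: field_simps)
      then have "of_int K * (of_int Qn * real r ^ v (Q n)) = of_int (s n) * (real r ^ v (Q n) * real r ^ Suc E) * g"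
        by (simp only: 1 2)
      then have "real r ^ v (Q n) * (of_int K * of_int Qn) = real r ^ v (Q n) * (of_int (s n) * real r ^ Suc E * g)"
        by (simp only: mult_ac)
      then have "of_int K * of_int Qn = of_int (s n) * real r ^ Suc E * g"
        by (rule mult_left_cancel[THEN iffD1, rotated]) (use r1 in simp)
      then show "g * real r ^ E * of_int (s n * int r) = of_int (K * Qn)"
        by (simp add: mult_ac)
    qed
    have int_loc: "x \<in> loc (int r)" if x: "real (q 0) * (of_int (s 0) * x) \<in> \<int>" for x
    proof -
      obtain i where "real (q 0) * (of_int (s 0) * x) = of_int i" using x by (elim Ints_cases)
      moreover have "\<not> int r dvd int (q 0) * s 0"
        using False rs[of 0] pr by (simp only: prime_dvd_mult_iff) simp
      ultimately show ?thesis by (intro locI[of _ "int (q 0) * s 0" _ i]) (auto simp: mult_ac)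
    qed
    have up: "x * real r ^ E \<in> loc (int r)" if x: "x \<in> loc (int r)" for x
    proof -
      obtain A B where "\<not> int r dvd B" "x * of_int B = of_int A" using x by (auto simp: loc_def)
      then show ?thesis by (intro locI[of _ B _ "A * int r ^ E"]) (auto simp: mult_ac)
    qed
    have aloc: "a * real r ^ E \<in> loc (int r)" by (rule up[OF int_loc[OF a'(1)]])
    then have "a \<noteq> g" using gloc by auto
    then have "ker_prod ?c ?q (a - g) = 0"
      using \<Lambda>(1) a(1) g(1) unfolding rational_spectrum_def orth_def by blast
    then obtain k where k: "ker (?q k) (?c k * (a - g)) = 0"
      using ker_prod_eq_0_iff[OF rational_admD(1)[OF adm]] by blast
    have "(a - g) * real r ^ E \<notin> loc (int r)"
    proof
      assume "(a - g) * real r ^ E \<in> loc (int r)"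
      from loc_diff[OF pr aloc this] show False using gloc by (simp add: left_diff_distrib)
    qed
    moreover have "(a - g) * real r ^ E \<in> loc (int r)" if "k = 0"
    proof -
      have "ker (q 0) (of_int (s 0) * (a - g)) = 0" using k that n0 by simp
      then have "real (q 0) * (of_int (s 0) * (a - g)) \<in> \<int>" using q[of 0] by (simp add: ker_eq_0_iff)
      then show ?thesis by (intro up int_loc)
    qed
    moreover have "(a - g) * real r ^ E \<in> loc (int r)" if "k \<noteq> n"
    proof -
      have "ker (q k) (c k * (a - g)) = 0" using k that by simp
      then have "real (q k) * (c k * (a - g)) \<in> \<int>" using q[of k] by (simp add: ker_eq_0_iff)
      then obtain i where i: "real (q k) * (c k * (a - g)) = of_int i" by (elim Ints_cases)
      obtain Qk where Qk: "Q k = Qk * int r ^ v (Q k)" "\<not> int r dvd Qk"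
        using multiplicity_split[OF Q_nonzero nu, of k] unfolding v_def by blast
      have "int (q k) \<noteq> 0" using q[of k] by simp
      then obtain qk where qk: "int (q k) = qk * int r ^ v (int (q k))" "\<not> int r dvd qk"
        using multiplicity_split[of "int (q k)" "int r"] nu unfolding v_def by blast
      define D where "D = nat (e k - e n - 1)"
      have D: "v (Q k) + E = v (int (q k)) + D"
        using strict[OF that] en by (simp add: D_def E_def e_def)
      have 1: "real_of_int (Q k) = of_int Qk * real r ^ v (Q k)" using arg_cong[OF Qk(1), of real_of_int] by simp
      have 2: "real (q k) = of_int qk * real r ^ v (int (q k))" using arg_cong[OF qk(1), of real_of_int] by simp
      have 3: "real r ^ v (Q k) * real r ^ E = real r ^ v (int (q k)) * real r ^ D"
        by (simp only: power_add[symmetric] D)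
      have "real (q k) * of_int (s k) * (a - g) = of_int i * of_int (Q k)"
        using i Q_nonzero[of k] by (simp add: field_simps)
      then have "of_int qk * real r ^ v (int (q k)) * of_int (s k) * (a - g) * real r ^ E
          = of_int i * of_int Qk * (real r ^ v (Q k) * real r ^ E)"
        by (simp only: 1 2 mult.assoc)
      then have "real r ^ v (int (q k)) * (of_int qk * of_int (s k) * (a - g) * real r ^ E)
          = real r ^ v (int (q k)) * (of_int i * of_int Qk * real r ^ D)"
        by (simp only: 3) (simp only: mult_ac)
      then have "of_int qk * of_int (s k) * (a - g) * real r ^ E = of_int i * of_int Qk * real r ^ D"
        by (rule mult_left_cancel[THEN iffD1, rotated]) (use r1 in simp)
      then have "(a - g) * real r ^ E * of_int (qk * s k) = of_int (i * Qk * int r ^ D)" by (simp add: mult_ac)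
      moreover have "\<not> int r dvd qk * s k" using qk(2) rs[of k] pr by (simp add: prime_dvd_mult_iff)
      ultimately show ?thesis by (intro locI)
    qed
    \<comment> \<open>If \<open>a - g\<close> were in the lattice of level \<open>n\<close>, so
      would be \<open>a\<close>. As \<open>r\<close> and \<open>s n\<close> are prime to
      \<open>q 0\<close>, the lattices of both levels together force \<open>s 0 * a\<close> to be an
      integer, which a zero of level \<open>0\<close> excludes.\<close>
    moreover have "k \<noteq> n"
    proof
      assume "k = n"
      then have "ker r (c n * real (r ^ j) * (a - g)) = 0" using k by simp
      then have "real r * (c n * real (r ^ j) * (a - g)) \<in> \<int>" using r1 by (simp add: ker_eq_0_iff)
      then have "real r * (c n * real (r ^ j) * (a - g)) + real r * (c n * real (r ^ j) * g) \<in> \<int>"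
        using g'(1) by (rule Ints_add)
      then have "real r * (c n * real (r ^ j) * a) \<in> \<int>"
        by (simp only: distrib_left[symmetric] diff_add_cancel)
      then obtain i where "real r * (c n * real (r ^ j) * a) = of_int i" by (elim Ints_cases)
      then have "of_int (s n * int r ^ Suc j) * (of_int (s 0) * a) = of_int (i * Q n * s 0)"
        using Q_nonzero[of n] by (simp add: field_simps)
      then have "of_int (s n * int r ^ Suc j) * (of_int (s 0) * a) \<in> \<int>" by (metis Ints_of_int)
      moreover have "of_int (int (q 0)) * (of_int (s 0) * a) \<in> \<int>" using a'(1) by simp
      moreover have "coprime (s n * int r ^ Suc j) (int (q 0))"
        using cop[of n 0] prime_imp_coprime[OF pr False] by simp
      ultimately have "of_int (s 0) * a \<in> \<int>" by (rule Ints_coprime_mult)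
      then show False using a' by simp
    qed
    ultimately show False by blast
  qed
qed

end

lemma (in moran) qspec_tail:
  assumes "qspec c q"
  shows "moran (\<lambda>n. \<beta> (Suc n)) (\<lambda>n. s (Suc n)) (\<lambda>n. q (Suc n))"
    "qspec (moran.c (\<lambda>n. \<beta> (Suc n)) (\<lambda>n. s (Suc n))) (\<lambda>n. q (Suc n))"
proof -
  show m: "moran (\<lambda>n. \<beta> (Suc n)) (\<lambda>n. s (Suc n)) (\<lambda>n. q (Suc n))"
    using \<beta> s q cop q_bounded by unfold_locales blast+
  interpret m: moran "\<lambda>n. \<beta> (Suc n)" "\<lambda>n. s (Suc n)" "\<lambda>n. q (Suc n)" by (rule m)
  have "Q (Suc n) = \<beta> 1 * m.Q n" for n
    by (induction n) (simp_all add: Q_Suc m.Q_Suc)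
  moreover have "\<beta> 1 \<noteq> 0" using \<beta>[of 1] by auto
  ultimately have "m.c = (\<lambda>n. of_int (\<beta> 1) * c (Suc n))" by (intro ext) simp
  then show "qspec m.c (\<lambda>n. q (Suc n))"
    using qspec_scale[OF qspec_shift[OF assms], of "of_int (\<beta> 1)"] \<open>\<beta> 1 \<noteq> 0\<close> by simp
qed

text \<open>Dropping level \<open>0\<close> repeatedly brings the level in question to index
  \<open>1\<close>, where \<open>qspec_dvd_first\<close> applies.\<close>

lemma qspec_imp_dvd:
  assumes "moran \<beta> s q" "qspec (moran.c \<beta> s) q"
  shows "int (q (Suc n)) dvd \<beta> (Suc n)"
  using assms
proof (induction n arbitrary: \<beta> s q)
  case 0
  then show ?case using moran.qspec_dvd_first by fastforce
next
  case (Suc n)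
  then show ?case using moran.qspec_tail[OF Suc.prems] by blast
qed


text \<open>Here the tail is a uniform distribution on an interval of length \<open>|t|\<close>, up to scaling. Coprimality forces the points
  selected with respect to level \<open>0\<close> into one coset of the integers, and then \<open>1 / t\<close> can be added to them.\<close>

lemma (in moran) not_qspec_exceptional:
  assumes sp: "qspec c q" and tail: "\<And>n. 1 \<le> n \<Longrightarrow> s n = t \<and> q n = p \<and> \<bar>\<beta> n\<bar> = int p"
    and t: "\<bar>t\<bar> \<noteq> 1" and cop0: "coprime t (s 0)"
  shows False
proof -
  have st: "s 1 = t" "q 1 = p" using tail[of 1] by auto
  have p2: "2 \<le> p" using q[of 1] st by simp
  have t0: "t \<noteq> 0" using s[of 1] st by simp
  have t2: "\<not> is_unit t" using t by simp
  have Qp: "\<bar>Q n\<bar> = int p ^ n" for n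
    by (induction n) (simp_all add: Q_Suc abs_mult tail mult.commute)
  obtain \<Lambda> where adm: "rational_adm c q" and \<Lambda>: "rational_spectrum c q \<Lambda>" "0 \<in> \<Lambda>"
    using sp by (auto simp: qspec_def)
  have zero0: "of_int (int (q 0) * s 0) * x \<in> \<int>" if "ker (q 0) (c 0 * x) = 0" for x
    using that q[of 0] by (simp add: ker_eq_0_iff mult.assoc)
  \<comment> \<open>Since \<open>|Q k|\<close> is a power of \<open>p\<close>, all zeros of the
    later levels lie in the lattice of multiples of \<open>1 / t\<close>.\<close>
  have zero_tail: "of_int t * x \<in> \<int>" if k: "1 \<le> k" and z: "ker (q k) (c k * x) = 0" for k x
  proof -
    have "real (q k) * (c k * x) \<in> \<int>" using z q[of k] by (simp add: ker_eq_0_iff)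
    then obtain i where "real (q k) * (c k * x) = of_int i" by (elim Ints_cases)
    then have i: "real p * of_int t * x = of_int (i * Q k)"
      using Q_nonzero[of k] tail[OF k] by (simp add: field_simps)
    have "int p dvd \<bar>Q k\<bar>" unfolding Qp using k by (simp add: dvd_power)
    then obtain y where "Q k = int p * y" by (auto elim: dvdE)
    then have "real p * (of_int t * x) = real p * of_int (i * y)" using i by (simp add: mult_ac)
    then have "of_int t * x = of_int (i * y)"
      by (rule mult_left_cancel[THEN iffD1, rotated]) (use p2 in simp)
    then show ?thesis by (metis Ints_of_int)
  qed
  have cop1: "coprime t (int (q 0) * s 0)" using cop[of 1 0] cop0 st by simp
  have both: "x \<in> \<int>" if "of_int t * x \<in> \<int>" "of_int (int (q 0) * s 0) * x \<in> \<int>" for x :: real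
    using that cop1 by (rule Ints_coprime_mult)
  obtain a where a: "a \<in> \<Lambda>" "ker (q 0) (c 0 * a) = 0"
    using rational_spectrum_zero_point[OF adm \<Lambda> q] by blast
  have ta: "of_int t * a \<notin> \<int>"
  proof
    assume "of_int t * a \<in> \<int>"
    then have "a \<in> \<int>" using zero0[OF a(2)] by (rule both)
    moreover have "c 0 * a \<notin> \<int>" using a(2) q[of 0] by (simp add: ker_eq_0_iff)
    ultimately show False by simp
  qed
  have diff: "of_int (int (q 0) * s 0) * (l - l') \<in> \<int> \<or> of_int t * (l - l') \<in> \<int>"
    if "l \<in> \<Lambda>" "l' \<in> \<Lambda>" for l l'
  proof (cases "l = l'")
    case False
    then have "ker_prod c q (l - l') = 0" using \<Lambda> that by (auto simp: rational_spectrum_def orth_def)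
    then obtain k where "ker (q k) (c k * (l - l')) = 0"
      using ker_prod_eq_0_iff[OF rational_admD(1)[OF adm]] by blast
    then show ?thesis using zero0 zero_tail[of k] by (cases "k = 0") auto
  qed simp
  \<comment> \<open>Otherwise \<open>l = l - 0\<close> lies in the lattice of \<open>1 / t\<close>
    only. The point \<open>a\<close> lies in the lattice of level \<open>0\<close> only, so
    \<open>l - a\<close> would lie in neither.\<close>
  have in0: "of_int (int (q 0) * s 0) * l \<in> \<int>" if l: "l \<in> \<Lambda>" for l
  proof (rule ccontr)
    assume n0: "of_int (int (q 0) * s 0) * l \<notin> \<int>"
    then have tl: "of_int t * l \<in> \<int>" using diff[OF l \<Lambda>(2)] by simp
    from diff[OF l a(1)] show False
    proof
      assume "of_int (int (q 0) * s 0) * (l - a) \<in> \<int>"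
      from Ints_add[OF this zero0[OF a(2)]] show False
        using n0 by (simp only: distrib_left[symmetric] diff_add_cancel)
    next
      assume "of_int t * (l - a) \<in> \<int>"
      from Ints_diff[OF tl this] show False
        using ta by (simp only: right_diff_distrib[symmetric] diff_diff_eq2 add_diff_cancel_left')
    qed
  qed
  let ?q = "q(0 := 1)"
  define u where "u = 1 / (c 0 * real (q 0))"
  have c0: "c 0 \<in> \<rat>" "c 0 \<noteq> 0" "1 \<le> q 0" using rational_admD(2-4)[OF adm, of 0] by auto
  have adm': "rational_adm c ?q"
    by (rule rational_adm_delete[OF adm])
  obtain \<rho> :: "real \<Rightarrow> real" where \<rho>: "\<And>x. \<exists>k::int. \<rho> x = x + of_int k * u"
      "\<And>x k::int. \<rho> (x + of_int k * u) = \<rho> x" "\<rho> 0 = of_int 0 * u"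
    by (rule coset_representative[of u 0]) (rule that)
  have factor: "ker_prod c q x = ker (q 0) (c 0 * x) * ker_prod c ?q x" for x
    by (rule ker_prod_delete[OF rational_admD(1)[OF adm]])
  define \<Lambda>s where "\<Lambda>s = {l \<in> \<Lambda>. \<exists>k::int. l - \<rho> l = of_int k * (real (q 0) * u)}"
  have sps: "rational_spectrum c ?q \<Lambda>s"
    unfolding \<Lambda>s_def by (rule rational_spectrum_select[OF adm adm' c0(3,1,2) u_def factor \<Lambda>(1) \<rho>(1,2)])
  have ints: "l - l' \<in> \<int>" if l: "l \<in> \<Lambda>s" "l' \<in> \<Lambda>s" for l l'
  proof (cases "l = l'")
    case False
    then have "ker_prod c ?q (l - l') = 0" using sps l by (auto simp: rational_spectrum_def orth_def)
    then obtain k where k: "ker (?q k) (c k * (l - l')) = 0"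
      using ker_prod_eq_0_iff[OF rational_admD(1)[OF adm']] by blast
    have "k \<noteq> 0" using k by (intro notI) simp
    then have "of_int t * (l - l') \<in> \<int>" using k by (intro zero_tail[of k]) auto
    moreover have "of_int (int (q 0) * s 0) * (l - l') \<in> \<int>"
      using l in0[of l] in0[of l'] by (simp only: right_diff_distrib) (auto simp: \<Lambda>s_def)
    ultimately show ?thesis by (rule both)
  qed simp
  obtain l0 where l0: "l0 \<in> \<Lambda>s" using rational_spectrum_nonempty[OF sps] by blast
  \<comment> \<open>Selected points differ by integers, so \<open>z\<close> differs from each of
    them by \<open>w / t\<close> with \<open>w\<close> congruent to \<open>1\<close> modulo
    \<open>t\<close>; as \<open>t\<close> is not a unit, \<open>w\<close> is not
    \<open>0\<close>.\<close>
  define z where "z = l0 + 1 / of_int t"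
  have zero: "ker_prod c ?q (z - l) = 0" if l: "l \<in> \<Lambda>s" for l
  proof -
    obtain N where N: "l0 - l = of_int N" using ints[OF l0 l] by (elim Ints_cases)
    define w where "w = 1 + t * N"
    have w0: "w \<noteq> 0"
    proof
      assume "w = 0"
      then have "t * (- N) = 1" by (simp add: w_def)
      then have "t dvd 1" by (metis dvd_triv_left)
      then show False using t2 by simp
    qed
    have zl: "z - l = of_int w / of_int t" using N t0 by (simp add: z_def w_def field_simps)
    have "\<not> is_unit (int p)" using p2 by simp
    from multiplicity_split[OF w0 this]
    obtain y where y: "w = y * int p ^ multiplicity (int p) w" "\<not> int p dvd y" by blast
    \<comment> \<open>The power of \<open>p\<close> in \<open>w\<close> determines the level at
      which \<open>w / t\<close> is a zero: \<open>p * c k * (w / t)\<close> is \<open>y\<close> up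
      to sign, and \<open>p\<close> does not divide \<open>y\<close>.\<close>
    define k where "k = Suc (multiplicity (int p) w)"
    have k: "s k = t" "q k = p" using tail[of k] by (auto simp: k_def)
    have "Q k = int p ^ k \<or> Q k = - (int p ^ k)" using Qp[of k] by linarith
    then obtain e :: int where e: "Q k = e * int p ^ k" "e = 1 \<or> e = -1" by (metis mult_1 mult_minus1)
    have pp: "int p ^ k = int p * int p ^ multiplicity (int p) w" by (simp add: k_def)
    have "real p * (c k * (z - l)) = of_int (e * y)"
      using e(2) p2 t0 arg_cong[OF y(1), of real_of_int] unfolding zl k e(1) pp
      by (auto simp: field_simps)
    then have pc: "real p * (c k * (z - l)) = of_int (e * y)" .
    have "ker p (c k * (z - l)) = 0"
    proof -
      have "c k * (z - l) \<notin> \<int>"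
      proof
        assume "c k * (z - l) \<in> \<int>"
        then obtain i where "c k * (z - l) = of_int i" by (elim Ints_cases)
        then have "of_int (int p * i) = (of_int (e * y) :: real)" using pc by simp
        then have "int p * i = e * y" by (simp only: of_int_eq_iff)
        then have "int p dvd e * y" by (metis dvd_triv_left)
        then show False using y(2) e(2) by auto
      qed
      moreover have "real p * (c k * (z - l)) \<in> \<int>" unfolding pc by (rule Ints_of_int)
      ultimately show ?thesis using p2 by (subst ker_eq_0_iff) auto
    qed
    then have "ker (?q k) (c k * (z - l)) = 0" using k by (simp add: k_def)
    then show ?thesis using ker_prod_eq_0_iff[OF rational_admD(1)[OF adm']] by blast
  qed
  have "z \<notin> \<Lambda>s"
  proof
    assume "z \<in> \<Lambda>s"
    from zero[OF this] show False using rational_admD(1)[OF adm'] by simp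
  qed
  moreover have "orth (ker_prod c ?q) (insert z \<Lambda>s)"
  proof -
    have zero': "ker_prod c ?q (l - z) = 0" if "l \<in> \<Lambda>s" for l
      using zero[OF that] norm_ker_prod_minus[OF rational_admD(1)[OF adm'], of "z - l"] by simp
    show ?thesis using sps zero zero' unfolding rational_spectrum_def orth_def by blast
  qed
  moreover obtain y :: real where y: "y \<notin> \<rat>" using ex_irrational by blast
  moreover have "z \<in> \<rat>" using l0 sps by (auto simp: z_def rational_spectrum_def)
  then have "y - z \<notin> \<rat>" using y Rats_add[of "y - z" z] by auto
  then have "ker_prod c ?q (y - z) \<noteq> 0"
    using ker_prod_zero_rational[OF adm'] by blast
  ultimately show False
    using complete_at_no_extra_point[of "ker_prod c ?q" \<Lambda>s y z] sps bessel[OF rational_admD(1)[OF adm']]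
    by (auto simp: rational_spectrum_def)
qed

section \<open>Construction of spectra\<close>

lemma norm_expo_minus_1_ge:
  assumes "0 \<le> a" "a \<le> \<bar>z\<bar>" "\<bar>z\<bar> \<le> 1/2"
  shows "1 - cos (2 * pi * a) \<le> cmod (expo 1 z - 1)"
proof -
  have "2 * pi * \<bar>z\<bar> \<le> 2 * pi * (1/2)" using assms by (intro mult_left_mono) auto
  then have "cos (2 * pi * \<bar>z\<bar>) \<le> cos (2 * pi * a)"
    using assms by (intro cos_monotone_0_pi_le) auto
  then have "1 - cos (2 * pi * a) \<le> \<bar>Re (expo 1 z - 1)\<bar>"
    by (cases "0 \<le> z") (auto simp: expo_cis)
  then show ?thesis using abs_Re_le_cmod[of "expo 1 z - 1"] by linarith
qed

text \<open>Let \<open>j\<close> be the integer nearest to \<open>q * x\<close>. If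
  \<open>q * x\<close> is at least \<open>q * \<eta>\<close> away from \<open>j\<close>, the
  geometric sum gives the bound. Otherwise \<open>q\<close> divides \<open>j\<close>, and
  \<open>x\<close> is so close to an integer that the Lipschitz bound keeps the kernel within
  \<open>1/2\<close> of \<open>1\<close>; the size of \<open>\<eta>\<close> is chosen for
  this.\<close>

lemma norm_ker_ge:
  assumes q: "1 \<le> q" "q \<le> P" and \<eta>: "0 < \<eta>" "\<eta> \<le> 1 / (4 * pi * real P)"
    and far: "\<And>j::int. \<not> int q dvd j \<Longrightarrow> real q * \<eta> \<le> \<bar>real q * x - of_int j\<bar>"
  shows "min (1/2) ((1 - cos (2 * pi * \<eta>)) / (2 * real P)) \<le> cmod (ker q x)"
proof -
  define j where "j = round (real q * x)"
  define z where "z = real q * x - of_int j"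
  have zh: "\<bar>z\<bar> \<le> 1/2" using of_int_round_abs_le[of "real q * x"] by (simp add: z_def j_def abs_minus_commute)
  have P: "0 < real P" using q by simp
  have qP: "real q * \<eta> \<le> 1 / (4 * pi)"
  proof -
    have "real q * \<eta> \<le> real P * (1 / (4 * pi * real P))" using q \<eta> by (intro mult_mono) auto
    then show ?thesis using P by simp
  qed
  show ?thesis
  proof (cases "real q * \<eta> \<le> \<bar>z\<bar>")
    case True
    have "1 * \<eta> \<le> real q * \<eta>" using q \<eta> by (intro mult_right_mono) auto
    then have "\<eta> \<le> \<bar>z\<bar>" using True by simp
    then have "1 - cos (2 * pi * \<eta>) \<le> cmod (expo 1 z - 1)"
      using \<eta> zh by (intro norm_expo_minus_1_ge) auto
    also have "expo 1 (real q * x) = expo 1 z"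
    proof -
      have "expo 1 (of_int j) = 1" by (simp add: expo_eq_1_iff)
      then show ?thesis using expo_add[of 1 z "of_int j"] by (simp add: z_def)
    qed
    then have "cmod (expo 1 z - 1) = real q * cmod (ker q x) * cmod (expo 1 x - 1)"
      using ker_mult_diff[of q x] by (metis norm_mult norm_of_nat)
    also have "\<dots> \<le> real P * cmod (ker q x) * 2"
      using q norm_triangle_ineq4[of "expo 1 x" 1] by (intro mult_mono mult_right_mono) auto
    finally have "(1 - cos (2 * pi * \<eta>)) / (2 * real P) \<le> cmod (ker q x)"
      using P by (simp add: divide_le_eq mult_ac)
    then show ?thesis by simp
  next
    case False
    then have "int q dvd j" using far[of j] by (auto simp: z_def)
    then obtain i where i: "j = int q * i" ..
    have "z = real q * (x - of_int i)" by (simp add: z_def i right_diff_distrib)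
    then have "real q * \<bar>x - of_int i\<bar> \<le> real q * \<eta>" using False by (simp add: abs_mult)
    then have "2 * pi * (real q * \<bar>x - of_int i\<bar>) \<le> 2 * pi * (1 / (4 * pi))"
      using qP by (intro mult_left_mono) auto
    then have "cmod (ker q (x - of_int i) - ker q 0) \<le> 1/2"
      using norm_ker_diff[of q "x - of_int i" 0] by (simp add: mult_ac)
    moreover have "ker q (x - of_int i) = ker q x"
      using ker_periodic[of "of_int (- i)" q x] by simp
    moreover have "1 - cmod (ker q x) \<le> cmod (1 - ker q x)"
      using norm_triangle_ineq2[of 1 "ker q x"] by simp
    ultimately show ?thesis using q by (simp add: norm_minus_commute)
  qed
qed

text \<open>The assumption \<open>EP\<close> says that, for infinitely many \<open>n\<close>, every coset of the integers in the multiples of \<open>1 / S\<close>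
  contains a bounded point \<open>w / S\<close> at which no factor of the tail from level \<open>n\<close> on vanishes.\<close>

locale hadamard = moran +
  fixes S b R :: int
  assumes dvd: "int (q n) dvd \<beta> n" and S: "0 < S" "s n dvd S" and b: "\<bar>\<beta> n\<bar> \<le> b"
    and EP: "\<And>N. \<exists>n\<ge>N. \<forall>z. \<exists>w. S dvd w - z \<and> \<bar>w\<bar> \<le> R \<and>
        (\<forall>k j. w * int (q (n + k)) * s (n + k) = S * (\<Prod>i\<le>k. \<beta> (n + i)) * j \<longrightarrow> int (q (n + k)) dvd j)"
begin

definition B :: "nat \<Rightarrow> nat \<Rightarrow> int" where "B n k = (\<Prod>i<k. \<beta> (n + i))"

text \<open>The coefficient of level \<open>n + k\<close> after the tail from level \<open>n\<close>
  on is rescaled by \<open>B 0 n\<close>. In this scale all estimates are uniform in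
  \<open>n\<close>.\<close>

definition d :: "nat \<Rightarrow> nat \<Rightarrow> real" where "d n k = of_int (s (n + k)) / of_int (B n (Suc k))"

abbreviation T :: "nat \<Rightarrow> real \<Rightarrow> complex" where "T n \<equiv> ker_prod (d n) (\<lambda>k. q (n + k))"

abbreviation \<Phi> :: "real \<Rightarrow> complex" where "\<Phi> \<equiv> ker_prod (d 0) q"

definition \<mu> :: "nat \<Rightarrow> real \<Rightarrow> complex" where "\<mu> n x = (\<Prod>k<n. ker (q k) (d 0 k * x))"

lemma B_0 [simp]: "B n 0 = 1" and B_Suc: "B n (Suc k) = B n k * \<beta> (n + k)"
  by (simp_all add: B_def)

lemma B_nonzero: "B n k \<noteq> 0"
  using \<beta> by (auto simp: B_def) (metis abs_0 not_numeral_le_zero)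

lemma B_add: "B n (k + l) = B n k * B (n + k) l"
  by (induction l) (simp_all add: B_Suc mult.assoc add.assoc)

lemma B_ge: "2 ^ k \<le> \<bar>B n k\<bar>"
proof (induction k)
  case (Suc k)
  have "2 ^ k * 2 \<le> \<bar>B n k\<bar> * \<bar>\<beta> (n + k)\<bar>" using Suc \<beta> by (intro mult_mono) auto
  then show ?case by (simp add: B_Suc abs_mult mult.commute)
qed simp

lemma B_le: "\<bar>B n k\<bar> \<le> b ^ k"
proof (induction k)
  case (Suc k)
  have "\<bar>B n k\<bar> * \<bar>\<beta> (n + k)\<bar> \<le> b ^ k * b"
    using Suc b by (intro mult_mono) (auto intro: order_trans[OF abs_ge_zero])
  then show ?case by (simp add: B_Suc abs_mult mult.commute)
qed simp

lemma abs_s: "1 \<le> \<bar>s n\<bar>" "\<bar>s n\<bar> \<le> S"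
  using s[of n] S dvd_imp_le_int[of S "s n"] by auto

lemma abs_d: "\<bar>d n k\<bar> \<le> of_int S * (1/2) ^ Suc k"
proof -
  have "\<bar>d n k\<bar> = of_int \<bar>s (n + k)\<bar> / of_int \<bar>B n (Suc k)\<bar>" by (simp add: d_def)
  also have "\<dots> \<le> of_int S / of_int (2 ^ Suc k)"
    using abs_s[of "n + k"] B_ge[of "Suc k" n]
    by (intro frac_le) (simp_all only: of_int_le_iff of_int_0_le_iff of_int_0_less_iff, auto)
  finally show ?thesis by (simp add: power_divide)
qed

definition P :: nat where "P = (SOME P. \<forall>n. q n \<le> P)"

lemma q_le_P: "q n \<le> P"
  unfolding P_def using someI_ex[OF q_bounded] by blast

lemma qd_le: "real (q (n + k)) * \<bar>d n k\<bar> \<le> real P * of_int S * (1/2) ^ Suc k"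
proof -
  have "real (q (n + k)) * \<bar>d n k\<bar> \<le> real P * (of_int S * (1/2) ^ Suc k)"
    using q_le_P[of "n + k"] abs_d[of n k] by (intro mult_mono) auto
  then show ?thesis by (simp add: mult.assoc)
qed

lemma summable_geometric_half: "summable (\<lambda>k. C * (1/2 :: real) ^ Suc k)" "(\<Sum>k. C * (1/2 :: real) ^ Suc k) = C"
  using sums_mult[OF power_half_series, of C] by (auto simp: sums_iff)

lemma admissible_d: "admissible (d n) (\<lambda>k. q (n + k))"
  unfolding admissible_def
proof (intro conjI allI)
  show "1 \<le> q (n + k)" for k using q[of "n + k"] by simp
  show "summable (\<lambda>k. real (q (n + k)) * \<bar>d n k\<bar>)"
    by (rule summable_comparison_test'[OF summable_geometric_half(1)[of "real P * of_int S"]])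
       (use qd_le in auto)
qed

lemma suminf_d_le: "(\<Sum>k. real (q (n + k)) * \<bar>d n k\<bar>) \<le> real P * of_int S"
  using suminf_le[OF qd_le admissibleD(2)[OF admissible_d] summable_geometric_half(1)]
  by (simp only: summable_geometric_half(2))

definition L :: real where "L = 2 * pi * (real P * of_int S)"

lemma L_pos: "0 < L"
  using q[of 0] q_le_P[of 0] S by (auto simp: L_def)

lemma T_lipschitz: "cmod (T n x - T n y) \<le> L * \<bar>x - y\<bar>"
proof -
  have "2 * pi * (\<Sum>k. real (q (n + k)) * \<bar>d n k\<bar>) * \<bar>x - y\<bar> \<le> 2 * pi * (real P * of_int S) * \<bar>x - y\<bar>"
    by (intro mult_right_mono mult_left_mono suminf_d_le) auto
  then show ?thesis
    unfolding L_def by (rule order_trans[OF norm_ker_prod_diff[OF admissible_d]])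
qed

section \<open>Lower bounds for the tails\<close>

lemma T_split: "T n x = (\<Prod>k<N. ker (q (n + k)) (d n k * x)) * T (n + N) (x / of_int (B n N))"
proof -
  have eq: "d n (k + N) = 1 / of_int (B n N) * d (n + N) k" for k
  proof -
    have "B n (Suc (k + N)) = B n N * B (n + N) (Suc k)"
      using B_add[of n N "Suc k"] by (simp add: add.commute)
    then show ?thesis using B_nonzero by (simp add: d_def add_ac)
  qed
  have "ker_prod (\<lambda>k. d n (k + N)) (\<lambda>k. q (n + (k + N))) x = T (n + N) (x / of_int (B n N))"
    unfolding eq ker_prod_scale by (simp add: add_ac)
  then show ?thesis using ker_prod_split[OF admissible_d, of n x N] by simp
qed

lemma \<Phi>_split: "\<Phi> x = \<mu> n x * T n (x / of_int (B 0 n))"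
  using T_split[of 0 x n] by (simp add: \<mu>_def)

lemma T_near_0: "\<bar>x\<bar> \<le> 1 / (2 * L) \<Longrightarrow> 1/2 \<le> cmod (T n x)"
proof -
  assume "\<bar>x\<bar> \<le> 1 / (2 * L)"
  then have "L * \<bar>x\<bar> \<le> 1/2" using L_pos by (simp add: field_simps)
  then have "cmod (T n x - T n 0) \<le> 1/2" using T_lipschitz[of n x 0] by simp
  moreover have "1 - cmod (T n x) \<le> cmod (1 - T n x)" using norm_triangle_ineq2[of 1 "T n x"] by simp
  ultimately show ?thesis using admissible_d[of n] by (simp add: norm_minus_commute)
qed

text \<open>At \<open>x = w / S\<close> the equation reads \<open>q (n + k) * d n k * x = j\<close>,
  with denominators cleared. That only multiples of \<open>q (n + k)\<close> occur as
  \<open>j\<close> means that no kernel of the tail vanishes at \<open>x\<close>.\<close>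

definition nonzero_at :: "nat \<Rightarrow> int \<Rightarrow> bool" where
  "nonzero_at n w \<longleftrightarrow> (\<forall>k j. w * int (q (n + k)) * s (n + k) = S * B n (Suc k) * j \<longrightarrow> int (q (n + k)) dvd j)"

text \<open>All zeros of the tails lie in the lattice of multiples of \<open>1 / S\<close>. Hence a point whose nearest lattice point is
  not a zero keeps a distance of at least \<open>1 / (2 * S)\<close> from the zeros.\<close>

lemma T_ge:
  shows "\<exists>\<epsilon>>0. \<forall>n w x. nonzero_at n w \<longrightarrow> \<bar>x - of_int w / of_int S\<bar> \<le> 1 / (2 * of_int S) \<longrightarrow> \<bar>x\<bar> \<le> K \<longrightarrow>
      \<epsilon> \<le> cmod (T n x)"
proof -
  \<comment> \<open>After \<open>N\<close> levels the argument has shrunk to the range of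
    \<open>T_near_0\<close>, so only \<open>N\<close> kernels need a lower bound.\<close>
  obtain N where N: "2 * L * (\<bar>K\<bar> + 1) < 2 ^ N" using real_arch_pow[of 2] by auto
  have b1: "1 \<le> b" using b[of 0] \<beta>[of 0] by linarith
  have P1: "1 \<le> P" using q[of 0] q_le_P[of 0] by simp
  \<comment> \<open>The first bound is required by \<open>norm_ker_ge\<close>. The second is the
    distance \<open>1 / (2 * S)\<close> from the zeros, times the lower bound
    \<open>1 / b ^ N\<close> for \<open>|d n k|\<close> with \<open>k < N\<close>.\<close>
  define \<eta> where "\<eta> = min (1 / (4 * pi * real P)) (1 / (2 * of_int S * of_int b ^ N))"
  have \<eta>: "0 < \<eta>" "\<eta> \<le> 1 / (4 * pi * real P)" "\<eta> \<le> 1 / (2 * of_int S * of_int b ^ N)"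
    using P1 S b1 by (auto simp: \<eta>_def)
  define \<epsilon> where "\<epsilon> = min (1/2) ((1 - cos (2 * pi * \<eta>)) / (2 * real P))"
  have "2 * pi * \<eta> \<le> 2 * pi * (1 / (4 * pi * real P))" using \<eta> by (intro mult_left_mono) auto
  also have "\<dots> = 1 / (2 * real P)" by simp
  also have "\<dots> \<le> 1" using P1 by simp
  finally have "2 * pi * \<eta> \<le> 1" .
  then have "2 * pi * \<eta> \<le> pi" using pi_gt3 by linarith
  then have "cos (2 * pi * \<eta>) < cos 0"
    using \<eta> by (intro cos_monotone_0_pi) auto
  then have \<epsilon>: "0 < \<epsilon>" using P1 by (simp add: \<epsilon>_def)
  have "\<epsilon> ^ N * (1/2) \<le> cmod (T n x)"
    if w: "nonzero_at n w" and x: "\<bar>x - of_int w / of_int S\<bar> \<le> 1 / (2 * of_int S)" "\<bar>x\<bar> \<le> K" for n w x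
  proof -
    have "\<epsilon> \<le> cmod (ker (q (n + k)) (d n k * x))" if k: "k < N" for k
      unfolding \<epsilon>_def
    proof (rule norm_ker_ge[OF _ q_le_P \<eta>(1,2)])
      show "1 \<le> q (n + k)" using q[of "n + k"] by simp
      fix j :: int assume j: "\<not> int (q (n + k)) dvd j"
      obtain s' where s': "S = s (n + k) * s'" using S(2)[of "n + k"] by (elim dvdE)
      have "int (q (n + k)) dvd B n (Suc k)" using dvd[of "n + k"] by (simp add: B_Suc)
      then obtain B' where B': "B n (Suc k) = int (q (n + k)) * B'" by (elim dvdE)
      \<comment> \<open>At the lattice point \<open>z / S\<close> the expression
        \<open>q (n + k) * d n k * x\<close> has the value \<open>j\<close>, which \<open>w\<close>
        avoids; so \<open>w\<close> and \<open>z\<close> are distinct integers.\<close>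
      define z where "z = B' * j * s'"
      have "w \<noteq> z"
      proof
        assume "w = z"
        then have "w * int (q (n + k)) * s (n + k) = S * B n (Suc k) * j"
          by (simp add: z_def s' B' mult_ac)
        then show False using w j unfolding nonzero_at_def by blast
      qed
      then have "1 \<le> \<bar>w - z\<bar>" by linarith
      then have "1 / of_int S \<le> real_of_int \<bar>w - z\<bar> / of_int S"
        using S(1) by (intro divide_right_mono) linarith+
      also have "\<dots> = \<bar>of_int w / of_int S - of_int z / of_int S\<bar>"
        using S by (simp add: abs_div_pos diff_divide_distrib)
      also have "\<dots> \<le> \<bar>x - of_int z / of_int S\<bar> + \<bar>x - of_int w / of_int S\<bar>" by linarith
      finally have "1 / (2 * of_int S) \<le> \<bar>x - of_int z / of_int S\<bar>" using x(1) by (simp add: field_simps)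
      have s0: "s (n + k) \<noteq> 0" "S \<noteq> 0" "B' \<noteq> 0" using s[of "n + k"] S B' B_nonzero[of n "Suc k"] by auto
      have "real (q (n + k)) * (d n k * x) - of_int j = real (q (n + k)) * d n k * (x - of_int z / of_int S)"
      proof -
        have "real (q (n + k)) * d n k * (of_int z / of_int S) = of_int j"
          using s0 q[of "n + k"] s' by (auto simp: d_def z_def B')
        then show ?thesis by (simp add: right_diff_distrib mult.assoc)
      qed
      then have "\<bar>real (q (n + k)) * (d n k * x) - of_int j\<bar> =
          real (q (n + k)) * (\<bar>d n k\<bar> * \<bar>x - of_int z / of_int S\<bar>)" by (simp add: abs_mult mult.assoc)
      also have "\<dots> \<ge> real (q (n + k)) * (1 / of_int b ^ N * (1 / (2 * of_int S)))"
      proof (intro mult_left_mono mult_mono)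
        have "\<bar>B n (Suc k)\<bar> \<le> b ^ N"
          using B_le[of n "Suc k"] power_increasing[of "Suc k" N b] k b1 by simp
        then have "real_of_int \<bar>B n (Suc k)\<bar> \<le> of_int b ^ N" by (metis of_int_le_iff of_int_power)
        moreover have "1 \<le> real_of_int \<bar>s (n + k)\<bar>" using abs_s[of "n + k"] by simp
        ultimately have "1 / of_int b ^ N \<le> of_int \<bar>s (n + k)\<bar> / real_of_int \<bar>B n (Suc k)\<bar>"
          using B_nonzero by (intro frac_le) auto
        then show "1 / of_int b ^ N \<le> \<bar>d n k\<bar>" by (simp add: d_def)
        show "1 / (2 * of_int S) \<le> \<bar>x - of_int z / of_int S\<bar>" by fact
      qed (use S in auto)
      finally have "real (q (n + k)) * (1 / of_int b ^ N * (1 / (2 * of_int S)))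
          \<le> \<bar>real (q (n + k)) * (d n k * x) - of_int j\<bar>" .
      moreover have "real (q (n + k)) * \<eta> \<le> real (q (n + k)) * (1 / of_int b ^ N * (1 / (2 * of_int S)))"
        using \<eta>(3) by (intro mult_left_mono) (auto simp: mult_ac)
      ultimately show "real (q (n + k)) * \<eta> \<le> \<bar>real (q (n + k)) * (d n k * x) - of_int j\<bar>" by linarith
    qed
    then have "(\<Prod>k<N. \<epsilon>) \<le> (\<Prod>k<N. cmod (ker (q (n + k)) (d n k * x)))"
      using \<epsilon> by (intro prod_mono) auto
    moreover have "1/2 \<le> cmod (T (n + N) (x / of_int (B n N)))"
    proof (rule T_near_0)
      have "(2::real) ^ N \<le> of_int \<bar>B n N\<bar>" using B_ge[of N n] by (metis of_int_le_iff of_int_numeral of_int_power)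
      then have "2 * L * (\<bar>K\<bar> + 1) \<le> of_int \<bar>B n N\<bar>" using N by linarith
      moreover have "2 * L * \<bar>x\<bar> \<le> 2 * L * (\<bar>K\<bar> + 1)" using x(2) L_pos by (intro mult_left_mono) auto
      ultimately have "2 * L * \<bar>x\<bar> \<le> of_int \<bar>B n N\<bar>" by linarith
      then show "\<bar>x / of_int (B n N)\<bar> \<le> 1 / (2 * L)"
        using L_pos B_nonzero[of n N] by (simp add: abs_divide divide_simps mult_ac)
    qed
    ultimately have "(\<Prod>k<N. \<epsilon>) * (1/2) \<le> (\<Prod>k<N. cmod (ker (q (n + k)) (d n k * x))) * cmod (T (n + N) (x / of_int (B n N)))"
      using \<epsilon> by (intro mult_mono) (auto intro!: prod_nonneg)
    then show ?thesis by (simp add: T_split[of n x N] norm_mult prod_norm)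
  qed
  then show ?thesis using \<epsilon> by (intro exI[of _ "\<epsilon> ^ N * (1/2)"]) auto
qed

lemma EP': "\<exists>n\<ge>N. \<forall>z. \<exists>w. S dvd w - z \<and> \<bar>w\<bar> \<le> R \<and> nonzero_at n w"
  using EP[of N] by (simp add: nonzero_at_def B_def lessThan_Suc_atMost)

text \<open>The integer nearest to \<open>S * x\<close> is moved by \<open>EP'\<close>, within its
  class modulo \<open>S\<close>, to a bounded \<open>w\<close> at which the tail does not vanish;
  \<open>\<kappa>\<close> records this move. \<open>T_ge\<close> bounds the tail near
  \<open>w / S\<close>, and the Lipschitz bound extends the estimate to a radius independent of the
  level.\<close>

lemma equi_positive:
  obtains \<epsilon> \<delta> where "0 < \<epsilon>" "\<epsilon> \<le> 1/2" "0 < \<delta>" "\<delta> \<le> 1 / (4 * L)"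
    "\<And>N. \<exists>n\<ge>N. \<forall>x. \<exists>\<kappa>::int. \<forall>y. \<bar>y\<bar> < \<delta> \<longrightarrow> \<epsilon> \<le> cmod (T n (y + x + of_int \<kappa>))"
proof -
  obtain \<epsilon> where \<epsilon>: "0 < \<epsilon>" "\<And>n w x. nonzero_at n w \<Longrightarrow> \<bar>x - of_int w / of_int S\<bar> \<le> 1 / (2 * of_int S) \<Longrightarrow>
      \<bar>x\<bar> \<le> of_int R + 1 \<Longrightarrow> \<epsilon> \<le> cmod (T n x)"
    using T_ge[of "of_int R + 1"] by blast
  define \<epsilon>' where "\<epsilon>' = min (1/2) (\<epsilon> / 2)"
  \<comment> \<open>The first bound keeps \<open>2 * \<delta>\<close> within the range of
    \<open>T_near_0\<close>; the second makes the Lipschitz loss at most half of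
    \<open>\<epsilon>\<close>.\<close>
  define \<delta> where "\<delta> = min (1 / (4 * L)) (\<epsilon> / (2 * L))"
  show thesis
  proof (rule that[of \<epsilon>' \<delta>])
    show "0 < \<epsilon>'" "\<epsilon>' \<le> 1/2" "0 < \<delta>" "\<delta> \<le> 1 / (4 * L)" using \<epsilon>(1) L_pos by (auto simp: \<epsilon>'_def \<delta>_def)
    fix N
    obtain n where n: "N \<le> n" "\<And>z. \<exists>w. S dvd w - z \<and> \<bar>w\<bar> \<le> R \<and> nonzero_at n w" using EP' by blast
    have "\<exists>\<kappa>::int. \<forall>y. \<bar>y\<bar> < \<delta> \<longrightarrow> \<epsilon>' \<le> cmod (T n (y + x + of_int \<kappa>))" for x
    proof -
      define z where "z = round (of_int S * x)"
      obtain w where w: "S dvd w - z" "\<bar>w\<bar> \<le> R" "nonzero_at n w" using n(2) by blast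
      obtain \<kappa> where \<kappa>: "w - z = S * \<kappa>" using w(1) ..
      have S0: "0 < real_of_int S" using S by simp
      have "x + of_int \<kappa> - of_int w / of_int S = (of_int S * x - of_int z) / of_int S"
      proof -
        have "real_of_int w = of_int z + of_int S * of_int \<kappa>" using \<kappa> by (metis add.commute diff_add_cancel of_int_add of_int_mult)
        then show ?thesis using S0 by (simp add: field_simps)
      qed
      moreover have "\<bar>of_int S * x - of_int z\<bar> \<le> 1/2"
        using of_int_round_abs_le[of "of_int S * x"] by (simp add: z_def abs_minus_commute)
      ultimately have near: "\<bar>x + of_int \<kappa> - of_int w / of_int S\<bar> \<le> 1 / (2 * of_int S)"
        using S0 by (simp add: abs_divide divide_simps)
      moreover have "\<bar>x + of_int \<kappa>\<bar> \<le> of_int R + 1"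
      proof -
        have S1: "1 \<le> real_of_int S" using S by simp
        then have "1 / (2 * of_int S) \<le> (1::real)" by simp
        moreover have "\<bar>of_int w / of_int S\<bar> \<le> (\<bar>of_int w\<bar> :: real)"
          using S1 mult_left_mono[OF S1, of "\<bar>real_of_int w\<bar>"] by (simp add: abs_divide divide_le_eq)
        moreover have "\<bar>real_of_int w\<bar> \<le> of_int R" using w(2) by (metis of_int_abs of_int_le_iff)
        ultimately show ?thesis using near by linarith
      qed
      ultimately have ge: "\<epsilon> \<le> cmod (T n (x + of_int \<kappa>))" using \<epsilon>(2) w(3) by blast
      have "\<epsilon>' \<le> cmod (T n (y + x + of_int \<kappa>))" if y: "\<bar>y\<bar> < \<delta>" for y
      proof -
        have "L * \<bar>y\<bar> \<le> \<epsilon> / 2" using y L_pos by (simp add: \<delta>_def field_simps)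
        moreover have "cmod (T n (x + of_int \<kappa>) - T n (y + x + of_int \<kappa>)) \<le> L * \<bar>y\<bar>"
          using T_lipschitz[of n "x + of_int \<kappa>" "y + x + of_int \<kappa>"] by simp
        moreover have "cmod (T n (x + of_int \<kappa>)) - cmod (T n (y + x + of_int \<kappa>))
            \<le> cmod (T n (x + of_int \<kappa>) - T n (y + x + of_int \<kappa>))" by (rule norm_triangle_ineq2)
        ultimately show ?thesis using ge by (simp add: \<epsilon>'_def)
      qed
      then show ?thesis by blast
    qed
    then show "\<exists>n\<ge>N. \<forall>x. \<exists>\<kappa>::int. \<forall>y. \<bar>y\<bar> < \<delta> \<longrightarrow> \<epsilon>' \<le> cmod (T n (y + x + of_int \<kappa>))"
      using n(1) by blast
  qed
qed

text \<open>A spectrum of the convolution of the first \<open>n\<close> levels. Orthogonality is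
  implied: for \<open>x\<close> in \<open>A\<close> the term \<open>a = x\<close> alone is
  \<open>1\<close>, so all others vanish.\<close>

definition level_spectrum :: "nat \<Rightarrow> real set \<Rightarrow> bool" where
  "level_spectrum n A \<longleftrightarrow> finite A \<and> (\<forall>x. (\<Sum>a\<in>A. (cmod (\<mu> n (x - a)))\<^sup>2) = 1)"

lemma \<mu>_0 [simp]: "\<mu> n 0 = 1"
  using q ker_0 by (simp add: \<mu>_def) (metis (no_types, lifting) ker_0 one_le_numeral order_trans prod.neutral q)

text \<open>For \<open>k < n\<close> the number \<open>d 0 k * B 0 n\<close> is an integer. This is
  the freedom of translation used to control the tails.\<close>

lemma \<mu>_periodic: "\<mu> n (x + of_int (B 0 n) * of_int \<kappa>) = \<mu> n x"
  unfolding \<mu>_def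
proof (intro prod.cong refl)
  fix k assume "k \<in> {..<n}"
  then have "B 0 n = B 0 (Suc k) * B (Suc k) (n - Suc k)"
    using B_add[of 0 "Suc k" "n - Suc k"] by simp
  then have "d 0 k * (of_int (B 0 n) * of_int \<kappa>) = of_int (s k * B (Suc k) (n - Suc k) * \<kappa>)"
    using B_nonzero[of 0 "Suc k"] by (simp add: d_def)
  then show "ker (q k) (d 0 k * (x + of_int (B 0 n) * of_int \<kappa>)) = ker (q k) (d 0 k * x)"
    using ker_periodic[OF Ints_of_int, of "q k" "d 0 k * x"] by (simp only: distrib_left)
qed

text \<open>A repeated point would contribute the value \<open>2\<close> to the sum.\<close>

lemma level_spectrum_image:
  assumes I: "finite I" and sum: "\<And>x. (\<Sum>i\<in>I. (cmod (\<mu> n (x - f i)))\<^sup>2) = 1"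
  shows "level_spectrum n (f ` I)" "inj_on f I"
proof -
  show inj: "inj_on f I"
  proof (rule inj_onI, rule ccontr)
    fix i j assume ij: "i \<in> I" "j \<in> I" "f i = f j" "i \<noteq> j"
    have "(\<Sum>k\<in>{i, j}. (cmod (\<mu> n (f i - f k)))\<^sup>2) \<le> (\<Sum>k\<in>I. (cmod (\<mu> n (f i - f k)))\<^sup>2)"
      using ij I by (intro sum_mono2) auto
    then show False using ij sum[of "f i"] by simp
  qed
  show "level_spectrum n (f ` I)"
    using I sum by (simp add: level_spectrum_def sum.reindex[OF inj])
qed

text \<open>Write \<open>\<beta> n = q n * h\<close>. The translates by \<open>B 0 n * h * j\<close>
  are invisible to the first \<open>n\<close> kernels and shift the argument of the next one by
  \<open>s n * j / q n\<close>, so the new sum factors into the old one and that of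
  \<open>sum_ker_shift\<close>.\<close>

lemma level_spectrum_step:
  assumes A: "level_spectrum n A"
  shows "\<exists>A'. A \<subseteq> A' \<and> level_spectrum (Suc n) A'"
proof -
  obtain h where h: "\<beta> n = int (q n) * h" using dvd[of n] by (elim dvdE)
  have h': "real_of_int (\<beta> n) = real (q n) * of_int h" using h by simp
  have qn: "1 \<le> q n" "real (q n) \<noteq> 0" using q[of n] by auto
  define f where "f = (\<lambda>(a, j). a + of_int (B 0 n) * of_int (h * int j) :: real)"
  let ?I = "A \<times> {..<q n}"
  have fin: "finite A" using A by (simp add: level_spectrum_def)
  have "(\<Sum>i\<in>?I. (cmod (\<mu> (Suc n) (x - f i)))\<^sup>2) = 1" for x
  proof -
    have "(cmod (\<mu> (Suc n) (x - f (a, j))))\<^sup>2 =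
        (cmod (\<mu> n (x - a)))\<^sup>2 * (cmod (ker (q n) (d 0 n * (x - a) - of_int (s n) * real j / real (q n))))\<^sup>2" for a j
    proof -
      have "\<mu> n (x - f (a, j)) = \<mu> n (x - a)"
        using \<mu>_periodic[of n "x - f (a, j)" "h * int j"] by (simp add: f_def)
      moreover have "d 0 n * (of_int (B 0 n) * of_int (h * int j)) = of_int (s n) * real j / real (q n)"
        using B_nonzero[of 0 n] \<beta>[of n] h qn by (auto simp: d_def B_Suc h')
      then have "d 0 n * (x - f (a, j)) = d 0 n * (x - a) - of_int (s n) * real j / real (q n)"
        by (simp add: f_def algebra_simps)
      ultimately show ?thesis by (simp add: \<mu>_def norm_mult power_mult_distrib)
    qed
    then have "(\<Sum>i\<in>?I. (cmod (\<mu> (Suc n) (x - f i)))\<^sup>2) =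
        (\<Sum>a\<in>A. (cmod (\<mu> n (x - a)))\<^sup>2 * (\<Sum>j<q n. (cmod (ker (q n) (d 0 n * (x - a) - of_int (s n) * real j / real (q n))))\<^sup>2))"
      by (simp add: sum.cartesian_product' sum_distrib_left)
    also have "\<dots> = 1" using A by (simp add: sum_ker_shift[OF qn(1) cop] level_spectrum_def)
    finally show ?thesis .
  qed
  then have "level_spectrum (Suc n) (f ` ?I)" using fin by (intro level_spectrum_image) auto
  moreover have "A \<subseteq> f ` ?I"
  proof
    fix a assume "a \<in> A"
    then show "a \<in> f ` ?I" using qn by (intro image_eqI[of _ _ "(a, 0)"]) (auto simp: f_def)
  qed
  ultimately show ?thesis by blast
qed

lemma level_spectrum_extend:
  assumes "level_spectrum n A"
  shows "\<exists>A'. A \<subseteq> A' \<and> level_spectrum (n + k) A'"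
proof (induction k)
  case 0
  then show ?case using assms by auto
next
  case (Suc k)
  then obtain A' where "A \<subseteq> A'" "level_spectrum (n + k) A'" by blast
  then show ?case using level_spectrum_step[of "n + k" A'] by auto
qed

text \<open>The spectra of growing levels are nested, with tails at least \<open>\<epsilon>\<close>
  near all their points. Comparing \<open>\<Phi>\<close> with the level transform then costs at most
  \<open>\<epsilon>\<close> squared, so a defect in Parseval's identity for \<open>\<Phi>\<close>
  would persist in the exact identity of a high level.\<close>

lemma spectrum_exists: "\<exists>\<Lambda>. countable \<Lambda> \<and> orth \<Phi> \<Lambda> \<and> (\<forall>y. complete_at \<Phi> \<Lambda> y)"
proof -
  obtain \<epsilon> \<delta> where \<epsilon>: "0 < \<epsilon>" "\<epsilon> \<le> 1/2" and \<delta>: "0 < \<delta>" "\<delta> \<le> 1 / (4 * L)"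
    and equi: "\<And>N. \<exists>n\<ge>N. \<forall>x. \<exists>\<kappa>::int. \<forall>y. \<bar>y\<bar> < \<delta> \<longrightarrow> \<epsilon> \<le> cmod (T n (y + x + of_int \<kappa>))"
    by (rule equi_positive) (rule that)
  define good where "good = (\<lambda>(n, A). level_spectrum n A \<and>
      (\<forall>a\<in>A. \<forall>y. \<bar>y\<bar> < \<delta> \<longrightarrow> \<epsilon> \<le> cmod (T n (y - a / of_int (B 0 n)))))"
  have T0: "\<epsilon> \<le> cmod (T n x)" if "\<bar>x\<bar> \<le> 2 * \<delta>" for n x
  proof -
    have "2 * \<delta> \<le> 1 / (2 * L)" using \<delta> L_pos by (simp add: field_simps)
    then show ?thesis using T_near_0[of x n] that \<epsilon> by linarith
  qed
  have "\<exists>f. \<forall>k. good (f k) \<and> (fst (f k) < fst (f (Suc k)) \<and> snd (f k) \<subseteq> snd (f (Suc k)))"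
  proof (rule dependent_nat_choice)
    have "level_spectrum 0 {0}" by (simp add: level_spectrum_def \<mu>_def)
    then have "good (0, {0})" using T0[of _ 0] \<delta> by (auto simp: good_def)
    then show "\<exists>x. good x" by blast
  next
    fix x k assume "good x"
    obtain n A where x: "x = (n, A)" by (cases x)
    have A: "level_spectrum n A" using \<open>good x\<close> by (simp add: good_def x)
    have fin: "finite A" using A by (simp add: level_spectrum_def)
    \<comment> \<open>\<open>N\<close> is so large that the old points, divided by the new scale,
      are smaller than \<open>\<delta>\<close>; then \<open>T_near_0\<close> takes care of them
      without translation.\<close>
    obtain N where N: "(\<Sum>a\<in>A. \<bar>a\<bar>) / \<delta> < 2 ^ N" using real_arch_pow[of 2] by auto
    obtain n' where n': "n + N + 1 \<le> n'"
      and eq: "\<And>x. \<exists>\<kappa>::int. \<forall>y. \<bar>y\<bar> < \<delta> \<longrightarrow> \<epsilon> \<le> cmod (T n' (y + x + of_int \<kappa>))"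
      using equi[of "n + N + 1"] by blast
    have small: "\<bar>a / of_int (B 0 n')\<bar> < \<delta>" if "a \<in> A" for a
    proof -
      have "\<bar>a\<bar> \<le> (\<Sum>a\<in>A. \<bar>a\<bar>)" using that fin by (intro member_le_sum) auto
      also have "\<dots> < \<delta> * 2 ^ N" using N \<delta> by (simp add: field_simps)
      also have "\<dots> \<le> \<delta> * 2 ^ n'" using n' \<delta> by (intro mult_left_mono power_increasing) auto
      also have "\<dots> \<le> \<delta> * of_int \<bar>B 0 n'\<bar>"
        using B_ge[of n' 0] \<delta> by (intro mult_left_mono) (metis of_int_le_iff of_int_numeral of_int_power, simp)
      finally show ?thesis using B_nonzero[of 0 n'] by (simp add: abs_divide divide_less_eq)
    qed
    obtain A1 where A1: "A \<subseteq> A1" "level_spectrum n' A1"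
      using level_spectrum_extend[OF A, of "n' - n"] n' by auto
    obtain \<kappa> :: "real \<Rightarrow> int" where \<kappa>: "\<And>x y. \<bar>y\<bar> < \<delta> \<Longrightarrow> \<epsilon> \<le> cmod (T n' (y + x + of_int (\<kappa> x)))"
      using eq by metis
    \<comment> \<open>Old points stay fixed so that the sets are nested; only new points are
      translated.\<close>
    define f where "f a = (if a \<in> A then a else a - of_int (B 0 n') * of_int (\<kappa> (- a / of_int (B 0 n'))))" for a
    have "(cmod (\<mu> n' (x - f a)))\<^sup>2 = (cmod (\<mu> n' (x - a)))\<^sup>2" for x a
      using \<mu>_periodic[of n' "x - a" "\<kappa> (- a / of_int (B 0 n'))"] by (simp add: f_def algebra_simps)
    then have A2: "level_spectrum n' (f ` A1)"
      using A1(2) by (intro level_spectrum_image) (auto simp: level_spectrum_def)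
    have "\<epsilon> \<le> cmod (T n' (y - f a / of_int (B 0 n')))" if y: "\<bar>y\<bar> < \<delta>" for a y
    proof (cases "a \<in> A")
      case True
      have "\<bar>y - a / of_int (B 0 n')\<bar> \<le> 2 * \<delta>" using small[OF True] y by linarith
      then show ?thesis using T0 True by (simp add: f_def)
    next
      case False
      then have eq: "y - f a / of_int (B 0 n') = y + - a / of_int (B 0 n') + of_int (\<kappa> (- a / of_int (B 0 n')))"
        using B_nonzero[of 0 n'] by (simp add: f_def diff_divide_distrib)
      show ?thesis unfolding eq by (rule \<kappa>[OF y])
    qed
    then have "good (n', f ` A1)" using A2 by (auto simp: good_def)
    moreover have "A \<subseteq> f ` A1" using A1(1) by (force simp: f_def)
    ultimately show "\<exists>y. good y \<and> (fst x < fst y \<and> snd x \<subseteq> snd y)"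
      using n' by (intro exI[of _ "(n', f ` A1)"]) (auto simp: x)
  qed
  then obtain f where f: "\<And>k. good (f k)" "\<And>k. fst (f k) < fst (f (Suc k))" "\<And>k. snd (f k) \<subseteq> snd (f (Suc k))"
    by blast
  define n where "n k = fst (f k)" for k
  define A where "A k = snd (f k)" for k
  have A: "level_spectrum (n k) (A k)" "finite (A k)"
    and TA: "\<And>a y. a \<in> A k \<Longrightarrow> \<bar>y\<bar> < \<delta> \<Longrightarrow> \<epsilon> \<le> cmod (T (n k) (y - a / of_int (B 0 (n k))))" for k
    using f(1)[of k] by (auto simp: good_def n_def A_def case_prod_beta level_spectrum_def)
  have mono: "A k \<subseteq> A l" if "k \<le> l" for k l
    using lift_Suc_mono_le[of A k l] f(3) that by (simp add: A_def)
  have n: "strict_mono n" using f(2) by (simp add: strict_mono_Suc_iff n_def)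
  define \<Lambda> where "\<Lambda> = (\<Union>k. A k)"
  have sub: "\<exists>k0. \<forall>k\<ge>k0. F \<subseteq> A k" if F: "finite F" "F \<subseteq> \<Lambda>" for F
    using F
  proof (induction F rule: finite_induct)
    case (insert a F)
    then obtain k0 k1 where "\<forall>k\<ge>k0. F \<subseteq> A k" "a \<in> A k1" by (auto simp: \<Lambda>_def)
    then have "\<forall>k\<ge>max k0 k1. insert a F \<subseteq> A k" using mono[of k1] by auto
    then show ?case by blast
  qed auto
  have orth: "orth \<Phi> \<Lambda>"
    unfolding orth_def
  proof (intro ballI impI)
    fix l l' assume l: "l \<in> \<Lambda>" "l' \<in> \<Lambda>" "l \<noteq> l'"
    then obtain k where k: "{l, l'} \<subseteq> A k" using sub[of "{l, l'}"] by auto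
    have "(\<Sum>a\<in>{l, l'}. (cmod (\<mu> (n k) (l - a)))\<^sup>2) \<le> (\<Sum>a\<in>A k. (cmod (\<mu> (n k) (l - a)))\<^sup>2)"
      using k A by (intro sum_mono2) auto
    then have "\<mu> (n k) (l - l') = 0" using l A(1)[of k] by (simp add: level_spectrum_def)
    then show "\<Phi> (l - l') = 0" using \<Phi>_split[of "l - l'" "n k"] by simp
  qed
  have "complete_at \<Phi> \<Lambda> y" for y
    unfolding complete_at_def
  proof (rule ccontr)
    define g where "g a = (cmod (\<Phi> (y - a)))\<^sup>2" for a
    assume "\<not> (\<forall>\<epsilon>>0. \<exists>F. finite F \<and> F \<subseteq> \<Lambda> \<and> 1 - \<epsilon> < (\<Sum>l\<in>F. (cmod (\<Phi> (y - l)))\<^sup>2))"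
    then obtain \<eta> where \<eta>: "0 < \<eta>" "\<And>F. finite F \<Longrightarrow> F \<subseteq> \<Lambda> \<Longrightarrow> (\<Sum>a\<in>F. g a) \<le> 1 - \<eta>"
      by (force simp: not_less g_def)
    define X where "X = {\<Sum>a\<in>F. g a |F. finite F \<and> F \<subseteq> \<Lambda>}"
    have X: "X \<noteq> {}" "bdd_above X" using \<eta>(2) by (auto simp: X_def bdd_above_def)
    \<comment> \<open>With this choice the points of a level set outside \<open>F0\<close> carry
      less than \<open>\<eta> / 4\<close> of the level sum. For a high level the points of
      \<open>F0\<close> carry less than \<open>1 - \<eta> + \<eta> / 2\<close>, so the total stays
      below \<open>1\<close>.\<close>
    have "0 < \<epsilon>\<^sup>2 * \<eta> / 4" using \<epsilon> \<eta> by simp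
    then have "Sup X - \<epsilon>\<^sup>2 * \<eta> / 4 < Sup X" by simp
    then obtain F0 where F0: "finite F0" "F0 \<subseteq> \<Lambda>" "Sup X - \<epsilon>\<^sup>2 * \<eta> / 4 < (\<Sum>a\<in>F0. g a)"
      using less_cSup_iff[OF X, of "Sup X - \<epsilon>\<^sup>2 * \<eta> / 4"] by (auto simp: X_def)
    have "(\<lambda>k. \<Sum>a\<in>F0. (cmod (\<mu> (n k) (y - a)))\<^sup>2) \<longlonglongrightarrow> (\<Sum>a\<in>F0. g a)"
      unfolding g_def
    proof (intro tendsto_sum tendsto_power tendsto_norm)
      fix a
      have "(\<lambda>N. \<mu> N (y - a)) \<longlonglongrightarrow> \<Phi> (y - a)"
        unfolding \<mu>_def using ker_prod_LIMSEQ[OF admissible_d[of 0]] by simp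
      then show "(\<lambda>k. \<mu> (n k) (y - a)) \<longlonglongrightarrow> \<Phi> (y - a)"
        using LIMSEQ_subseq_LIMSEQ[OF _ n] by (force simp: o_def)
    qed
    then have "\<forall>\<^sub>F k in sequentially. (\<Sum>a\<in>F0. (cmod (\<mu> (n k) (y - a)))\<^sup>2) < (\<Sum>a\<in>F0. g a) + \<eta> / 2"
      using \<eta>(1) by (intro order_tendstoD(2)) auto
    moreover have "\<forall>\<^sub>F k in sequentially. F0 \<subseteq> A k"
      using sub[OF F0(1,2)] by (simp add: eventually_sequentially)
    moreover have "\<forall>\<^sub>F k in sequentially. \<bar>y / of_int (B 0 (n k))\<bar> < \<delta>"
    proof -
      obtain N where N: "\<bar>y\<bar> / \<delta> < 2 ^ N" using real_arch_pow[of 2] by auto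
      have "\<bar>y / of_int (B 0 (n k))\<bar> < \<delta>" if "N \<le> k" for k
      proof -
        have "N \<le> n k" using that seq_suble[OF n, of k] by simp
        have "\<bar>y\<bar> < \<delta> * 2 ^ N" using N \<delta> by (simp add: field_simps)
        also have "\<dots> \<le> \<delta> * 2 ^ n k" using \<open>N \<le> n k\<close> \<delta> by (intro mult_left_mono power_increasing) auto
        also have "\<dots> \<le> \<delta> * of_int \<bar>B 0 (n k)\<bar>"
          using B_ge[of "n k" 0] \<delta> by (intro mult_left_mono) (metis of_int_le_iff of_int_numeral of_int_power, simp)
        finally show ?thesis using B_nonzero[of 0 "n k"] by (simp add: abs_divide divide_less_eq)
      qed
      then show ?thesis by (auto simp: eventually_sequentially)
    qed
    ultimately have "\<forall>\<^sub>F k in sequentially. (\<Sum>a\<in>F0. (cmod (\<mu> (n k) (y - a)))\<^sup>2) < (\<Sum>a\<in>F0. g a) + \<eta> / 2 \<and>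
        F0 \<subseteq> A k \<and> \<bar>y / of_int (B 0 (n k))\<bar> < \<delta>"
      by eventually_elim blast
    then obtain k where k: "(\<Sum>a\<in>F0. (cmod (\<mu> (n k) (y - a)))\<^sup>2) < (\<Sum>a\<in>F0. g a) + \<eta> / 2" "F0 \<subseteq> A k"
        "\<bar>y / of_int (B 0 (n k))\<bar> < \<delta>"
      by (auto simp: eventually_sequentially)
    have "A k \<subseteq> \<Lambda>" by (auto simp: \<Lambda>_def)
    have "(\<Sum>a\<in>A k. g a) \<le> Sup X"
      using X A(2) \<open>A k \<subseteq> \<Lambda>\<close> by (intro cSup_upper) (auto simp: X_def)
    moreover have "(\<Sum>a\<in>A k. g a) = (\<Sum>a\<in>F0. g a) + (\<Sum>a\<in>A k - F0. g a)"
      using A(2) k(2) by (metis add.commute sum.subset_diff)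
    ultimately have rest: "(\<Sum>a\<in>A k - F0. g a) < \<epsilon>\<^sup>2 * \<eta> / 4" using F0(3) by simp
    have "\<epsilon>\<^sup>2 * (\<Sum>a\<in>A k - F0. (cmod (\<mu> (n k) (y - a)))\<^sup>2) \<le> (\<Sum>a\<in>A k - F0. g a)"
      unfolding sum_distrib_left
    proof (intro sum_mono)
      fix a assume "a \<in> A k - F0"
      then have "\<epsilon> \<le> cmod (T (n k) (y / of_int (B 0 (n k)) - a / of_int (B 0 (n k))))"
        using k(3) by (intro TA) auto
      then have "\<epsilon> * cmod (\<mu> (n k) (y - a)) \<le> cmod (\<Phi> (y - a))"
        unfolding \<Phi>_split[of "y - a" "n k"] norm_mult diff_divide_distrib
        by (subst mult.commute) (rule mult_left_mono, auto)
      then have "(\<epsilon> * cmod (\<mu> (n k) (y - a)))\<^sup>2 \<le> g a"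
        unfolding g_def using \<epsilon> by (intro power_mono) auto
      then show "\<epsilon>\<^sup>2 * (cmod (\<mu> (n k) (y - a)))\<^sup>2 \<le> g a" by (simp add: power_mult_distrib)
    qed
    then have "\<epsilon>\<^sup>2 * (\<Sum>a\<in>A k - F0. (cmod (\<mu> (n k) (y - a)))\<^sup>2) < \<epsilon>\<^sup>2 * (\<eta> / 4)" using rest by simp
    then have "(\<Sum>a\<in>A k - F0. (cmod (\<mu> (n k) (y - a)))\<^sup>2) < \<eta> / 4"
      using \<epsilon> by (subst (asm) mult_less_cancel_left_pos) auto
    moreover have "(\<Sum>a\<in>A k. (cmod (\<mu> (n k) (y - a)))\<^sup>2) =
        (\<Sum>a\<in>F0. (cmod (\<mu> (n k) (y - a)))\<^sup>2) + (\<Sum>a\<in>A k - F0. (cmod (\<mu> (n k) (y - a)))\<^sup>2)"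
      using A(2) k(2) by (metis add.commute sum.subset_diff)
    moreover have "(\<Sum>a\<in>A k. (cmod (\<mu> (n k) (y - a)))\<^sup>2) = 1" using A(1) by (simp add: level_spectrum_def)
    ultimately show False using k(1) \<eta>(1) \<eta>(2)[OF F0(1,2)] by linarith
  qed
  moreover have "countable \<Lambda>" unfolding \<Lambda>_def using A(2) by (intro countable_UN) (auto intro: countable_finite)
  ultimately show ?thesis using orth by blast
qed

end


section \<open>Words over finitely many symbols\<close>

lemma inf_conv_cong:
  assumes "\<And>n. \<nu> (Suc n) = \<nu>' (Suc n)"
  shows "inf_conv \<nu> = inf_conv \<nu>'"
proof -
  have "partial_conv \<nu> n = partial_conv \<nu>' n" for n
    by (induction n) (simp_all add: assms)
  then have "partial_conv \<nu> = partial_conv \<nu>'" by (rule ext)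
  then show ?thesis by (simp only: inf_conv_def)
qed

lemma mu_eq_kconv:
  assumes "\<And>n. 2 \<le> p (\<sigma> (Suc n))"
  shows "mu b p t \<sigma> = kconv (\<lambda>n. of_int (t (\<sigma> (Suc n))) / of_int (\<Prod>k=1..Suc n. b (\<sigma> k))) (\<lambda>n. nat (p (\<sigma> (Suc n))))"
  unfolding mu_def kconv_def
proof (rule inf_conv_cong)
  fix n
  let ?B = "\<Prod>k=1..Suc n. real_of_int (b (\<sigma> k))" and ?p = "p (\<sigma> (Suc n))" and ?t = "t (\<sigma> (Suc n))"
  have "{0..?p - 1} = int ` {..<nat ?p}"
  proof
    show "{0..?p - 1} \<subseteq> int ` {..<nat ?p}"
    proof
      fix i assume "i \<in> {0..?p - 1}"
      then show "i \<in> int ` {..<nat ?p}" by (intro image_eqI[of _ _ "nat i"]) auto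
    qed
  qed auto
  then have "(\<lambda>d. inverse ?B * of_int d) ` digits ?p ?t = (\<lambda>k. of_int ?t / ?B * real k) ` {..<nat ?p}"
    unfolding digits_def image_image by (simp add: image_image divide_inverse mult_ac)
  then show "unif ((\<lambda>d. inverse ?B * of_int d) ` digits ?p ?t) =
    unif ((\<lambda>k. of_int (t (\<sigma> (Suc (Suc n - 1)))) / of_int (\<Prod>k=1..Suc (Suc n - 1). b (\<sigma> k)) * real k) ` {..<nat (p (\<sigma> (Suc (Suc n - 1))))})"
    by simp
qed

lemma (in moran) Q_ge: "2 ^ n \<le> \<bar>Q n\<bar>"
proof (induction n)
  case (Suc n)
  have "2 ^ n * 2 \<le> \<bar>Q n\<bar> * \<bar>\<beta> (Suc n)\<bar>" using Suc \<beta> by (intro mult_mono) auto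
  then show ?case by (simp add: Q_Suc abs_mult mult.commute)
qed simp

lemma (in moran) rational_adm_c:
  assumes S: "\<And>n. \<bar>s n\<bar> \<le> S"
  shows "rational_adm c q"
proof -
  obtain P where P: "\<And>n. q n \<le> P" using q_bounded by blast
  have bound: "real (q n) * \<bar>c n\<bar> \<le> real P * of_int S * (1/2) ^ n" for n
  proof -
    have "\<bar>c n\<bar> = of_int \<bar>s n\<bar> / of_int \<bar>Q n\<bar>" by simp
    also have "\<dots> \<le> of_int S / of_int (2 ^ n)"
      using S[of n] Q_ge[of n] by (intro frac_le) (simp_all only: of_int_le_iff of_int_0_le_iff of_int_0_less_iff, auto)
    finally have "real (q n) * \<bar>c n\<bar> \<le> real P * (of_int S / of_int (2 ^ n))"
      using P[of n] by (intro mult_mono) auto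
    then show ?thesis by (simp add: power_divide)
  qed
  have "summable (\<lambda>n. real P * of_int S * (1/2 :: real) ^ n)"
    by (intro summable_mult summable_geometric) simp
  then have "summable (\<lambda>n. real (q n) * \<bar>c n\<bar>)"
  proof (rule summable_comparison_test')
    show "norm (real (q n) * \<bar>c n\<bar>) \<le> real P * of_int S * (1/2) ^ n" for n
      using bound[of n] by (simp only: real_norm_def abs_mult abs_of_nat abs_abs)
  qed
  moreover have "1 \<le> q n" for n using q[of n] by simp
  ultimately show ?thesis
    using s Q_nonzero by (auto simp: rational_adm_def admissible_def)
qed

lemma qspec_tails:
  assumes "moran \<beta> s q" "qspec (moran.c \<beta> s) q"
  shows "moran (\<lambda>n. \<beta> (n + N)) (\<lambda>n. s (n + N)) (\<lambda>n. q (n + N)) \<and>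
    qspec (moran.c (\<lambda>n. \<beta> (n + N)) (\<lambda>n. s (n + N))) (\<lambda>n. q (n + N))"
proof (induction N)
  case (Suc N)
  then show ?case using moran.qspec_tail[of "\<lambda>n. \<beta> (n + N)" "\<lambda>n. s (n + N)" "\<lambda>n. q (n + N)"] by simp
qed (use assms in simp)

lemma spectral_kconv_scale:
  assumes "admissible d q" "a \<noteq> 0"
    and \<Lambda>: "\<exists>\<Lambda>. countable \<Lambda> \<and> orth (ker_prod d q) \<Lambda> \<and> (\<forall>y. complete_at (ker_prod d q) \<Lambda> y)"
  shows "spectral_measure (kconv (\<lambda>n. a * d n) q)"
proof -
  obtain \<Lambda> where "countable \<Lambda>" "orth (ker_prod d q) \<Lambda>" "\<And>y. complete_at (ker_prod d q) \<Lambda> y"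
    using \<Lambda> by blast
  moreover have "ker_prod (\<lambda>n. a * d n) q = (\<lambda>x. ker_prod d q (a * x))"
    by (rule ext) (rule ker_prod_scale)
  ultimately show ?thesis
    using assms unfolding spectral_kconv_iff[OF admissible_scale[OF assms(1)]]
    by (intro exI[of _ "(\<lambda>l. l / a) ` \<Lambda>"]) (auto intro: orth_scale complete_at_scale)
qed

lemma (in hadamard) spectral_scaled: "a \<noteq> 0 \<Longrightarrow> spectral_measure (kconv (\<lambda>n. a * d 0 n) q)"
  using admissible_d[of 0] spectrum_exists by (intro spectral_kconv_scale) auto

section \<open>Points of a coset that avoid the zeros of a symbol\<close>

lemma avoid_divisor:
  fixes g t u :: int
  assumes "coprime g t" "\<not> is_unit g"
  shows "\<exists>e\<in>{0, 1}. \<not> g dvd u + e * t"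
proof (rule ccontr)
  assume "\<not> ?thesis"
  then have "g dvd u" "g dvd u + t" by auto
  then have gt: "g dvd t" using dvd_add_right_iff by blast
  show False using coprime_common_divisor[OF assms(1) dvd_refl gt] assms(2) by simp
qed

lemma solve_residue:
  fixes g t u :: int
  assumes "coprime g t" "0 < g"
  shows "\<exists>k. 0 \<le> k \<and> k < g \<and> g dvd u + k * t"
proof -
  obtain x y where xy: "x * g + y * t = 1"
    using bezout_int[of g t] assms(1) by (auto simp: coprime_iff_gcd_eq_1)
  define k where "k = (- u * y) mod g"
  have "u + (- u * y) * t = u * (1 - y * t)" by (simp add: algebra_simps)
  also have "1 - y * t = x * g" using xy by linarith
  finally have "g dvd u + (- u * y) * t" by simp
  moreover have "k mod g = (- u * y) mod g" by (simp add: k_def)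
  then have "g dvd k - (- u * y)" by (simp only: mod_eq_dvd_iff)
  then have "g dvd (k - (- u * y)) * t" by (rule dvd_mult2)
  ultimately have "g dvd (u + (- u * y) * t) + (k - (- u * y)) * t" by (rule dvd_add)
  then have "g dvd u + k * t" by (simp add: algebra_simps)
  then show ?thesis using assms(2) by (intro exI[of _ k]) (auto simp: k_def)
qed

locale symbols =
  fixes m :: nat and b p t :: "nat \<Rightarrow> int"
  assumes bpt: "k \<in> {1..m} \<Longrightarrow> 2 \<le> \<bar>b k\<bar> \<and> 2 \<le> p k \<and> 1 \<le> \<bar>t k\<bar>"
    and coprime_pt: "k \<in> {1..m} \<Longrightarrow> i \<in> {1..m} \<Longrightarrow> coprime (p k) (t i)"
    and coprime_tt: "i \<in> {1..m} \<Longrightarrow> j \<in> {1..m} \<Longrightarrow> i \<noteq> j \<Longrightarrow> coprime (t i) (t j)"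
begin

definition S :: int where "S = (\<Prod>k\<in>{1..m}. \<bar>t k\<bar>)"

lemma S_pos: "0 < S"
  unfolding S_def using bpt by (intro prod_pos) force

lemma t_dvd_S: "k \<in> {1..m} \<Longrightarrow> t k dvd S"
  unfolding S_def using dvd_prodI[of "{1..m}" k "\<lambda>k. \<bar>t k\<bar>"] by simp

text \<open>The point \<open>v / t i\<close> is not a zero of a level that carries the symbol \<open>i\<close>.\<close>

definition avoids :: "(nat \<Rightarrow> nat) \<Rightarrow> nat \<Rightarrow> int \<Rightarrow> bool" where
  "avoids \<tau> i v \<longleftrightarrow> (\<forall>k j. \<tau> k = i \<longrightarrow> v * p i = (\<Prod>l\<le>k. b (\<tau> l)) * j \<longrightarrow> p i dvd j)"

text \<open>A zero of a level with symbol \<open>i\<close> is a multiple of \<open>1 / t i\<close>. Since the \<open>t i\<close> are pairwise coprime, a coset of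
  the integers other than the integers themselves meets the zeros of at most one symbol.\<close>

lemma nonzero_residue:
  assumes \<tau>: "\<And>k. \<tau> k \<in> {1..m}" and dvd: "\<And>k. p (\<tau> k) dvd b (\<tau> k)"
    and K: "\<And>i u. i \<in> {1..m} \<Longrightarrow> \<not> t i dvd u \<Longrightarrow> \<bar>u\<bar> < \<bar>t i\<bar> \<Longrightarrow> \<exists>\<kappa>. 0 \<le> \<kappa> \<and> \<kappa> \<le> K \<and> avoids \<tau> i (u + \<kappa> * t i)"
    and "0 \<le> K"
  shows "\<exists>w. S dvd w - z \<and> \<bar>w\<bar> \<le> (K + 1) * S \<and>
    (\<forall>k j. w * p (\<tau> k) * t (\<tau> k) = S * (\<Prod>l\<le>k. b (\<tau> l)) * j \<longrightarrow> p (\<tau> k) dvd j)"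
proof -
  define y where "y = z mod S"
  have y: "0 \<le> y" "y < S" "S dvd y - z" using S_pos by (auto simp: y_def mod_eq_dvd_iff[symmetric])
  \<comment> \<open>As \<open>p (\<tau> k)\<close> divides the last ratio, it can be cancelled:
    \<open>w / S\<close> is a multiple of \<open>1 / t (\<tau> k)\<close>.\<close>
  have level: "S dvd w * t (\<tau> k)" if "w * p (\<tau> k) * t (\<tau> k) = S * (\<Prod>l\<le>k. b (\<tau> l)) * j" for w k j
  proof -
    have "p (\<tau> k) dvd (\<Prod>l\<le>k. b (\<tau> l))" using dvd[of k] dvd_prodI[of "{..k}" k "\<lambda>l. b (\<tau> l)"] by (auto intro: dvd_trans)
    then obtain B where "(\<Prod>l\<le>k. b (\<tau> l)) = p (\<tau> k) * B" by (elim dvdE)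
    then have "p (\<tau> k) * (w * t (\<tau> k)) = p (\<tau> k) * (S * (B * j))" using that by (simp add: mult_ac)
    then have "w * t (\<tau> k) = S * (B * j)" using bpt[OF \<tau>[of k]] by auto
    then show ?thesis by simp
  qed
  \<comment> \<open>The coset of \<open>y / S\<close> is that of the integers, or contains
    nonintegral multiples of \<open>1 / t i\<close> for some \<open>i\<close>, or meets no zeros at
    all.\<close>
  consider "y = 0" | i where "y \<noteq> 0" "i \<in> {1..m}" "S dvd y * t i" | "\<And>i. i \<in> {1..m} \<Longrightarrow> \<not> S dvd y * t i"
    by blast
  then show ?thesis
  proof cases
    case 1
    have b0: "(\<Prod>l\<le>k. b (\<tau> l)) \<noteq> 0" for k
    proof -
      have "b (\<tau> l) \<noteq> 0" for l using bpt[OF \<tau>[of l]] by auto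
      then show ?thesis by simp
    qed
    show ?thesis
    proof (intro exI[of _ 0] conjI allI impI)
      show "S dvd 0 - z" using y(3) 1 by simp
      show "\<bar>0\<bar> \<le> (K + 1) * S" using \<open>0 \<le> K\<close> S_pos by simp
      fix k j assume "0 * p (\<tau> k) * t (\<tau> k) = S * (\<Prod>l\<le>k. b (\<tau> l)) * j"
      then have "S = 0 \<or> (\<Prod>l\<le>k. b (\<tau> l)) = 0 \<or> j = 0" by (metis mult_eq_0_iff mult_zero_left)
      then show "p (\<tau> k) dvd j" using b0[of k] S_pos by auto
    qed
  next
    case 2
    obtain u where u: "y * t i = S * u" using 2(3) by (elim dvdE)
    have ti: "t i \<noteq> 0" using bpt[OF 2(2)] by auto
    have ndvd: "\<not> S dvd y" using y 2(1) zdvd_not_zless[of y S] by auto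
    have "\<not> t i dvd u"
    proof
      assume "t i dvd u"
      then obtain u' where "u = t i * u'" by (elim dvdE)
      then have "y = S * u'" using u ti by auto
      then show False using ndvd by simp
    qed
    moreover have "S * \<bar>u\<bar> = y * \<bar>t i\<bar>" using u y S_pos by (metis abs_mult abs_of_nonneg abs_of_pos)
    then have "S * \<bar>u\<bar> < S * \<bar>t i\<bar>" using y ti by simp
    then have "\<bar>u\<bar> < \<bar>t i\<bar>" using S_pos by simp
    ultimately obtain \<kappa> where \<kappa>: "0 \<le> \<kappa>" "\<kappa> \<le> K" "avoids \<tau> i (u + \<kappa> * t i)" using K[OF 2(2)] by blast
    define w where "w = y + \<kappa> * S"
    have wt: "w * t i = S * (u + \<kappa> * t i)" by (simp add: w_def distrib_right u algebra_simps)
    have "p (\<tau> k) dvd j" if eq: "w * p (\<tau> k) * t (\<tau> k) = S * (\<Prod>l\<le>k. b (\<tau> l)) * j" for k j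
    proof (cases "\<tau> k = i")
      case True
      have "S * ((u + \<kappa> * t i) * p i) = (w * t i) * p i" by (simp only: wt mult.assoc)
      also have "\<dots> = w * p i * t i" by (simp only: mult_ac)
      also have "\<dots> = S * ((\<Prod>l\<le>k. b (\<tau> l)) * j)" using eq by (simp only: True mult.assoc)
      finally have "(u + \<kappa> * t i) * p i = (\<Prod>l\<le>k. b (\<tau> l)) * j" using S_pos by simp
      then show ?thesis using \<kappa>(3) True unfolding avoids_def by blast
    next
      case False
      obtain x x' where "x * t i + x' * t (\<tau> k) = 1"
        using bezout_int[of "t i" "t (\<tau> k)"] coprime_tt[OF 2(2) \<tau>, of k] False
        by (auto simp: coprime_iff_gcd_eq_1)
      then have "w = x * (w * t i) + x' * (w * t (\<tau> k))" by (metis distrib_left mult.left_commute mult.right_neutral)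
      moreover have "S dvd x * (w * t i) + x' * (w * t (\<tau> k))"
        by (rule dvd_add[OF dvd_mult[of S "w * t i"] dvd_mult[OF level[OF eq]]]) (simp add: wt)
      ultimately have "S dvd w" by simp
      then have "S dvd y" by (simp add: w_def dvd_add_left_iff)
      then show ?thesis using ndvd by simp
    qed
    moreover have "\<bar>w\<bar> \<le> (K + 1) * S"
    proof -
      have "\<kappa> * S \<le> K * S" using \<kappa> S_pos by (intro mult_right_mono) auto
      moreover have "0 \<le> \<kappa> * S" using \<kappa> S_pos by simp
      ultimately show ?thesis using y unfolding w_def distrib_right mult_1 by linarith
    qed
    moreover have "S dvd w - z" using y(3) dvd_add[of S "y - z" "\<kappa> * S"] by (simp add: w_def algebra_simps)
    ultimately show ?thesis by blast
  next
    case 3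
    have "0 \<le> K * S" using \<open>0 \<le> K\<close> S_pos by simp
    then have "\<bar>y\<bar> \<le> (K + 1) * S" using y unfolding distrib_right mult_1 by linarith
    then show ?thesis using y(3) 3 level \<tau> by blast
  qed
qed

text \<open>Every product of ratios contains \<open>b i\<close> from level \<open>0\<close>, so a
  solution at any level makes \<open>c\<close>, and hence \<open>g = gcd c (p i)\<close>, divide the
  point. As \<open>g\<close> is prime to \<open>t i\<close>, it cannot divide both \<open>u\<close>
  and \<open>u + t i\<close>.\<close>

lemma avoids_common_divisor:
  assumes \<tau>: "\<And>k. \<tau> k \<in> {1..m}" and c: "b i = p i * c" "\<not> coprime c (p i)" and i: "i = \<tau> 0"
  shows "\<exists>\<kappa>\<in>{0, 1}. avoids \<tau> i (u + \<kappa> * t i)"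
proof -
  have im: "i \<in> {1..m}" using \<tau> i by simp
  define g where "g = gcd c (p i)"
  have "\<not> is_unit g" using c(2) by (simp add: g_def coprime_iff_gcd_eq_1)
  moreover have "coprime g (t i)"
    using coprime_pt[OF im im] coprime_divisors[of g "p i" "t i" "t i"] by (simp add: g_def)
  ultimately obtain e where e: "e \<in> {0, 1}" "\<not> g dvd u + e * t i" using avoid_divisor by blast
  have "False" if "(u + e * t i) * p i = (\<Prod>l\<le>k. b (\<tau> l)) * j" for k j
  proof -
    have "b (\<tau> 0) dvd (\<Prod>l\<le>k. b (\<tau> l))" using dvd_prodI[of "{..k}" 0 "\<lambda>l. b (\<tau> l)"] by simp
    then obtain X where "(\<Prod>l\<le>k. b (\<tau> l)) = p i * c * X" using c i by (metis dvdE)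
    then have "p i * (u + e * t i) = p i * (c * (X * j))" using that by (simp add: mult_ac)
    then have "u + e * t i = c * (X * j)" using bpt[OF im] by auto
    then show False using e(2) by (simp add: g_def dvd_mult2)
  qed
  then show ?thesis using e(1) unfolding avoids_def by blast
qed

text \<open>If \<open>i\<close> is not the first symbol, each of its levels has the additional
  factor \<open>p (\<tau> 0)\<close>, and a point not divisible by it avoids them all. If
  \<open>i\<close> is the first symbol and \<open>c\<close> is prime to \<open>p i\<close>, a
  multiple \<open>p i * y\<close> is harmless at level \<open>0\<close>, where it forces
  \<open>p i\<close> to divide \<open>j\<close>; later levels with \<open>i\<close> contain
  \<open>p (\<tau> 1)\<close> as well, so \<open>y\<close> is chosen not divisible by that.\<close>

lemma avoids_two_symbols:
  assumes \<tau>: "\<And>k. \<tau> k \<in> {1..m}" and dvd: "\<And>k. p (\<tau> k) dvd b (\<tau> k)" and ne: "\<tau> 0 \<noteq> \<tau> 1" and i: "i \<in> {1..m}"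
  shows "\<exists>\<kappa>. 0 \<le> \<kappa> \<and> \<kappa> \<le> 2 * p i \<and> avoids \<tau> i (u + \<kappa> * t i)"
proof -
  have p2: "2 \<le> p k" if "k \<in> {1..m}" for k using bpt[OF that] by simp
  have nu: "\<not> is_unit (p k)" if "k \<in> {1..m}" for k using p2[OF that] by auto
  have sub: "(\<Prod>l\<in>A. b (\<tau> l)) dvd (\<Prod>l\<le>k. b (\<tau> l))" if "A \<subseteq> {..k}" for A k
    using that by (intro prod_dvd_prod_subset) auto
  show ?thesis
  proof (cases "i = \<tau> 0")
    case False
    obtain e where e: "e \<in> {0, 1}" "\<not> p (\<tau> 0) dvd u + e * t i"
      using avoid_divisor[OF coprime_pt[OF \<tau> i] nu[OF \<tau>]] by blast
    have "False" if k: "\<tau> k = i" "(u + e * t i) * p i = (\<Prod>l\<le>k. b (\<tau> l)) * j" for k j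
    proof -
      have "k \<noteq> 0" using k(1) False by metis
      then have "b (\<tau> 0) * b (\<tau> k) dvd (\<Prod>l\<le>k. b (\<tau> l))" using sub[of "{0, k}" k] by simp
      moreover have "p (\<tau> 0) * p i dvd b (\<tau> 0) * b (\<tau> k)" using dvd[of 0] dvd[of k] k(1) by (intro mult_dvd_mono) auto
      ultimately obtain X where "(\<Prod>l\<le>k. b (\<tau> l)) = p (\<tau> 0) * p i * X" by (metis dvd_trans dvdE)
      then have "p i * (u + e * t i) = p i * (p (\<tau> 0) * (X * j))" using k(2) by (simp add: mult_ac)
      then have "u + e * t i = p (\<tau> 0) * (X * j)" using p2[OF i] by auto
      then show False using e(2) by simp
    qed
    then have "avoids \<tau> i (u + e * t i)" unfolding avoids_def by blast
    then show ?thesis using e(1) p2[OF i] by (intro exI[of _ e]) auto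
  next
    case True
    obtain c where c: "b i = p i * c" using dvd[of 0] True by (auto elim: dvdE)
    show ?thesis
    proof (cases "coprime c (p i)")
      case False
      then obtain \<kappa> where "\<kappa> \<in> {0, 1}" "avoids \<tau> i (u + \<kappa> * t i)"
        using avoids_common_divisor[of \<tau>, OF \<tau> c False True, of u] by blast
      then show ?thesis using p2[OF i] by (intro exI[of _ \<kappa>]) auto
    next
      case cop: True
      obtain k0 where k0: "0 \<le> k0" "k0 < p i" "p i dvd u + k0 * t i"
        using solve_residue[OF coprime_pt[OF i i], of u] p2[OF i] by auto
      obtain y where y: "u + k0 * t i = p i * y" using k0(3) by (elim dvdE)
      obtain e where e: "e \<in> {0, 1}" "\<not> p (\<tau> 1) dvd y + e * t i"
        using avoid_divisor[OF coprime_pt[OF \<tau> i] nu[OF \<tau>]] by blast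
      have v: "u + (k0 + e * p i) * t i = p i * (y + e * t i)" using y by (simp add: algebra_simps)
      have "p i dvd j" if k: "\<tau> k = i" "p i * (y + e * t i) * p i = (\<Prod>l\<le>k. b (\<tau> l)) * j" for k j
      proof (cases "k = 0")
        case True
        then have "p i * (p i * (y + e * t i)) = p i * (c * j)" using k c by (simp add: mult_ac)
        then have "p i * (y + e * t i) = c * j" using p2[OF i] by auto
        then have "p i dvd c * j" by (metis dvd_triv_left)
        then show ?thesis using cop by (simp add: coprime_commute coprime_dvd_mult_right_iff)
      next
        case False
        have "k \<noteq> 1" using k(1) True ne by metis
        then have "b (\<tau> 0) * (b (\<tau> 1) * b (\<tau> k)) dvd (\<Prod>l\<le>k. b (\<tau> l))"
          using sub[of "{0, 1, k}" k] False by simp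
        moreover have "p i * (p (\<tau> 1) * p i) dvd b (\<tau> 0) * (b (\<tau> 1) * b (\<tau> k))"
          using dvd[of 0] dvd[of 1] dvd[of k] k(1) True by (intro mult_dvd_mono) auto
        ultimately obtain X where "(\<Prod>l\<le>k. b (\<tau> l)) = p i * (p (\<tau> 1) * p i) * X" by (metis dvd_trans dvdE)
        then have "(p i * p i) * (y + e * t i) = (p i * p i) * (p (\<tau> 1) * (X * j))" using k(2) by (simp add: mult_ac)
        then have "y + e * t i = p (\<tau> 1) * (X * j)" using p2[OF i] by auto
        then show ?thesis using e(2) by simp
      qed
      then have "avoids \<tau> i (u + (k0 + e * p i) * t i)" unfolding avoids_def v by blast
      then show ?thesis using e(1) k0 by (intro exI[of _ "k0 + e * p i"]) auto
    qed
  qed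
qed

text \<open>Level \<open>k\<close> reads \<open>v = p i ^ k * c ^ Suc k * j\<close>. For
  \<open>c\<close> prime to \<open>p i\<close>, take \<open>v\<close> divisible by
  \<open>p i ^ J\<close> with \<open>J = |t i|\<close>: for \<open>k < J\<close> this forces
  \<open>p i\<close> to divide \<open>j\<close>. For \<open>k \<ge> J\<close> only
  \<open>j = 0\<close> is left, since \<open>|v| < p i ^ J * |t i|\<close> while
  \<open>|c| \<ge> 2\<close> gives \<open>|c| ^ Suc k > |t i|\<close>. This is where
  \<open>|b i| \<noteq> p i\<close> enters.\<close>

lemma avoids_constant:
  assumes i: "i \<in> {1..m}" and dvd: "p i dvd b i" and nb: "\<bar>b i\<bar> \<noteq> p i" and u: "\<bar>u\<bar> < \<bar>t i\<bar>"
  shows "\<exists>\<kappa>. 0 \<le> \<kappa> \<and> \<kappa> \<le> p i ^ nat \<bar>t i\<bar> \<and> avoids (\<lambda>_. i) i (u + \<kappa> * t i)"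
proof -
  obtain c where c: "b i = p i * c" using dvd by (elim dvdE)
  have p2: "2 \<le> p i" using bpt[OF i] by simp
  have "\<bar>c\<bar> \<noteq> 1" using nb c p2 by (auto simp: abs_mult)
  moreover have "c \<noteq> 0" using bpt[OF i] c by auto
  ultimately have c2: "2 \<le> \<bar>c\<bar>" by linarith
  define J where "J = nat \<bar>t i\<bar>"
  have pJ: "1 \<le> p i ^ J" using p2 by simp
  show ?thesis
  proof (cases "coprime c (p i)")
    case False
    obtain \<kappa> where "\<kappa> \<in> {0, 1}" "avoids (\<lambda>_. i) i (u + \<kappa> * t i)"
      using avoids_common_divisor[of "\<lambda>_. i", OF i c False refl, of u] by blast
    then show ?thesis using pJ unfolding J_def by (intro exI[of _ \<kappa>]) auto
  next
    case cop: True
    have "coprime (p i ^ J) (t i)" using coprime_pt[OF i i] by simp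
    then obtain \<kappa> where \<kappa>: "0 \<le> \<kappa>" "\<kappa> < p i ^ J" "p i ^ J dvd u + \<kappa> * t i"
      using solve_residue[of "p i ^ J" "t i" u] pJ by auto
    define v where "v = u + \<kappa> * t i"
    have small: "\<bar>v\<bar> < p i ^ J * \<bar>t i\<bar>"
    proof -
      have "\<bar>v\<bar> \<le> \<bar>u\<bar> + \<kappa> * \<bar>t i\<bar>" using abs_triangle_ineq[of u "\<kappa> * t i"] \<kappa>(1) by (simp add: v_def abs_mult)
      also have "\<kappa> * \<bar>t i\<bar> \<le> (p i ^ J - 1) * \<bar>t i\<bar>" using \<kappa>(2) by (intro mult_right_mono) auto
      finally show ?thesis using u by (simp add: left_diff_distrib)
    qed
    have "p i dvd j" if "v * p i = (\<Prod>l\<le>k. b i) * j" for k :: nat and j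
    proof -
      have "p i * v = p i * (p i ^ k * (c ^ Suc k * j))" using that by (simp add: c power_mult_distrib mult_ac)
      then have v: "v = p i ^ k * (c ^ Suc k * j)" using p2 by auto
      show ?thesis
      proof (cases "k < J")
        case True
        then have "p i ^ Suc k dvd v" using \<kappa>(3) le_imp_power_dvd[of "Suc k" J "p i"] by (auto simp: v_def intro: dvd_trans)
        then have "p i ^ k * p i dvd p i ^ k * (c ^ Suc k * j)" by (simp add: v mult.commute)
        then have "p i dvd c ^ Suc k * j" using p2 by (simp only: dvd_mult_cancel_left) auto
        moreover have "coprime (p i) (c ^ Suc k)" using cop by (simp add: coprime_commute)
        ultimately show ?thesis by (simp only: coprime_dvd_mult_right_iff)
      next
        case False
        have "j = 0"
        proof (rule ccontr)
          assume "j \<noteq> 0"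
          then have j1: "1 \<le> \<bar>j\<bar>" by linarith
          have "\<bar>t i\<bar> < 2 ^ J" using less_exp[of J] by (simp add: J_def) (metis J_def nat_less_iff abs_ge_zero of_nat_less_two_power int_nat_eq zless_nat_eq_int_zless)
          also have "(2::int) ^ J \<le> 2 ^ Suc k" using False by (intro power_increasing) auto
          also have "\<dots> \<le> \<bar>c\<bar> ^ Suc k" using c2 by (intro power_mono) auto
          also have "\<dots> \<le> \<bar>c ^ Suc k * j\<bar>"
            using mult_left_mono[OF j1, of "\<bar>c\<bar> ^ Suc k"] by (simp only: abs_mult power_abs mult_1_right) simp
          finally have "p i ^ J * \<bar>t i\<bar> \<le> p i ^ k * \<bar>c ^ Suc k * j\<bar>"
            using False p2 by (intro mult_mono power_increasing) auto
          also have "\<dots> = \<bar>v\<bar>" using p2 unfolding v by (simp add: abs_mult)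
          finally show False using small by simp
        qed
        then show ?thesis by simp
      qed
    qed
    then have "avoids (\<lambda>_. i) i v" unfolding avoids_def by blast
    then show ?thesis using \<kappa> unfolding v_def J_def by (intro exI[of _ \<kappa>]) auto
  qed
qed

end

text \<open>Replacing the ratio of level \<open>0\<close> by \<open>q 0\<close> makes the
  divisibility condition true there, and the change of measure is absorbed by the scaling factor
  \<open>a\<close>.\<close>

lemma (in moran) spectral_if_hadamard:
  assumes "hadamard (\<beta>(0 := int (q 0))) s q S b R" "a \<noteq> 0"
  shows "spectral_measure (kconv (\<lambda>n. a * c n) q)"
proof -
  define \<beta>' where "\<beta>' = \<beta>(0 := int (q 0))"
  interpret H: hadamard \<beta>' s q S b R using assms(1) by (simp only: \<beta>'_def)
  have \<beta>': "\<beta>' 0 = int (q 0)" "\<beta>' (Suc n) = \<beta> (Suc n)" for n by (simp_all add: \<beta>'_def)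
  have "H.B 0 (Suc n) = int (q 0) * Q n" for n
  proof (induction n)
    case 0
    show ?case by (simp add: H.B_Suc \<beta>')
  next
    case (Suc n)
    then show ?case by (simp add: H.B_Suc[of 0 "Suc n"] Q_Suc \<beta>')
  qed
  moreover have "q 0 \<noteq> 0" using q[of 0] by simp
  ultimately have "(\<lambda>n. a * c n) = (\<lambda>n. (a * real (q 0)) * H.d 0 n)"
    by (intro ext) (simp add: H.d_def)
  then show ?thesis using H.spectral_scaled[of "a * real (q 0)"] assms(2) \<open>q 0 \<noteq> 0\<close> by simp
qed

theorem theorem1p2:
  fixes m :: nat and b p t :: "nat \<Rightarrow> int"
  assumes "m \<ge> 1"
    and "\<And>k. k \<in> {1..m} \<Longrightarrow> \<bar>b k\<bar> \<ge> 2 \<and> p k \<ge> 2 \<and> \<bar>t k\<bar> \<ge> 1"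
    and "\<And>k i. k \<in> {1..m} \<Longrightarrow> i \<in> {1..m} \<Longrightarrow> coprime (p k) (t i)"
    and "\<And>i j. i \<in> {1..m} \<Longrightarrow> j \<in> {1..m} \<Longrightarrow> i \<noteq> j \<Longrightarrow> coprime (t i) (t j)"
  shows "\<forall>\<sigma>\<in>words m. spectral_measure (mu b p t \<sigma>) \<longleftrightarrow>
           (\<forall>n\<ge>2. p (\<sigma> n) dvd b (\<sigma> n)) \<and> \<sigma> \<notin> (\<Union>l\<in>{1..}. exceptional m b p t l)"
proof
  fix \<sigma> assume \<sigma>: "\<sigma> \<in> words m"
  interpret symbols m b p t by unfold_locales (use assms(2-4) in blast)+
  define \<tau> where "\<tau> n = \<sigma> (Suc n)" for n
  have \<tau>: "\<tau> n \<in> {1..m}" for n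
    using PiE_mem[OF \<sigma>[unfolded words_def], of "Suc n"] by (simp add: \<tau>_def)
  define \<beta> where "\<beta> n = b (\<tau> n)" for n
  define s where "s n = t (\<tau> n)" for n
  define q where "q n = nat (p (\<tau> n))" for n
  have bpt': "2 \<le> \<bar>b (\<tau> n)\<bar>" "2 \<le> p (\<tau> n)" "1 \<le> \<bar>t (\<tau> n)\<bar>" for n using bpt[OF \<tau>[of n]] by auto
  have q_p: "int (q n) = p (\<tau> n)" for n using bpt'(2)[of n] by (simp add: q_def)
  have \<beta>2: "2 \<le> \<bar>\<beta> n\<bar>" and q2: "2 \<le> q n" for n
    using bpt'[of n] by (auto simp: \<beta>_def q_def)
  have p_le: "p i \<le> (\<Sum>k\<in>{1..m}. p k)" if "i \<in> {1..m}" for i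
    using that bpt by (intro member_le_sum) force+
  have "q n \<le> nat (\<Sum>k\<in>{1..m}. p k)" for n
    unfolding q_def by (intro nat_mono p_le \<tau>)
  then have q_bdd: "\<exists>P. \<forall>n. q n \<le> P" by blast
  have moranI: "moran \<beta>' s' q" if "\<And>n. 2 \<le> \<bar>\<beta>' n\<bar>" "\<And>n. s' n \<noteq> 0" "\<And>n k. coprime (s' n) (int (q k))" for \<beta>' s'
    using that q2 q_bdd by unfold_locales auto
  have s0: "s n \<noteq> 0" and cop: "coprime (s n) (int (q k))" for n k
    using bpt'(3)[of n] coprime_pt[OF \<tau>[of k] \<tau>[of n]] by (auto simp: s_def q_p coprime_commute)
  interpret M: moran \<beta> s q by (rule moranI[OF \<beta>2 s0 cop])
  have \<beta>0: "\<beta> 0 \<noteq> 0" using \<beta>2[of 0] by auto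
  have b\<sigma>: "b (\<sigma> (Suc k)) = \<beta> k" for k by (simp add: \<beta>_def \<tau>_def)
  have "(\<Prod>k=1..Suc n. b (\<sigma> k)) = \<beta> 0 * M.Q n" for n
    by (induction n) (simp_all add: b\<sigma> M.Q_Suc)
  moreover have "q = (\<lambda>n. nat (p (\<sigma> (Suc n))))" by (simp add: q_def \<tau>_def fun_eq_iff)
  ultimately have mu: "mu b p t \<sigma> = kconv (\<lambda>n. 1 / of_int (\<beta> 0) * M.c n) q"
    using bpt'(2) unfolding \<tau>_def by (subst mu_eq_kconv) (simp_all add: s_def \<tau>_def)
  have "s n dvd S" for n unfolding s_def by (rule t_dvd_S[OF \<tau>])
  then have s_le: "\<bar>s n\<bar> \<le> S" for n using S_pos dvd_imp_le_int[of S "s n"] by auto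
  have adm: "rational_adm M.c q" by (rule M.rational_adm_c[OF s_le])
  show "spectral_measure (mu b p t \<sigma>) \<longleftrightarrow>
      (\<forall>n\<ge>2. p (\<sigma> n) dvd b (\<sigma> n)) \<and> \<sigma> \<notin> (\<Union>l\<in>{1..}. exceptional m b p t l)"
  proof
    assume spectral: "spectral_measure (mu b p t \<sigma>)"
    have "rational_adm (\<lambda>n. 1 / of_int (\<beta> 0) * M.c n) q"
      using adm \<beta>0 admissible_scale[of M.c q "1 / of_int (\<beta> 0)"] by (auto simp: rational_adm_def)
    then have "qspec (\<lambda>n. 1 / of_int (\<beta> 0) * M.c n) q"
      using spectral unfolding mu by (rule spectral_imp_qspec)
    from qspec_scale[OF this, of "of_int (\<beta> 0)"] have sp: "qspec M.c q"
      using \<beta>0 by simp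
    have "p (\<sigma> n) dvd b (\<sigma> n)" if "2 \<le> n" for n
    proof -
      have "n = Suc (Suc (n - 2))" using that by simp
      then obtain k where "n = Suc (Suc k)" ..
      then show ?thesis
        using qspec_imp_dvd[OF M.moran_axioms sp, of k] by (simp add: q_p \<beta>_def \<tau>_def)
    qed
    moreover have "\<sigma> \<notin> exceptional m b p t l" if l: "1 \<le> l" for l
    proof
      assume "\<sigma> \<in> exceptional m b p t l"
      then obtain j where j: "j \<in> {1..m}" "\<And>n. l < n \<Longrightarrow> \<sigma> n = j" "\<sigma> l \<noteq> j" "\<bar>b j\<bar> = p j" "\<bar>t j\<bar> \<noteq> 1"
        by (auto simp: exceptional_def)
      \<comment> \<open>Starting at \<open>N\<close> puts \<open>\<sigma> l\<close> on level
        \<open>0\<close> and the repeated symbol \<open>j\<close> on all later levels.\<close>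
      define N where "N = l - 1"
      have shift: "\<tau> (n + N) = \<sigma> (n + l)" for n using l by (simp add: \<tau>_def N_def)
      have "coprime (t j) (t (\<sigma> l))"
        using coprime_tt[OF j(1) \<tau>[of N]] j(3) shift[of 0] by auto
      moreover have "s (n + N) = t j \<and> q (n + N) = nat (p j) \<and> \<bar>\<beta> (n + N)\<bar> = int (nat (p j))" if "1 \<le> n" for n
        using that j(2)[of "n + l"] j(4) bpt[OF j(1)] by (simp add: s_def q_def \<beta>_def shift)
      ultimately show False
        using moran.not_qspec_exceptional[of "\<lambda>n. \<beta> (n + N)" "\<lambda>n. s (n + N)" "\<lambda>n. q (n + N)" "t j" "nat (p j)"]
          qspec_tails[OF M.moran_axioms sp, of N] j(5) shift[of 0] by (simp add: s_def)
    qed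
    ultimately show "(\<forall>n\<ge>2. p (\<sigma> n) dvd b (\<sigma> n)) \<and> \<sigma> \<notin> (\<Union>l\<in>{1..}. exceptional m b p t l)" by blast
  next
    assume rhs: "(\<forall>n\<ge>2. p (\<sigma> n) dvd b (\<sigma> n)) \<and> \<sigma> \<notin> (\<Union>l\<in>{1..}. exceptional m b p t l)"
    then have dvd: "p (\<tau> n) dvd b (\<tau> n)" if "1 \<le> n" for n using that by (simp add: \<tau>_def)
    define \<beta>' where "\<beta>' = \<beta>(0 := int (q 0))"
    \<comment> \<open>The digit numbers are included because the modified ratio
      \<open>\<beta>' 0\<close> is one of them.\<close>
    define bb where "bb = (\<Sum>k\<in>{1..m}. \<bar>b k\<bar> + p k)"
    have "\<bar>b i\<bar> + p i \<le> bb" if "i \<in> {1..m}" for i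
      unfolding bb_def using that bpt by (intro member_le_sum[where f="\<lambda>k. \<bar>b k\<bar> + p k"]) force+
    from this[OF \<tau>] have bb': "\<bar>b (\<tau> n)\<bar> + p (\<tau> n) \<le> bb" for n .
    have bb: "\<bar>\<beta>' n\<bar> \<le> bb" for n
      using bb'[of n] bpt'(2)[of n] by (auto simp: \<beta>'_def \<beta>_def q_p)
    have dvd': "int (q n) dvd \<beta>' n" for n using dvd[of n] by (simp add: q_p \<beta>'_def \<beta>_def)
    have \<beta>2': "2 \<le> \<bar>\<beta>' n\<bar>" for n using \<beta>2[of n] q2[of n] by (auto simp: \<beta>'_def)
    have prod: "(\<Prod>i\<le>k. \<beta>' (n + i)) = (\<Prod>i\<le>k. b (\<tau> (n + i)))" if "1 \<le> n" for n k
      using that by (intro prod.cong) (auto simp: \<beta>'_def \<beta>_def)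
    \<comment> \<open>The starting level is at least \<open>1\<close>, as divisibility of
      \<open>b\<close> by \<open>p\<close> is given only from there on; \<open>K\<close> has to be
      the same for all starting levels.\<close>
    have ifEP: "spectral_measure (mu b p t \<sigma>)"
      if K: "0 \<le> K" and EP: "\<And>N. \<exists>n\<ge>max N 1. \<forall>i u. i \<in> {1..m} \<longrightarrow> \<not> t i dvd u \<longrightarrow> \<bar>u\<bar> < \<bar>t i\<bar> \<longrightarrow>
        (\<exists>\<kappa>. 0 \<le> \<kappa> \<and> \<kappa> \<le> K \<and> avoids (\<lambda>k. \<tau> (n + k)) i (u + \<kappa> * t i))" for K
    proof -
      have had: "hadamard \<beta>' s q S bb ((K + 1) * S)"
      proof (intro hadamard.intro hadamard_axioms.intro moranI[OF \<beta>2' s0 cop] dvd' S_pos bb)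
        show "s n dvd S" for n unfolding s_def by (rule t_dvd_S[OF \<tau>])
        fix N
        obtain n where n: "max N 1 \<le> n" and av: "\<And>i u. i \<in> {1..m} \<Longrightarrow> \<not> t i dvd u \<Longrightarrow> \<bar>u\<bar> < \<bar>t i\<bar> \<Longrightarrow>
            (\<exists>\<kappa>. 0 \<le> \<kappa> \<and> \<kappa> \<le> K \<and> avoids (\<lambda>k. \<tau> (n + k)) i (u + \<kappa> * t i))"
          using EP[of N] by blast
        have n1: "1 \<le> n" using n by simp
        show "\<exists>n\<ge>N. \<forall>z. \<exists>w. S dvd w - z \<and> \<bar>w\<bar> \<le> (K + 1) * S \<and>
          (\<forall>k j. w * int (q (n + k)) * s (n + k) = S * (\<Prod>i\<le>k. \<beta>' (n + i)) * j \<longrightarrow> int (q (n + k)) dvd j)"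
        proof (intro exI[of _ n] conjI allI)
          show "N \<le> n" using n by simp
          fix z
          show "\<exists>w. S dvd w - z \<and> \<bar>w\<bar> \<le> (K + 1) * S \<and>
            (\<forall>k j. w * int (q (n + k)) * s (n + k) = S * (\<Prod>i\<le>k. \<beta>' (n + i)) * j \<longrightarrow> int (q (n + k)) dvd j)"
            unfolding prod[OF n1] q_p s_def using n1
            by (intro nonzero_residue[of "\<lambda>k. \<tau> (n + k)" K z, OF \<tau> dvd av K]) auto
        qed
      qed
      show ?thesis
        unfolding mu using \<beta>0 by (intro M.spectral_if_hadamard[OF had[unfolded \<beta>'_def]]) simp
    qed
    show "spectral_measure (mu b p t \<sigma>)"
    proof (cases "\<exists>n0. \<forall>n\<ge>n0. \<tau> n = \<tau> (Suc n)")
      case False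
      show ?thesis
      proof (rule ifEP)
        show "0 \<le> 2 * (\<Sum>k\<in>{1..m}. p k)" using bpt by (intro mult_nonneg_nonneg sum_nonneg) force+
        fix N
        obtain n where n: "max N 1 \<le> n" "\<tau> n \<noteq> \<tau> (Suc n)" using False by blast
        have "\<exists>\<kappa>. 0 \<le> \<kappa> \<and> \<kappa> \<le> 2 * (\<Sum>k\<in>{1..m}. p k) \<and> avoids (\<lambda>k. \<tau> (n + k)) i (u + \<kappa> * t i)"
          if i: "i \<in> {1..m}" for i u
        proof -
          have "\<exists>\<kappa>. 0 \<le> \<kappa> \<and> \<kappa> \<le> 2 * p i \<and> avoids (\<lambda>k. \<tau> (n + k)) i (u + \<kappa> * t i)"
            using n by (intro avoids_two_symbols \<tau> dvd i) auto
          then show ?thesis using p_le[OF i] by (meson mult_left_mono order_trans zero_le_numeral)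
        qed
        then show "\<exists>n\<ge>max N 1. \<forall>i u. i \<in> {1..m} \<longrightarrow> \<not> t i dvd u \<longrightarrow> \<bar>u\<bar> < \<bar>t i\<bar> \<longrightarrow>
            (\<exists>\<kappa>. 0 \<le> \<kappa> \<and> \<kappa> \<le> 2 * (\<Sum>k\<in>{1..m}. p k) \<and> avoids (\<lambda>k. \<tau> (n + k)) i (u + \<kappa> * t i))"
          using n(1) by blast
      qed
    next
      case True
      then obtain n0 where n0: "\<And>n. n0 \<le> n \<Longrightarrow> \<tau> n = \<tau> (Suc n)" by blast
      have const: "\<tau> n = \<tau> n0" if "n0 \<le> n" for n
        using that by (induction n rule: dec_induct) (auto simp: n0[symmetric])
      define i where "i = \<tau> n0"
      have im: "i \<in> {1..m}" using \<tau> by (simp add: i_def)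
      consider "\<And>n. \<tau> n = i" | n1 where "\<tau> n1 \<noteq> i" by blast
      then show ?thesis
      proof cases
        case 1
        \<comment> \<open>The common multiplier \<open>t i\<close> goes into the scaling. With
          multipliers \<open>1\<close> all zeros of the tails are nonzero integers, so
          \<open>S = 1\<close> and \<open>w = 0\<close> serves for every \<open>z\<close>.\<close>
        have had: "hadamard \<beta>' (\<lambda>_. 1) q 1 bb 0"
        proof (intro hadamard.intro hadamard_axioms.intro moranI[OF \<beta>2'] dvd' bb)
          fix N
          have j0: "j = 0" if "0 = (\<Prod>i\<le>k. \<beta>' (N + i)) * j" for k j
          proof -
            have "\<beta>' l \<noteq> 0" for l using \<beta>2'[of l] by auto
            then have "(\<Prod>i\<le>k. \<beta>' (N + i)) \<noteq> 0" by (simp only: prod_zero_iff finite_atMost) blast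
            then show ?thesis using that by (metis mult_eq_0_iff)
          qed
          show "\<exists>n\<ge>N. \<forall>z. \<exists>w. 1 dvd w - z \<and> \<bar>w\<bar> \<le> 0 \<and>
            (\<forall>k j. w * int (q (n + k)) * 1 = 1 * (\<Prod>i\<le>k. \<beta>' (n + i)) * j \<longrightarrow> int (q (n + k)) dvd j)"
          proof (intro exI[of _ N] conjI allI)
            fix z
            show "\<exists>w. 1 dvd w - z \<and> \<bar>w\<bar> \<le> 0 \<and>
              (\<forall>k j. w * int (q (N + k)) * 1 = 1 * (\<Prod>i\<le>k. \<beta>' (N + i)) * j \<longrightarrow> int (q (N + k)) dvd j)"
            proof (intro exI[of _ 0] conjI allI impI)
              fix k j assume "0 * int (q (N + k)) * 1 = 1 * (\<Prod>i\<le>k. \<beta>' (N + i)) * j"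
              then have "j = 0" by (intro j0) (simp only: mult_zero_left mult_1_left)
              then show "int (q (N + k)) dvd j" by simp
            qed auto
          qed simp
        qed auto
        interpret M1: moran \<beta> "\<lambda>_. 1" q by (rule moranI[OF \<beta>2]) auto
        have "t i \<noteq> 0" using bpt[OF im] by auto
        then have "spectral_measure (kconv (\<lambda>n. of_int (t i) / of_int (\<beta> 0) * M1.c n) q)"
          using \<beta>0 by (intro M1.spectral_if_hadamard[OF had[unfolded \<beta>'_def]]) simp
        then show ?thesis unfolding mu by (simp add: s_def 1)
      next
        case 2
        have "{n. \<tau> n \<noteq> i} \<subseteq> {..<n0}"
        proof
          fix n assume "n \<in> {n. \<tau> n \<noteq> i}"
          then have "\<not> n0 \<le> n" using const[of n] unfolding i_def by blast
          then show "n \<in> {..<n0}" by simp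
        qed
        then have fin: "finite {n. \<tau> n \<noteq> i}" by (rule finite_subset) simp
        \<comment> \<open>The last place with a symbol other than \<open>i\<close>. If
          \<open>i\<close> were inadmissible, the word would lie in the exceptional set with
          \<open>l = Suc n2\<close>; the successor appears because \<open>\<tau>\<close> starts at
          index \<open>0\<close>.\<close>
        define n2 where "n2 = Max {n. \<tau> n \<noteq> i}"
        have "n2 \<in> {n. \<tau> n \<noteq> i}" unfolding n2_def using fin 2 by (intro Max_in) blast+
        then have n2: "\<tau> n2 \<noteq> i" by simp
        have after: "\<tau> n = i" if "n2 < n" for n
        proof (rule ccontr)
          assume "\<tau> n \<noteq> i"
          then have "n \<le> n2" unfolding n2_def using fin by (intro Max_ge) auto
          then show False using that by simp
        qed
        have good: "\<bar>b i\<bar> \<noteq> p i \<or> \<bar>t i\<bar> = 1"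
        proof (rule ccontr)
          assume "\<not> ?thesis"
          moreover have "\<sigma> n = i" if "Suc n2 < n" for n using after[of "n - 1"] that by (simp add: \<tau>_def)
          moreover have "\<sigma> (Suc n2) \<noteq> i" using n2 by (simp add: \<tau>_def)
          ultimately have "\<sigma> \<in> exceptional m b p t (Suc n2)"
            using \<sigma> im unfolding exceptional_def by blast
          then show False using rhs by auto
        qed
        show ?thesis
        proof (rule ifEP)
          show "0 \<le> p i ^ nat \<bar>t i\<bar>" using bpt[OF im] by auto
          fix N
          define n where "n = max (max N 1) (Suc n2)"
          have n: "max N 1 \<le> n" "1 \<le> n" and \<tau>n: "(\<lambda>k. \<tau> (n + k)) = (\<lambda>_. i)"
            using after by (auto simp: n_def fun_eq_iff)
          have pos: "0 \<le> p i ^ nat \<bar>t i\<bar>" using bpt[OF im] by auto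
          have "\<exists>\<kappa>. 0 \<le> \<kappa> \<and> \<kappa> \<le> p i ^ nat \<bar>t i\<bar> \<and> avoids (\<lambda>k. \<tau> (n + k)) k (u + \<kappa> * t k)"
            if k: "k \<in> {1..m}" "\<not> t k dvd u" "\<bar>u\<bar> < \<bar>t k\<bar>" for k u
          proof (cases "k = i")
            case True
            have "\<bar>t i\<bar> \<noteq> 1" using k(2) unit_imp_dvd[of "t i" u] True by auto
            then have "\<bar>b i\<bar> \<noteq> p i" using good by simp
            moreover have "p i dvd b i" using dvd[OF n(2)] fun_cong[OF \<tau>n, of 0] by simp
            ultimately show ?thesis unfolding \<tau>n True using k(3) True by (intro avoids_constant im) auto
          next
            case False
            \<comment> \<open>The symbol \<open>k\<close> no longer occurs from level
              \<open>n\<close> on, so there is nothing to avoid.\<close>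
            then have "avoids (\<lambda>k. \<tau> (n + k)) k (u + 0 * t k)" unfolding \<tau>n avoids_def by simp
            then show ?thesis using pos by blast
          qed
          then show "\<exists>n\<ge>max N 1. \<forall>k u. k \<in> {1..m} \<longrightarrow> \<not> t k dvd u \<longrightarrow> \<bar>u\<bar> < \<bar>t k\<bar> \<longrightarrow>
              (\<exists>\<kappa>. 0 \<le> \<kappa> \<and> \<kappa> \<le> p i ^ nat \<bar>t i\<bar> \<and> avoids (\<lambda>k. \<tau> (n + k)) k (u + \<kappa> * t k))"
            using n(1) by blast
        qed
      qed
    qed
  qed
qed

end
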